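(* Let $p,q>0$ and $a\in\mathbb{R}$, let $(W_t)_{t\ge 0}$, $(W^{(1)}_t)_{t\ge 0}$, $(W^{(2)}_t)_{t\ge 0}$ be three independent standard one-dimensional Brownian motions (started at $0$), and for $t\ge 0$ set $$Z_t = a\,t + W_t,\qquad X_t=\int_0^t e^{pZ_s}\,dW^{(1)}_s,\qquad Y_t=\int_0^t e^{-qZ_s}\,dW^{(2)}_s .$$ Let $\mathcal N=W_1$, $\underline{\mathcal M}=\min\{W_t:0\le t\le 1\}$ and $\overline{\mathcal M}=\max\{W_t:0\le t\le 1\}$. (i) If $a>0$, then as $t\to\infty$, $$\frac{1}{\sqrt t}\Bigl(\log|X_t|-p\,a\,t,\ \log|Y_t|,\ Z_t-a\,t\Bigr)\to (p\,\mathcal N,\,0,\,\mathcal N)\quad\text{in law.}$$ (ii) If $a<0$, then as $t\to\infty$, $$\frac{1}{\sqrt t}\Bigl(\log|X_t|,\ \log|Y_t|+q\,a\,t,\ Z_t-a\,t\Bigr)\to (0,\,-q\,\mathcal N,\,\mathcal N)\quad\text{in law.}$$ (iii) If $a=0$, then as $t\to\infty$, $$\frac{1}{\sqrt t}\Bigl(\log|X_t|,\ \log|Y_t|,\ Z_t\Bigr)\to (p\,\overline{\mathcal M},\,-q\,\underline{\mathcal M},\,\mathcal N)\quad\text{in law.}$$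
   Context: The integrals are Itô stochastic integrals. The process $(X_t,Y_t,Z_t)$ is the diffusion on $\mathrm{Sol}(p,q)\equiv\mathbb{R}^3$ started at $(0,0,0)$ with infinitesimal generator $$\frac12\Bigl(e^{2pz}\frac{\partial^2}{\partial x^2}+e^{-2qz}\frac{\partial^2}{\partial y^2}+\frac{\partial^2}{\partial z^2}\Bigr)+a\,\frac{\partial}{\partial z}.$$ Convergence in law is joint convergence in distribution of $\mathbb{R}^3$-valued random vectors. *)

theory Defs
  imports "HOL-Probability.Probability"
begin

text \<open>
  Processes are functions \<open>real \<Rightarrow> 'a \<Rightarrow> _\<close>, time first; only times \<open>t \<ge> 0\<close> are ever constrained.
\<close>

definition brownian_motion :: "'a measure \<Rightarrow> (real \<Rightarrow> 'a \<Rightarrow> real) \<Rightarrow> bool" where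
  "brownian_motion M B \<longleftrightarrow>
     prob_space M \<and>
     (\<forall>t\<ge>0. B t \<in> borel_measurable M) \<and>
     (AE \<omega> in M. B 0 \<omega> = 0) \<and>
     (\<forall>\<omega>\<in>space M. continuous_on {0..} (\<lambda>t. B t \<omega>)) \<and>
     (\<forall>s t. 0 \<le> s \<and> s < t \<longrightarrow>
        distributed M lborel (\<lambda>\<omega>. B t \<omega> - B s \<omega>) (normal_density 0 (sqrt (t - s)))) \<and>
     (\<forall>(n::nat) \<tau>. 0 \<le> \<tau> 0 \<and> (\<forall>i<n. \<tau> i < \<tau> (Suc i)) \<longrightarrow>
        prob_space.indep_vars M (\<lambda>_. borel) (\<lambda>i \<omega>. B (\<tau> (Suc i)) \<omega> - B (\<tau> i) \<omega>) {..<n})"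

text \<open>Mutual independence of whole processes, i.e. of the induced random elements of the path
  space \<open>\<real>\<^bsup>[0,\<infinity>)\<^esup>\<close> with its product sigma-algebra.\<close>

definition indep_processes :: "'a measure \<Rightarrow> ('i \<Rightarrow> real \<Rightarrow> 'a \<Rightarrow> real) \<Rightarrow> 'i set \<Rightarrow> bool" where
  "indep_processes M B I \<longleftrightarrow>
     prob_space.indep_vars M (\<lambda>_. \<Pi>\<^sub>M t\<in>{0..}. borel) (\<lambda>i \<omega>. \<lambda>t\<in>{0..}. B i t \<omega>) I"

definition natural_filtration ::
    "'a measure \<Rightarrow> (real \<Rightarrow> 'a \<Rightarrow> 'b::topological_space) \<Rightarrow> real \<Rightarrow> 'a measure" where
  "natural_filtration M B t =
     sigma (space M) {B s -` A \<inter> space M | s A. 0 \<le> s \<and> s \<le> t \<and> A \<in> sets borel}"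

text \<open>
  The square-integrable theory of the Ito integral over \<open>[0,T]\<close>. It is meant for a Brownian motion
  \<open>B\<close> relative to the filtration \<open>F\<close> (\<open>B\<close> adapted, future increments independent of \<open>F s\<close>).
  A simple process \<open>(n, \<tau>, \<xi>)\<close> stands for the sum over \<open>i < n\<close> of \<open>\<xi> i\<close> times the indicator of
  \<open>(\<tau> i, \<tau> (i + 1)]\<close>, where \<open>\<xi> i\<close> is known at the left endpoint \<open>\<tau> i\<close>.
\<close>

definition simple_process ::
    "'a measure \<Rightarrow> (real \<Rightarrow> 'a measure) \<Rightarrow> real \<Rightarrow> nat \<Rightarrow> (nat \<Rightarrow> real) \<Rightarrow> (nat \<Rightarrow> 'a \<Rightarrow> real) \<Rightarrow> bool" where
  "simple_process M F T n \<tau> \<xi> \<longleftrightarrow>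
     0 \<le> \<tau> 0 \<and> (\<forall>i<n. \<tau> i \<le> \<tau> (Suc i)) \<and> \<tau> n \<le> T \<and>
     (\<forall>i<n. \<xi> i \<in> borel_measurable (F (\<tau> i)) \<and> bounded (\<xi> i ` space M))"

definition simple_value ::
    "nat \<Rightarrow> (nat \<Rightarrow> real) \<Rightarrow> (nat \<Rightarrow> 'a \<Rightarrow> real) \<Rightarrow> real \<Rightarrow> 'a \<Rightarrow> real" where
  "simple_value n \<tau> \<xi> s \<omega> = (\<Sum>i<n. \<xi> i \<omega> * indicator {\<tau> i<..\<tau> (Suc i)} s)"

definition simple_integral ::
    "(real \<Rightarrow> 'a \<Rightarrow> real) \<Rightarrow> nat \<Rightarrow> (nat \<Rightarrow> real) \<Rightarrow> (nat \<Rightarrow> 'a \<Rightarrow> real) \<Rightarrow> 'a \<Rightarrow> real" where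
  "simple_integral B n \<tau> \<xi> \<omega> = (\<Sum>i<n. \<xi> i \<omega> * (B (\<tau> (Suc i)) \<omega> - B (\<tau> i) \<omega>))"

definition ito_integrand ::
    "'a measure \<Rightarrow> (real \<Rightarrow> 'a measure) \<Rightarrow> real \<Rightarrow> (real \<Rightarrow> 'a \<Rightarrow> real) \<Rightarrow> bool" where
  "ito_integrand M F T H \<longleftrightarrow>
     (\<lambda>(s, \<omega>). H s \<omega>) \<in> borel_measurable (restrict_space borel {0..T} \<Otimes>\<^sub>M M) \<and>
     (\<forall>s\<in>{0..T}. H s \<in> borel_measurable (F s)) \<and>
     (\<integral>\<^sup>+\<omega>. (\<integral>\<^sup>+s\<in>{0..T}. ennreal ((H s \<omega>)\<^sup>2) \<partial>lborel) \<partial>M) < \<infinity>"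

text \<open>
  \<open>J\<close> is a version of \<open>\<integral>\<^sub>0\<^sup>T H dB\<close>: the \<open>L\<^sup>2\<close>-limit of the integrals of simple processes
  approximating \<open>H\<close> in \<open>L\<^sup>2([0,T] \<times> \<Omega>)\<close>. As usual, \<open>J\<close> is determined only almost surely.
\<close>

definition has_ito_integral ::
    "'a measure \<Rightarrow> (real \<Rightarrow> 'a measure) \<Rightarrow> (real \<Rightarrow> 'a \<Rightarrow> real) \<Rightarrow> (real \<Rightarrow> 'a \<Rightarrow> real) \<Rightarrow> real
      \<Rightarrow> ('a \<Rightarrow> real) \<Rightarrow> bool" where
  "has_ito_integral M F B H T J \<longleftrightarrow>
     ito_integrand M F T H \<and> J \<in> borel_measurable M \<and>
     (\<exists>n \<tau> \<xi>.
        (\<forall>k::nat. simple_process M F T (n k) (\<tau> k) (\<xi> k)) \<and>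
        (\<lambda>k. \<integral>\<^sup>+\<omega>. (\<integral>\<^sup>+s\<in>{0..T}. ennreal ((H s \<omega> - simple_value (n k) (\<tau> k) (\<xi> k) s \<omega>)\<^sup>2)
              \<partial>lborel) \<partial>M) \<longlonglongrightarrow> 0 \<and>
        (\<lambda>k. \<integral>\<^sup>+\<omega>. ennreal ((J \<omega> - simple_integral B (n k) (\<tau> k) (\<xi> k) \<omega>)\<^sup>2) \<partial>M) \<longlonglongrightarrow> 0)"

text \<open>The measurability clauses matter: the Bochner integral of a non-measurable function is \<open>0\<close>.\<close>

definition converges_in_law ::
    "'a measure \<Rightarrow> ('t \<Rightarrow> 'a \<Rightarrow> 'b::metric_space) \<Rightarrow> 'c measure \<Rightarrow> ('c \<Rightarrow> 'b) \<Rightarrow> 't filter \<Rightarrow> bool" where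
  "converges_in_law M V N L G \<longleftrightarrow>
     (\<forall>\<^sub>F t in G. V t \<in> borel_measurable M) \<and> L \<in> borel_measurable N \<and>
     (\<forall>f::'b \<Rightarrow> real. continuous_on UNIV f \<and> bounded (range f) \<longrightarrow>
        ((\<lambda>t. \<integral>\<omega>. f (V t \<omega>) \<partial>M) \<longlongrightarrow> (\<integral>\<omega>. f (L \<omega>) \<partial>N)) G)"

end

theory Submission
  imports Defs "HOL-Real_Asymp.Real_Asymp"
begin

text \<open>
  Why the theorem holds. Given the path of \<open>W\<close>, the integral \<open>X t = \<integral>\<^sub>0\<^sup>t exp (p Z) dW1\<close> is a centred
  Gaussian variable whose variance \<open>A t = \<integral>\<^sub>0\<^sup>t exp (2 p Z s) ds\<close> is a functional of \<open>W\<close> alone. So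
  \<open>X t / sqrt (A t)\<close> is standard normal for every \<open>t\<close>, and \<open>ln \<bar>X t\<bar>\<close> differs from \<open>ln (A t) / 2\<close> by a
  random variable whose law does not depend on \<open>t\<close>. After division by \<open>sqrt t\<close> this difference
  disappears in probability, and likewise for \<open>Y t\<close>. What remains is a statement about exponential
  functionals of one Brownian motion with drift.

  By Brownian scaling \<open>A t\<close> has, jointly with its analogue for \<open>Y\<close> and with \<open>W t\<close>, the law of
  \<open>t \<integral>\<^sub>0\<^sup>1 exp (2 p (a t s + sqrt t W s)) ds\<close>. For each fixed continuous path the Laplace method gives
  the growth of this integral: on the scale \<open>sqrt t\<close> the exponent \<open>sqrt t a s + W s\<close> is maximal at
  the end point \<open>s = 1\<close> if \<open>a > 0\<close>, at \<open>s = 0\<close> if \<open>a < 0\<close>, and where \<open>W\<close> is maximal if \<open>a = 0\<close>.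
  For \<open>Y\<close>, where \<open>- q\<close> replaces \<open>p\<close>, the end points change places and a minimum of \<open>W\<close> replaces
  the maximum. So the expressions built from the scaled path converge almost surely, hence in law.

  The first step rests on \<open>ito_integral_self_normalized\<close>, applied to the filtration enlarged by the
  whole paths of the other two Brownian motions. In the enlarged filtration \<open>A t\<close> is known at time \<open>0\<close>, so
  integrands may be divided by \<open>sqrt (A t)\<close>, while increments of the integrator stay independent of the
  past (\<open>insider_filtration_indep_increment\<close>). Exponential martingales of the normalized simple
  integrals then identify the characteristic function of \<open>X t / sqrt (A t)\<close>. The scaling step is
  \<open>brownian_motion_scaling\<close>, the pathwise asymptotics come from \<open>laplace_method\<close>, and
  \<open>converges_in_law_slutsky\<close> glues the parts together.
\<close>

section \<open>Independence of future increments from an enlarged filtration\<close>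

lemma brownian_motion_measurable:
  "brownian_motion M B \<Longrightarrow> 0 \<le> t \<Longrightarrow> B t \<in> borel_measurable M"
  by (simp add: brownian_motion_def)

lemma sets_Collect_preimage:
  "f \<in> measurable M N \<Longrightarrow> C \<in> sets N \<Longrightarrow> {x\<in>space M. f x \<in> C} \<in> sets M"
  by (drule measurable_sets[of f M N C]) (auto simp: vimage_def Int_def conj_commute)

text \<open>
  A finite set of times up to \<open>s\<close> is turned into a partition of \<open>[0, t]\<close> that contains \<open>0\<close>, \<open>s\<close> and
  \<open>t\<close>. The values of \<open>B\<close> at the chosen times are then partial sums of increments up to \<open>s\<close>, because
  \<open>B 0 = 0\<close> almost surely, and the last increment is independent of the earlier ones.
\<close>
lemma brownian_motion_past_indep_increment:
  assumes B: "brownian_motion M B" and st: "0 \<le> s" "s < t"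
    and J: "finite J" "J \<subseteq> {0..s}" and E: "\<And>r. r \<in> J \<Longrightarrow> E r \<in> sets borel"
    and C: "C \<in> sets borel"
  shows "measure M {\<omega>\<in>space M. (\<forall>r\<in>J. B r \<omega> \<in> E r) \<and> B t \<omega> - B s \<omega> \<in> C} =
    measure M {\<omega>\<in>space M. \<forall>r\<in>J. B r \<omega> \<in> E r} * measure M {\<omega>\<in>space M. B t \<omega> - B s \<omega> \<in> C}"
proof -
  interpret prob_space M using B by (simp add: brownian_motion_def)
  have [measurable]: "B r \<in> borel_measurable M" if "0 \<le> r" for r
    using B that by (simp add: brownian_motion_def)
  define R where "R = insert 0 (insert s J)"
  have R: "finite R" "R \<noteq> {}" using J by (auto simp: R_def)
  define n where "n = card R - 1"
  define l where "l = sorted_list_of_set R"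
  have l: "length l = Suc n" "set l = R" "sorted_wrt (<) l"
    using R by (auto simp: l_def n_def Suc_diff_1 card_gt_0_iff)
  define \<tau> where "\<tau> i = (if i \<le> n then l ! i else t)" for i
  have mono: "\<tau> i < \<tau> (Suc i)" if "i < n" for i
    using l that sorted_wrt_nth_less[of "(<)" l i "Suc i"] by (auto simp: \<tau>_def)
  have ge0: "0 \<le> \<tau> i" if "i \<le> n" for i
    using l that nth_mem[of i l] J st by (auto simp: \<tau>_def R_def)
  have \<tau>0: "\<tau> 0 = 0"
  proof -
    have "0 \<in> set l" using l by (simp add: R_def)
    then obtain i where i: "i < length l" "l ! i = 0" by (metis in_set_conv_nth)
    then have "l ! 0 \<le> 0"
      using l sorted_wrt_nth_less[of "(<)" l 0 i] by (cases "i = 0") auto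
    then show ?thesis using ge0[of 0] by (simp add: \<tau>_def)
  qed
  have \<tau>n: "\<tau> n = s"
  proof -
    have "s \<in> set l" using l by (simp add: R_def)
    then obtain i where i: "i < length l" "l ! i = s" by (metis in_set_conv_nth)
    then have "s \<le> l ! n"
      using l sorted_wrt_nth_less[of "(<)" l i n] by (cases "i = n") auto
    moreover have "l ! n \<in> R" using l nth_mem[of n l] by simp
    then have "l ! n \<le> s" using J st by (auto simp: R_def)
    ultimately show ?thesis by (simp add: \<tau>_def)
  qed
  have \<tau>Sn: "\<tau> (Suc n) = t" by (simp add: \<tau>_def)
  have mono': "\<tau> i < \<tau> (Suc i)" if "i < Suc n" for i
    using mono[of i] that \<tau>n \<tau>Sn st by (cases "i = n") auto
  define D where "D i \<omega> = B (\<tau> (Suc i)) \<omega> - B (\<tau> i) \<omega>" for i \<omega>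
  have "indep_vars (\<lambda>_. borel) D {..<Suc n}"
  proof -
    have "0 \<le> \<tau> 0 \<and> (\<forall>i<Suc n. \<tau> i < \<tau> (Suc i))" using \<tau>0 mono' by auto
    then show ?thesis using B unfolding brownian_motion_def D_def[abs_def] by blast
  qed
  then have ind: "indep_var (PiM {..<n} (\<lambda>_. borel)) (\<lambda>\<omega>. \<lambda>i\<in>{..<n}. D i \<omega>)
      (PiM {n} (\<lambda>_. borel)) (\<lambda>\<omega>. \<lambda>i\<in>{n}. D i \<omega>)"
    by (rule indep_var_restrict) auto
  have "\<exists>i\<le>n. \<tau> i = r" if "r \<in> J" for r
  proof -
    have "r \<in> set l" using l that by (simp add: R_def)
    then obtain i where "i < length l" "l ! i = r" by (metis in_set_conv_nth)
    then show ?thesis using l by (intro exI[of _ i]) (auto simp: \<tau>_def)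
  qed
  then obtain idx where idx: "\<And>r. r \<in> J \<Longrightarrow> idx r \<le> n \<and> \<tau> (idx r) = r" by metis
  define A1 where "A1 = {x\<in>space (PiM {..<n} (\<lambda>_. borel::real measure)). \<forall>r\<in>J. (\<Sum>j<idx r. x j) \<in> E r}"
  define A2 where "A2 = {x\<in>space (PiM {n} (\<lambda>_. borel::real measure)). x n \<in> C}"
  have [measurable]: "(\<lambda>x. \<Sum>j<idx r. x j) \<in> borel_measurable (PiM {..<n} (\<lambda>_. borel::real measure))" if "r \<in> J" for r
    using idx[OF that] by (intro borel_measurable_sum) auto
  have A1: "A1 \<in> sets (PiM {..<n} (\<lambda>_. borel))"
    unfolding A1_def using E J by (intro sets.sets_Collect_finite_All sets_Collect_preimage[where N=borel]) auto
  have A2: "A2 \<in> sets (PiM {n} (\<lambda>_. borel))"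
    unfolding A2_def using C by (intro sets_Collect_preimage[where N=borel]) auto
  have sum: "(\<Sum>j<idx r. D j \<omega>) = B r \<omega> - B 0 \<omega>" if "r \<in> J" for r \<omega>
    using sum_lessThan_telescope[of "\<lambda>i. B (\<tau> i) \<omega>" "idx r"] idx[OF that] \<tau>0 by (simp add: D_def)
  have e1: "((\<lambda>\<omega>. \<lambda>i\<in>{..<n}. D i \<omega>) -` A1 \<inter> space M) = {\<omega>\<in>space M. \<forall>r\<in>J. B r \<omega> - B 0 \<omega> \<in> E r}"
  proof -
    have "(\<Sum>j<idx r. (\<lambda>i\<in>{..<n}. D i \<omega>) j) = B r \<omega> - B 0 \<omega>" if "r \<in> J" for r \<omega>
      unfolding sum[OF that, symmetric] using idx[OF that] by (intro sum.cong) auto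
    then show ?thesis by (auto simp: A1_def space_PiM)
  qed
  have e2: "((\<lambda>\<omega>. \<lambda>i\<in>{n}. D i \<omega>) -` A2 \<inter> space M) = {\<omega>\<in>space M. B t \<omega> - B s \<omega> \<in> C}"
    by (auto simp: A2_def space_PiM D_def \<tau>n \<tau>Sn)
  have "prob ((\<lambda>\<omega>. (\<lambda>i\<in>{..<n}. D i \<omega>, \<lambda>i\<in>{n}. D i \<omega>)) -` (A1 \<times> A2) \<inter> space M) =
      prob ((\<lambda>\<omega>. \<lambda>i\<in>{..<n}. D i \<omega>) -` A1 \<inter> space M) * prob ((\<lambda>\<omega>. \<lambda>i\<in>{n}. D i \<omega>) -` A2 \<inter> space M)"
    by (rule indep_varD[OF ind A1 A2])
  also have "(\<lambda>\<omega>. (\<lambda>i\<in>{..<n}. D i \<omega>, \<lambda>i\<in>{n}. D i \<omega>)) -` (A1 \<times> A2) \<inter> space M =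
     ((\<lambda>\<omega>. \<lambda>i\<in>{..<n}. D i \<omega>) -` A1 \<inter> space M) \<inter> ((\<lambda>\<omega>. \<lambda>i\<in>{n}. D i \<omega>) -` A2 \<inter> space M)"
    by auto
  finally have 1: "prob ({\<omega>\<in>space M. \<forall>r\<in>J. B r \<omega> - B 0 \<omega> \<in> E r} \<inter> {\<omega>\<in>space M. B t \<omega> - B s \<omega> \<in> C}) =
      prob {\<omega>\<in>space M. \<forall>r\<in>J. B r \<omega> - B 0 \<omega> \<in> E r} * prob {\<omega>\<in>space M. B t \<omega> - B s \<omega> \<in> C}"
    unfolding e1 e2 .
  \<comment> \<open>So far the values are relative to \<open>B 0\<close>, which vanishes almost surely.\<close>
  have B0: "AE \<omega> in M. B 0 \<omega> = 0" using B by (simp add: brownian_motion_def)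
  have [measurable]: "{\<omega>\<in>space M. B t \<omega> - B s \<omega> \<in> C} \<in> sets M"
    using st C by (intro sets_Collect_preimage[where N=borel]) auto
  have [measurable]: "{\<omega>\<in>space M. \<forall>r\<in>J. B r \<omega> - B 0 \<omega> \<in> E r} \<in> sets M"
    using E J by (intro sets.sets_Collect_finite_All sets_Collect_preimage[where N=borel]) auto
  have [measurable]: "{\<omega>\<in>space M. \<forall>r\<in>J. B r \<omega> \<in> E r} \<in> sets M"
    using E J by (intro sets.sets_Collect_finite_All sets_Collect_preimage[where N=borel]) auto
  have "prob {\<omega>\<in>space M. \<forall>r\<in>J. B r \<omega> \<in> E r} = prob {\<omega>\<in>space M. \<forall>r\<in>J. B r \<omega> - B 0 \<omega> \<in> E r}"
    using B0 by (intro finite_measure_eq_AE) auto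
  moreover have "prob ({\<omega>\<in>space M. \<forall>r\<in>J. B r \<omega> \<in> E r} \<inter> {\<omega>\<in>space M. B t \<omega> - B s \<omega> \<in> C}) =
     prob ({\<omega>\<in>space M. \<forall>r\<in>J. B r \<omega> - B 0 \<omega> \<in> E r} \<inter> {\<omega>\<in>space M. B t \<omega> - B s \<omega> \<in> C})"
    using B0 by (intro finite_measure_eq_AE) auto
  moreover have "{\<omega>\<in>space M. (\<forall>r\<in>J. B r \<omega> \<in> E r) \<and> B t \<omega> - B s \<omega> \<in> C} =
     {\<omega>\<in>space M. \<forall>r\<in>J. B r \<omega> \<in> E r} \<inter> {\<omega>\<in>space M. B t \<omega> - B s \<omega> \<in> C}" by auto
  ultimately show ?thesis using 1 by simp
qed

text \<open>
  Independence checked on an intersection-stable generator. The conclusion is spelled out as a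
  product of probabilities since \<open>indep_var\<close> forces both variables to take values in one type.
\<close>
lemma (in prob_space) prob_factorizes_generator:
  assumes X: "random_variable S X" and Y: "random_variable T Y"
    and gen: "sets S = sigma_sets (space S) E" "Int_stable E"
    and eq: "\<And>A C. A \<in> E \<Longrightarrow> C \<in> sets T \<Longrightarrow>
      prob {\<omega>\<in>space M. X \<omega> \<in> A \<and> Y \<omega> \<in> C} = prob {\<omega>\<in>space M. X \<omega> \<in> A} * prob {\<omega>\<in>space M. Y \<omega> \<in> C}"
    and AC: "A \<in> sets S" "C \<in> sets T"
  shows "prob {\<omega>\<in>space M. X \<omega> \<in> A \<and> Y \<omega> \<in> C} = prob {\<omega>\<in>space M. X \<omega> \<in> A} * prob {\<omega>\<in>space M. Y \<omega> \<in> C}"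
proof -
  let ?A = "{X -` A \<inter> space M | A. A \<in> E}" and ?B = "{Y -` C \<inter> space M | C. C \<in> sets T}"
  have "indep_set ?A ?B"
    unfolding indep_sets2_eq
  proof (intro conjI ballI)
    show "?A \<subseteq> events" using X gen(1) by (auto intro!: measurable_sets[OF X])
    show "?B \<subseteq> events" using Y by (auto intro!: measurable_sets[OF Y])
    fix a b assume "a \<in> ?A" "b \<in> ?B"
    then obtain A C where ab: "A \<in> E" "C \<in> sets T" "a = X -` A \<inter> space M" "b = Y -` C \<inter> space M" by auto
    have "a \<inter> b = {\<omega>\<in>space M. X \<omega> \<in> A \<and> Y \<omega> \<in> C}" "a = {\<omega>\<in>space M. X \<omega> \<in> A}" "b = {\<omega>\<in>space M. Y \<omega> \<in> C}"
      using ab by auto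
    then show "prob (a \<inter> b) = prob a * prob b" using eq[OF ab(1,2)] by simp
  qed
  moreover have "Int_stable ?A"
    unfolding Int_stable_def
  proof safe
    fix A A' assume "A \<in> E" "A' \<in> E"
    then have "A \<inter> A' \<in> E" using gen(2) by (auto simp: Int_stable_def)
    then show "\<exists>B. X -` A \<inter> space M \<inter> (X -` A' \<inter> space M) = X -` B \<inter> space M \<and> B \<in> E"
      by (intro exI[of _ "A \<inter> A'"]) auto
  qed
  moreover have "Int_stable ?B"
    unfolding Int_stable_def
  proof safe
    fix A A' assume "A \<in> sets T" "A' \<in> sets T"
    then show "\<exists>B. Y -` A \<inter> space M \<inter> (Y -` A' \<inter> space M) = Y -` B \<inter> space M \<and> B \<in> sets T"
      by (intro exI[of _ "A \<inter> A'"]) auto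
  qed
  ultimately have "indep_set (sigma_sets (space M) ?A) (sigma_sets (space M) ?B)"
    by (rule indep_set_sigma_sets)
  moreover have "X -` A \<inter> space M \<in> sigma_sets (space M) ?A"
    using sigma_sets_vimage_commute[of X "space M" "space S" E] measurable_space[OF X] AC gen(1) by auto
  moreover have "Y -` C \<inter> space M \<in> sigma_sets (space M) ?B" using AC by auto
  ultimately have "prob ((X -` A \<inter> space M) \<inter> (Y -` C \<inter> space M)) = prob (X -` A \<inter> space M) * prob (Y -` C \<inter> space M)"
    unfolding indep_sets2_eq by blast
  moreover have "(X -` A \<inter> space M) \<inter> (Y -` C \<inter> space M) = {\<omega>\<in>space M. X \<omega> \<in> A \<and> Y \<omega> \<in> C}"
    "X -` A \<inter> space M = {\<omega>\<in>space M. X \<omega> \<in> A}" "Y -` C \<inter> space M = {\<omega>\<in>space M. Y \<omega> \<in> C}" by auto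
  ultimately show ?thesis by simp
qed

definition insider_index :: "'i set \<Rightarrow> 'i \<Rightarrow> real \<Rightarrow> ('i \<times> real) set" where
  "insider_index I k s = {(i, r). i \<in> I \<and> 0 \<le> r \<and> (i = k \<longrightarrow> r \<le> s)}"

text \<open>
  The enlarged filtration: at time \<open>s\<close> an insider knows the \<open>k\<close>-th process up to time \<open>s\<close>, and all
  other processes for the whole of \<open>[0, \<infinity>)\<close>.
\<close>
definition insider_filtration ::
  "'a measure \<Rightarrow> ('i \<Rightarrow> real \<Rightarrow> 'a \<Rightarrow> real) \<Rightarrow> 'i set \<Rightarrow> 'i \<Rightarrow> real \<Rightarrow> 'a measure" where
  "insider_filtration M P I k s = vimage_algebra (space M)
     (\<lambda>\<omega>. \<lambda>(i, r)\<in>insider_index I k s. P i r \<omega>) (PiM (insider_index I k s) (\<lambda>_. borel))"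

lemma space_insider_filtration [simp]: "space (insider_filtration M P I k s) = space M"
  by (simp add: insider_filtration_def)

lemma insider_filtration_measurable:
  assumes "(i, r) \<in> insider_index I k s"
  shows "P i r \<in> borel_measurable (insider_filtration M P I k s)"
proof -
  let ?I = "insider_index I k s"
  have "(\<lambda>\<omega>. \<lambda>(i, r)\<in>?I. P i r \<omega>) \<in> measurable (insider_filtration M P I k s) (PiM ?I (\<lambda>_. borel))"
    unfolding insider_filtration_def
    by (rule measurable_vimage_algebra1) (auto simp: space_PiM)
  then have "(\<lambda>\<omega>. (\<lambda>(i, r)\<in>?I. P i r \<omega>) (i, r)) \<in> borel_measurable (insider_filtration M P I k s)"
    using assms by (rule measurable_compose[OF _ measurable_component_singleton])
  then show ?thesis using assms by simp
qed

lemma restricted_path_in_space_PiM: "(\<lambda>\<omega>. \<lambda>(i, r)\<in>I. P i r \<omega>) \<in> \<Omega> \<rightarrow> space (PiM I (\<lambda>_. borel))"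
  by (auto simp: space_PiM)

lemma insider_filtration_mono:
  assumes "s \<le> s'" shows "sets (insider_filtration M P I k s) \<subseteq> sets (insider_filtration M P I k s')"
proof -
  have sub: "insider_index I k s \<subseteq> insider_index I k s'" using assms by (auto simp: insider_index_def)
  have "(\<lambda>\<omega>. \<lambda>(i, r)\<in>insider_index I k s. P i r \<omega>) \<in>
    measurable (insider_filtration M P I k s') (PiM (insider_index I k s) (\<lambda>_. borel))"
    using sub by (intro measurable_restrict) (auto simp: split_beta intro!: insider_filtration_measurable)
  then show ?thesis
    unfolding insider_filtration_def[of M P I k s]
    by (auto simp: sets_vimage_algebra2[OF restricted_path_in_space_PiM] dest: measurable_sets)
qed

lemma insider_filtration_subset_events:
  assumes "\<And>i r. i \<in> I \<Longrightarrow> 0 \<le> r \<Longrightarrow> P i r \<in> borel_measurable M"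
  shows "sets (insider_filtration M P I k s) \<subseteq> sets M"
proof -
  have "(\<lambda>\<omega>. \<lambda>(i, r)\<in>insider_index I k s. P i r \<omega>) \<in> measurable M (PiM (insider_index I k s) (\<lambda>_. borel))"
    using assms by (intro measurable_restrict) (auto simp: split_beta insider_index_def)
  then show ?thesis
    unfolding insider_filtration_def
    by (auto simp: sets_vimage_algebra2[OF restricted_path_in_space_PiM] dest: measurable_sets)
qed

text \<open>
  Independence of the sigma-algebra \<open>G s\<close> from the increment, in the form needed for Fubini: the
  joint law of \<open>\<omega>\<close>, seen through \<open>G s\<close>, and the increment is a product measure. A cylinder event
  for the insider splits into one event for each process. Only the factor of the \<open>k\<close>-th process
  interacts with the increment, so independence of the processes reduces the claim to
  \<open>brownian_motion_past_indep_increment\<close>.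
\<close>
lemma insider_filtration_indep_increment:
  fixes P :: "'i \<Rightarrow> real \<Rightarrow> 'a \<Rightarrow> real"
  assumes ind: "indep_processes M P I" and I: "finite I" "k \<in> I"
    and B: "brownian_motion M (P k)" and st: "0 \<le> s" "s < t"
    and meas: "\<And>i r. i \<in> I \<Longrightarrow> 0 \<le> r \<Longrightarrow> P i r \<in> borel_measurable M"
  shows "distr M (insider_filtration M P I k s \<Otimes>\<^sub>M borel) (\<lambda>\<omega>. (\<omega>, P k t \<omega> - P k s \<omega>)) =
    distr M (insider_filtration M P I k s) (\<lambda>\<omega>. \<omega>) \<Otimes>\<^sub>M distr M borel (\<lambda>\<omega>. P k t \<omega> - P k s \<omega>)"
proof -
  interpret prob_space M using B by (simp add: brownian_motion_def)
  let ?S = "insider_index I k s" and ?G = "insider_filtration M P I k s"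
  define X where "X = (\<lambda>\<omega>. \<lambda>(i, r)\<in>?S. P i r \<omega>)"
  define D where "D = (\<lambda>\<omega>. P k t \<omega> - P k s \<omega>)"
  let ?path = "\<lambda>i \<omega>. \<lambda>r\<in>{0..}. P i r \<omega>" and ?Q = "PiM {0::real..} (\<lambda>_. borel::real measure)"
  have mX: "X \<in> measurable M (PiM ?S (\<lambda>_. borel))"
    unfolding X_def using meas by (intro measurable_restrict) (auto simp: split_beta insider_index_def)
  have mD: "D \<in> borel_measurable M"
    unfolding D_def using st meas[OF I(2), of s] meas[OF I(2), of t] by auto
  have paths: "indep_vars (\<lambda>_. ?Q) ?path I"
    using ind by (simp add: indep_processes_def)
  have fact: "prob {\<omega>\<in>space M. X \<omega> \<in> A \<and> D \<omega> \<in> C} = prob {\<omega>\<in>space M. X \<omega> \<in> A} * prob {\<omega>\<in>space M. D \<omega> \<in> C}"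
    if "A \<in> sets (PiM ?S (\<lambda>_. borel))" "C \<in> sets borel" for A :: "('i \<times> real \<Rightarrow> real) set" and C
  proof (rule prob_factorizes_generator[OF mX mD _ _ _ that])
    show "sets (PiM ?S (\<lambda>_. borel)) = sigma_sets (space (PiM ?S (\<lambda>_. borel))) (prod_algebra ?S (\<lambda>_. borel))"
      by (simp add: sets_PiM space_PiM)
    show "Int_stable (prod_algebra ?S (\<lambda>_. borel))" by (rule Int_stable_prod_algebra)
    fix A :: "('i \<times> real \<Rightarrow> real) set" and C :: "real set" assume A: "A \<in> prod_algebra ?S (\<lambda>_. borel)" and C: "C \<in> sets borel"
    from A obtain J E where J: "A = prod_emb ?S (\<lambda>_. borel) J (Pi\<^sub>E J E)" "finite J" "J \<subseteq> ?S"
        "\<And>j. j \<in> J \<Longrightarrow> E j \<in> sets borel"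
      by (rule prod_algebraE) auto
    define Ji where "Ji i = {r. (i, r) \<in> J}" for i
    have Ji: "finite (Ji i)" for i
      using finite_imageI[OF J(2), of snd] by (rule rev_finite_subset) (force simp: Ji_def)
    have JiI: "r \<in> Ji i \<Longrightarrow> i \<in> I \<and> 0 \<le> r \<and> (i = k \<longrightarrow> r \<le> s)" for i r
      using J(3) by (auto simp: Ji_def insider_index_def)
    \<comment> \<open>\<open>U i\<close> is the cylinder condition on the path of process \<open>i\<close>; \<open>V i\<close> adds the increment condition for \<open>i = k\<close>.\<close>
    define U where "U i = {x\<in>space ?Q. \<forall>r\<in>Ji i. x r \<in> E (i, r)}" for i
    define V where "V i = (if i = k then {x\<in>U i. x t - x s \<in> C} else U i)" for i
    have U: "U i \<in> sets ?Q" for i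
      unfolding U_def using Ji JiI[of _ i] J(4)
      by (intro sets.sets_Collect_finite_All sets_Collect_preimage[where N=borel] measurable_component_singleton)
         (auto simp: Ji_def)
    have V: "V i \<in> sets ?Q" for i
    proof -
      have "{x\<in>space ?Q. x t - x s \<in> C} \<in> sets ?Q"
        using st C by (intro sets_Collect_preimage[where N=borel]) auto
      moreover have "{x\<in>U k. x t - x s \<in> C} = U k \<inter> {x\<in>space ?Q. x t - x s \<in> C}"
        by (auto simp: U_def)
      ultimately show ?thesis using U[of k] U[of i] by (auto simp: V_def)
    qed
    have IU: "prob (\<Inter>i\<in>I. ?path i -` U i \<inter> space M) = (\<Prod>i\<in>I. prob (?path i -` U i \<inter> space M))"
      using I U by (intro indep_varsD_finite[OF paths]) auto
    have IV: "prob (\<Inter>i\<in>I. ?path i -` V i \<inter> space M) = (\<Prod>i\<in>I. prob (?path i -` V i \<inter> space M))"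
      using I V by (intro indep_varsD_finite[OF paths]) auto
    have eU: "?path i -` U i \<inter> space M = {\<omega>\<in>space M. \<forall>r\<in>Ji i. P i r \<omega> \<in> E (i, r)}" for i
      using JiI[of _ i] by (auto simp: U_def space_PiM)
    have eVk: "?path k -` V k \<inter> space M = {\<omega>\<in>space M. (\<forall>r\<in>Ji k. P k r \<omega> \<in> E (k, r)) \<and> D \<omega> \<in> C}"
      using JiI[of _ k] st by (auto simp: V_def U_def space_PiM D_def)
    have eA: "(X \<omega> \<in> A) \<longleftrightarrow> (\<forall>i\<in>I. \<forall>r\<in>Ji i. P i r \<omega> \<in> E (i, r))" for \<omega>
    proof -
      have "X \<omega> \<in> A \<longleftrightarrow> (\<forall>j\<in>J. (case j of (i, r) \<Rightarrow> P i r \<omega>) \<in> E j)"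
        using J(3) by (auto simp: X_def J(1) prod_emb_def PiE_iff extensional_def split_beta subset_iff)
      also have "\<dots> \<longleftrightarrow> (\<forall>i\<in>I. \<forall>r\<in>Ji i. P i r \<omega> \<in> E (i, r))"
        using J(3) by (auto simp: Ji_def insider_index_def)
      finally show ?thesis .
    qed
    have "{\<omega>\<in>space M. X \<omega> \<in> A} = (\<Inter>i\<in>I. ?path i -` U i \<inter> space M)"
      unfolding eU eA using I by auto
    then have pU: "prob {\<omega>\<in>space M. X \<omega> \<in> A} = (\<Prod>i\<in>I. prob (?path i -` U i \<inter> space M))"
      using IU by simp
    have "(\<Inter>i\<in>I. ?path i -` V i \<inter> space M) =
        (?path k -` V k \<inter> space M) \<inter> (\<Inter>i\<in>I. ?path i -` U i \<inter> space M)"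
      using I by (auto simp: V_def split: if_splits)
    also have "\<dots> = {\<omega>\<in>space M. X \<omega> \<in> A \<and> D \<omega> \<in> C}"
      unfolding eVk eU eA using I by auto
    finally have pV: "prob {\<omega>\<in>space M. X \<omega> \<in> A \<and> D \<omega> \<in> C} = (\<Prod>i\<in>I. prob (?path i -` V i \<inter> space M))"
      using IV by simp
    have "prob (?path k -` V k \<inter> space M) = prob (?path k -` U k \<inter> space M) * prob {\<omega>\<in>space M. D \<omega> \<in> C}"
      unfolding eVk eU unfolding D_def using J(4) JiI[of _ k] Ji[of k] C st
      by (intro brownian_motion_past_indep_increment[OF B]) (auto simp: Ji_def)
    moreover have "(\<Prod>i\<in>I. prob (?path i -` V i \<inter> space M)) =
        prob (?path k -` V k \<inter> space M) * (\<Prod>i\<in>I-{k}. prob (?path i -` U i \<inter> space M))"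
      using I by (subst prod.remove[of _ k]) (auto simp: V_def)
    moreover have "(\<Prod>i\<in>I. prob (?path i -` U i \<inter> space M)) =
        prob (?path k -` U k \<inter> space M) * (\<Prod>i\<in>I-{k}. prob (?path i -` U i \<inter> space M))"
      using I by (subst prod.remove[of _ k]) auto
    ultimately show "prob {\<omega>\<in>space M. X \<omega> \<in> A \<and> D \<omega> \<in> C} =
        prob {\<omega>\<in>space M. X \<omega> \<in> A} * prob {\<omega>\<in>space M. D \<omega> \<in> C}"
      using pU pV by simp
  qed
  have id: "(\<lambda>\<omega>. \<omega>) \<in> measurable M ?G"
    using insider_filtration_subset_events[of I P M k s, OF meas] by (auto simp: measurable_def subset_iff)
  have Xs: "X \<in> space M \<rightarrow> space (PiM ?S (\<lambda>_. borel))" unfolding X_def by (rule restricted_path_in_space_PiM)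
  interpret G: prob_space "distr M ?G (\<lambda>\<omega>. \<omega>)" using id by (rule prob_space_distr)
  interpret D: prob_space "distr M borel D" using mD by (rule prob_space_distr)
  have pair: "(\<lambda>\<omega>. (\<omega>, D \<omega>)) \<in> measurable M (?G \<Otimes>\<^sub>M borel)"
    using id mD by (rule measurable_Pair)
  have "distr M (?G \<Otimes>\<^sub>M borel) (\<lambda>\<omega>. (\<omega>, D \<omega>)) = distr M ?G (\<lambda>\<omega>. \<omega>) \<Otimes>\<^sub>M distr M borel D"
  proof (rule pair_measure_eqI[symmetric])
    show "sigma_finite_measure (distr M ?G (\<lambda>\<omega>. \<omega>))" by unfold_locales
    show "sigma_finite_measure (distr M borel D)" by unfold_locales
    show "sets (distr M ?G (\<lambda>\<omega>. \<omega>) \<Otimes>\<^sub>M distr M borel D) = sets (distr M (?G \<Otimes>\<^sub>M borel) (\<lambda>\<omega>. (\<omega>, D \<omega>)))"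
      by (simp cong: sets_pair_measure_cong)
    fix a C assume "a \<in> sets (distr M ?G (\<lambda>\<omega>. \<omega>))" "C \<in> sets (distr M borel D)"
    then have a: "a \<in> sets ?G" and C: "C \<in> sets borel" by auto
    from a obtain A where A: "A \<in> sets (PiM ?S (\<lambda>_. borel))" "a = X -` A \<inter> space M"
      unfolding insider_filtration_def X_def[symmetric] by (auto simp: sets_vimage_algebra2[OF Xs])
    then have e: "(\<lambda>\<omega>. \<omega>) -` a \<inter> space M = {\<omega>\<in>space M. X \<omega> \<in> A}" "D -` C \<inter> space M = {\<omega>\<in>space M. D \<omega> \<in> C}"
      "(\<lambda>\<omega>. (\<omega>, D \<omega>)) -` (a \<times> C) \<inter> space M = {\<omega>\<in>space M. X \<omega> \<in> A \<and> D \<omega> \<in> C}"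
      by auto
    show "emeasure (distr M ?G (\<lambda>\<omega>. \<omega>)) a * emeasure (distr M borel D) C =
        emeasure (distr M (?G \<Otimes>\<^sub>M borel) (\<lambda>\<omega>. (\<omega>, D \<omega>))) (a \<times> C)"
      using a C fact[OF A(1) C]
      by (simp add: emeasure_distr[OF id] emeasure_distr[OF mD] emeasure_distr[OF pair] e emeasure_eq_measure ennreal_mult
        del: vimage_ident)
  qed
  then show ?thesis unfolding D_def .
qed

section \<open>Tools: normal laws, subsequences, and squares of simple processes\<close>

lemma (in prob_space) char_normal:
  assumes D: "distributed M lborel D (normal_density 0 \<sigma>)" and \<sigma>: "0 < \<sigma>"
  shows "(CLINT \<omega>|M. iexp (c * D \<omega>)) = complex_of_real (exp (- (c\<^sup>2 * \<sigma>\<^sup>2) / 2))"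
proof -
  have D': "distributed M lborel (\<lambda>\<omega>. (D \<omega> - 0) / \<sigma>) std_normal_density"
    using D normal_standard_normal_convert[OF \<sigma>, of D 0] by simp
  have [measurable]: "D \<in> borel_measurable M" using distributed_measurable[OF D] by simp
  have eq: "distr M lborel (\<lambda>\<omega>. D \<omega> / \<sigma>) = std_normal_distribution"
    using distributed_distr_eq_density[OF D'] by simp
  have "complex_of_real (exp (- (c\<^sup>2 * \<sigma>\<^sup>2) / 2)) = char std_normal_distribution (c * \<sigma>)"
    by (simp add: char_std_normal_distribution power_mult_distrib)
  also have "\<dots> = (CLINT \<omega>|M. iexp (c * \<sigma> * (D \<omega> / \<sigma>)))"
    unfolding eq[symmetric] char_def by (subst integral_distr) auto
  also have "\<dots> = (CLINT \<omega>|M. iexp (c * D \<omega>))"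
    using \<sigma> by simp
  finally show ?thesis by simp
qed

lemma (in prob_space) std_normal_if_char:
  assumes [measurable]: "R \<in> borel_measurable M"
    and char: "\<And>u. (CLINT \<omega>|M. iexp (u * R \<omega>)) = complex_of_real (exp (- u\<^sup>2 / 2))"
  shows "distr M borel R = std_normal_distribution"
proof (rule Levy_uniqueness)
  show "real_distribution (distr M borel R)" by (rule real_distribution_distr) simp
  show "real_distribution std_normal_distribution" by (rule real_dist_normal_dist)
  have "char (distr M borel R) = (\<lambda>u. CLINT \<omega>|M. iexp (u * R \<omega>))"
    unfolding char_def by (subst integral_distr) auto
  then show "char (distr M borel R) = char std_normal_distribution"
    unfolding char_std_normal_distribution char .
qed

text \<open>
  Along a subsequence the integrals are at most \<open>(1/2)\<^sup>n\<close>, so the integrands are summable almost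
  everywhere.
\<close>
lemma nn_integral_tendsto_0_AE_subseq:
  fixes u :: "nat \<Rightarrow> 'a \<Rightarrow> ennreal"
  assumes [measurable]: "\<And>k. u k \<in> borel_measurable M"
    and lim: "(\<lambda>k. \<integral>\<^sup>+\<omega>. u k \<omega> \<partial>M) \<longlonglongrightarrow> 0"
  shows "\<exists>r::nat\<Rightarrow>nat. strict_mono r \<and> (AE \<omega> in M. (\<lambda>k. u (r k) \<omega>) \<longlonglongrightarrow> 0)"
proof -
  have ev: "\<forall>e>0. \<forall>\<^sub>F k in sequentially. (\<integral>\<^sup>+\<omega>. u k \<omega> \<partial>M) < e"
    using order_tendstoD(2)[OF lim] by auto
  have "\<exists>k\<ge>m. (\<integral>\<^sup>+\<omega>. u k \<omega> \<partial>M) < ennreal ((1/2)^n)" for m n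
    using ev[rule_format, of "ennreal ((1/2)^n)"] unfolding eventually_sequentially
    by (metis (no_types) ennreal_less_zero_iff linorder_le_cases order_refl zero_less_divide_1_iff zero_less_numeral zero_less_power)
  then obtain sel where sel: "\<And>m n. sel m n \<ge> m \<and> (\<integral>\<^sup>+\<omega>. u (sel m n) \<omega> \<partial>M) < ennreal ((1/2)^n)" by metis
  define r where "r = rec_nat (sel 0 0) (\<lambda>n k. sel (Suc k) (Suc n))"
  have r0: "r 0 = sel 0 0" and rS: "r (Suc n) = sel (Suc (r n)) (Suc n)" for n by (simp_all add: r_def)
  have r: "r (Suc n) > r n" for n using sel[of "Suc (r n)" "Suc n"] by (simp add: rS)
  then have mono: "strict_mono r" by (rule strict_monoI_Suc)
  have le: "(\<integral>\<^sup>+\<omega>. u (r n) \<omega> \<partial>M) \<le> ennreal ((1/2)^n)" for n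
  proof (cases n)
    case 0
    then show ?thesis using sel[of 0 0] unfolding r0 0 by (intro less_imp_le) blast
  next
    case (Suc m)
    then show ?thesis using sel[of "Suc (r m)" "Suc m"] unfolding Suc rS by (intro less_imp_le) blast
  qed
  have "(\<integral>\<^sup>+\<omega>. (\<Sum>n. u (r n) \<omega>) \<partial>M) = (\<Sum>n. \<integral>\<^sup>+\<omega>. u (r n) \<omega> \<partial>M)"
    by (rule nn_integral_suminf) auto
  also have "\<dots> \<le> (\<Sum>n. ennreal ((1/2)^n))"
    by (intro suminf_le le) auto
  also have "\<dots> = ennreal 2"
    by (subst suminf_ennreal2) (auto simp: suminf_geometric summable_geometric)
  finally have "(\<integral>\<^sup>+\<omega>. (\<Sum>n. u (r n) \<omega>) \<partial>M) \<noteq> \<infinity>" by (auto simp: top_unique)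
  then have "AE \<omega> in M. (\<Sum>n. u (r n) \<omega>) \<noteq> \<infinity>"
    by (intro nn_integral_PInf_AE) auto
  then have "AE \<omega> in M. (\<lambda>k. u (r k) \<omega>) \<longlonglongrightarrow> 0"
  proof eventually_elim
    fix \<omega> assume fin: "(\<Sum>n. u (r n) \<omega>) \<noteq> \<infinity>"
    have finn: "u (r n) \<omega> < \<top>" for n
    proof -
      have "u (r n) \<omega> \<le> (\<Sum>n. u (r n) \<omega>)"
        using sum_le_suminf[of "\<lambda>n. u (r n) \<omega>" "{n}"] by simp
      then show ?thesis using fin by (auto simp: less_top top_unique)
    qed
    have "summable (\<lambda>n. enn2real (u (r n) \<omega>))"
      using fin finn by (intro summable_suminf_not_top) (auto simp: ennreal_enn2real)
    then have "(\<lambda>n. ennreal (enn2real (u (r n) \<omega>))) \<longlonglongrightarrow> ennreal 0"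
      by (intro tendsto_ennrealI summable_LIMSEQ_zero)
    then show "(\<lambda>k. u (r k) \<omega>) \<longlonglongrightarrow> 0" using finn by (simp add: ennreal_enn2real)
  qed
  with mono show ?thesis by blast
qed

text \<open>
  The reverse triangle inequality for \<open>L\<^sup>2\<close> norms, that is, Cauchy-Schwarz. It turns convergence of
  simple processes to \<open>H\<close> in \<open>L\<^sup>2([0,T])\<close> into convergence of their quadratic variations.
\<close>
lemma L2_reverse_triangle:
  fixes f g :: "'a \<Rightarrow> real"
  assumes [measurable]: "f \<in> borel_measurable N" "g \<in> borel_measurable N"
    and A: "(\<integral>\<^sup>+x. ennreal ((f x)\<^sup>2) \<partial>N) = ennreal A" "0 \<le> A"
    and V: "(\<integral>\<^sup>+x. ennreal ((g x)\<^sup>2) \<partial>N) = ennreal V" "0 \<le> V"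
  shows "ennreal ((sqrt A - sqrt V)\<^sup>2) \<le> (\<integral>\<^sup>+x. ennreal ((f x - g x)\<^sup>2) \<partial>N)"
proof -
  have f2: "integrable N (\<lambda>x. (f x)\<^sup>2)" "(\<integral>x. (f x)\<^sup>2 \<partial>N) = A"
  proof -
    show "integrable N (\<lambda>x. (f x)\<^sup>2)"
      by (rule integrableI_nn_integral_finite[OF _ _ A(1)]) auto
    show "(\<integral>x. (f x)\<^sup>2 \<partial>N) = A"
      using A by (subst integral_eq_nn_integral) auto
  qed
  have g2: "integrable N (\<lambda>x. (g x)\<^sup>2)" "(\<integral>x. (g x)\<^sup>2 \<partial>N) = V"
  proof -
    show "integrable N (\<lambda>x. (g x)\<^sup>2)"
      by (rule integrableI_nn_integral_finite[OF _ _ V(1)]) auto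
    show "(\<integral>x. (g x)\<^sup>2 \<partial>N) = V"
      using V by (subst integral_eq_nn_integral) auto
  qed
  have fg: "integrable N (\<lambda>x. f x * g x)"
  proof (rule Bochner_Integration.integrable_bound[OF Bochner_Integration.integrable_add[OF f2(1) g2(1)]])
    have "\<bar>f x * g x\<bar> \<le> (f x)\<^sup>2 + (g x)\<^sup>2" for x
    proof -
      have "0 \<le> \<bar>f x * g x\<bar>" "2 * \<bar>f x * g x\<bar> \<le> (f x)\<^sup>2 + (g x)\<^sup>2"
        using sum_squares_bound[of "\<bar>f x\<bar>" "\<bar>g x\<bar>"] by (auto simp: abs_mult)
      then show ?thesis by linarith
    qed
    then show "AE x in N. norm (f x * g x) \<le> norm ((f x)\<^sup>2 + (g x)\<^sup>2)"
      by (intro AE_I2) (simp add: order_trans[OF _ abs_ge_self])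
  qed simp
  have int: "integrable N (\<lambda>x. (f x - g x)\<^sup>2)"
    using f2(1) g2(1) fg by (simp add: power2_diff mult.assoc)
  have CS: "(\<integral>x. f x * g x \<partial>N) \<le> sqrt A * sqrt V"
  proof -
    have "(\<integral>x. f x * g x \<partial>N) \<le> (\<integral>x. \<bar>f x * g x\<bar> \<partial>N)"
      using fg by (intro integral_mono) auto
    moreover have "ennreal ((\<integral>x. \<bar>f x * g x\<bar> \<partial>N)\<^sup>2) \<le> ennreal (A * V)"
    proof -
      have "ennreal ((\<integral>x. \<bar>f x * g x\<bar> \<partial>N)\<^sup>2) = (ennreal (\<integral>x. \<bar>f x * g x\<bar> \<partial>N))\<^sup>2"
        by (simp add: ennreal_power)
      also have "\<dots> = (\<integral>\<^sup>+x. ennreal \<bar>f x\<bar> * ennreal \<bar>g x\<bar> \<partial>N)\<^sup>2"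
        using integrable_abs[OF fg] by (subst nn_integral_eq_integral[symmetric]) (auto simp: abs_mult ennreal_mult)
      also have "\<dots> \<le> (\<integral>\<^sup>+x. (ennreal \<bar>f x\<bar>)\<^sup>2 \<partial>N) * (\<integral>\<^sup>+x. (ennreal \<bar>g x\<bar>)\<^sup>2 \<partial>N)"
        by (rule Cauchy_Schwarz_nn_integral) auto
      also have "\<dots> = ennreal (A * V)"
        using A V by (simp add: ennreal_power ennreal_mult)
      finally show ?thesis .
    qed
    then have "(\<integral>x. \<bar>f x * g x\<bar> \<partial>N) \<le> sqrt (A * V)"
      using A(2) V(2) by (intro real_le_rsqrt) (simp add: ennreal_le_iff)
    ultimately show ?thesis by (simp add: real_sqrt_mult)
  qed
  have "(sqrt A - sqrt V)\<^sup>2 \<le> A + V - 2 * (\<integral>x. f x * g x \<partial>N)"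
    using CS A V by (simp add: power2_diff)
  also have "\<dots> = (\<integral>x. (f x - g x)\<^sup>2 \<partial>N)"
    using f2 g2 fg by (simp add: power2_diff mult.assoc)
  finally show ?thesis
    using int by (subst nn_integral_eq_integral) (auto simp: ennreal_leI)
qed

lemma lift_Suc_mono_le_upto:
  fixes \<tau> :: "nat \<Rightarrow> 'a::order"
  assumes "\<And>i. i < n \<Longrightarrow> \<tau> i \<le> \<tau> (Suc i)" and "i \<le> j" "j \<le> n"
  shows "\<tau> i \<le> \<tau> j"
  using assms(2,3)
proof (induction j rule: dec_induct)
  case (step m)
  then show ?case using order_trans[OF _ assms(1)[of m]] by auto
qed simp

text \<open>
  The intervals \<open>(\<tau> i, \<tau> (i + 1)]\<close> are disjoint, so the mixed terms of the square vanish.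
\<close>
lemma simple_value_square:
  assumes "\<And>i. i < n \<Longrightarrow> \<tau> i \<le> \<tau> (Suc i)"
  shows "(simple_value n \<tau> \<xi> s \<omega>)\<^sup>2 = (\<Sum>i<n. (\<xi> i \<omega>)\<^sup>2 * indicator {\<tau> i<..\<tau> (Suc i)} s)"
  using assms
proof (induction n)
  case (Suc n)
  have IH: "(simple_value n \<tau> \<xi> s \<omega>)\<^sup>2 = (\<Sum>i<n. (\<xi> i \<omega>)\<^sup>2 * indicator {\<tau> i<..\<tau> (Suc i)} s)"
    using Suc by auto
  have mono': "\<tau> i \<le> \<tau> n" if "i \<le> n" for i
    by (rule lift_Suc_mono_le_upto[of n]) (use that Suc.prems in auto)
  have mono: "\<tau> (Suc i) \<le> \<tau> n" if "i < n" for i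
    using that mono'[of "Suc i"] by simp
  have "simple_value n \<tau> \<xi> s \<omega> = 0" if "s \<in> {\<tau> n<..\<tau> (Suc n)}"
    unfolding simple_value_def using that mono by (intro sum.neutral) (force simp: indicator_def)
  then show ?case
    unfolding sum.lessThan_Suc IH[symmetric]
    by (auto simp: simple_value_def indicator_def)
qed (simp add: simple_value_def)

lemma nn_integral_simple_value_square:
  assumes "simple_process M F T n \<tau> \<xi>"
  shows "(\<integral>\<^sup>+s\<in>{0..T}. ennreal ((simple_value n \<tau> \<xi> s \<omega>)\<^sup>2) \<partial>lborel) =
    ennreal (\<Sum>i<n. (\<xi> i \<omega>)\<^sup>2 * (\<tau> (Suc i) - \<tau> i))"
proof -
  have \<tau>: "0 \<le> \<tau> 0" "\<And>i. i < n \<Longrightarrow> \<tau> i \<le> \<tau> (Suc i)" "\<tau> n \<le> T" using assms by (auto simp: simple_process_def)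
  have lo: "0 \<le> \<tau> i" if "i \<le> n" for i
    using that \<tau> lift_Suc_mono_le_upto[of n \<tau> 0 i] by auto
  have hi: "\<tau> i \<le> T" if "i \<le> n" for i
    using that \<tau> lift_Suc_mono_le_upto[of n \<tau> i n] by auto
  have "(\<integral>\<^sup>+s\<in>{0..T}. ennreal ((simple_value n \<tau> \<xi> s \<omega>)\<^sup>2) \<partial>lborel) =
      (\<integral>\<^sup>+s. (\<Sum>i<n. ennreal ((\<xi> i \<omega>)\<^sup>2) * indicator {\<tau> i<..\<tau> (Suc i)} s) \<partial>lborel)"
  proof (rule nn_integral_cong)
    fix s :: real
    have "ennreal ((simple_value n \<tau> \<xi> s \<omega>)\<^sup>2) * indicator {0..T} s =
       (\<Sum>i<n. ennreal ((\<xi> i \<omega>)\<^sup>2) * indicator {\<tau> i<..\<tau> (Suc i)} s) * indicator {0..T} s"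
    proof -
      have "ennreal ((simple_value n \<tau> \<xi> s \<omega>)\<^sup>2) = ennreal (\<Sum>i<n. (\<xi> i \<omega>)\<^sup>2 * indicator {\<tau> i<..\<tau> (Suc i)} s)"
        using simple_value_square[of n \<tau> \<xi> s \<omega>, OF \<tau>(2)] by simp
      also have "\<dots> = (\<Sum>i<n. ennreal ((\<xi> i \<omega>)\<^sup>2 * indicator {\<tau> i<..\<tau> (Suc i)} s))"
        by (rule sum_ennreal[symmetric]) simp
      also have "\<dots> = (\<Sum>i<n. ennreal ((\<xi> i \<omega>)\<^sup>2) * indicator {\<tau> i<..\<tau> (Suc i)} s)"
        by (intro sum.cong) (auto simp: indicator_def)
      finally show ?thesis by simp
    qed
    also have "\<dots> = (\<Sum>i<n. ennreal ((\<xi> i \<omega>)\<^sup>2) * indicator {\<tau> i<..\<tau> (Suc i)} s)"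
    proof -
      have "0 \<le> s \<and> s \<le> T" if "i < n" "\<tau> i < s" "s \<le> \<tau> (Suc i)" for i
        using that lo[of i] hi[of "Suc i"] by auto
      then show ?thesis
        unfolding sum_distrib_right by (intro sum.cong) (auto simp: indicator_def)
    qed
    finally show "ennreal ((simple_value n \<tau> \<xi> s \<omega>)\<^sup>2) * indicator {0..T} s = (\<Sum>i<n. ennreal ((\<xi> i \<omega>)\<^sup>2) * indicator {\<tau> i<..\<tau> (Suc i)} s)" .
  qed
  also have "\<dots> = (\<Sum>i<n. ennreal ((\<xi> i \<omega>)\<^sup>2) * ennreal (\<tau> (Suc i) - \<tau> i))"
    using \<tau>(2) by (subst nn_integral_sum) (auto simp: nn_integral_cmult)
  also have "\<dots> = ennreal (\<Sum>i<n. (\<xi> i \<omega>)\<^sup>2 * (\<tau> (Suc i) - \<tau> i))"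
    using \<tau>(2) by (subst sum_ennreal[symmetric]) (auto simp: ennreal_mult)
  finally show ?thesis .
qed


section \<open>Self-normalized stochastic integrals are standard normal\<close>

text \<open>
  Summation stops at the first index at which the partial sum would exceed \<open>K\<close>: since all terms are
  nonnegative, the condition fails from there on.
\<close>
lemma sum_stopped_le:
  fixes v :: "nat \<Rightarrow> real"
  assumes "\<And>i. i < n \<Longrightarrow> 0 \<le> v i" and "0 \<le> K"
  shows "(\<Sum>i<n. if (\<Sum>j<Suc i. v j) \<le> K then v i else 0) \<le> K"
  using assms(1)
proof (induction n)
  case (Suc n)
  show ?case
  proof (cases "(\<Sum>j<Suc n. v j) \<le> K")
    case True
    have "(\<Sum>i<Suc n. if (\<Sum>j<Suc i. v j) \<le> K then v i else 0) \<le> (\<Sum>i<Suc n. v i)"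
      by (intro sum_mono) (use Suc.prems in auto)
    with True show ?thesis by simp
  next
    case False
    then show ?thesis using Suc by simp
  qed
qed (use assms(2) in simp)

text \<open>
  The situation of \<open>insider_filtration_indep_increment\<close> in the abstract: a process with independent
  Gaussian increments relative to a filtration that may be larger than its own.
\<close>
locale gaussian_increments = prob_space M for M :: "'a measure" +
  fixes G :: "real \<Rightarrow> 'a measure" and B :: "real \<Rightarrow> 'a \<Rightarrow> real"
  assumes space_G: "space (G s) = space M"
    and G_events: "sets (G s) \<subseteq> sets M"
    and G_mono: "s \<le> t \<Longrightarrow> sets (G s) \<subseteq> sets (G t)"
    and B_adapted: "0 \<le> s \<Longrightarrow> B s \<in> borel_measurable (G s)"
    and increment_indep: "0 \<le> s \<Longrightarrow> s < t \<Longrightarrow>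
      distr M (G s \<Otimes>\<^sub>M borel) (\<lambda>\<omega>. (\<omega>, B t \<omega> - B s \<omega>)) =
      distr M (G s) (\<lambda>\<omega>. \<omega>) \<Otimes>\<^sub>M distr M borel (\<lambda>\<omega>. B t \<omega> - B s \<omega>)"
    and increment_normal: "0 \<le> s \<Longrightarrow> s < t \<Longrightarrow>
      distributed M lborel (\<lambda>\<omega>. B t \<omega> - B s \<omega>) (normal_density 0 (sqrt (t - s)))"
begin

lemma measurable_G_events: "f \<in> measurable (G s) N \<Longrightarrow> f \<in> measurable M N"
  using G_events[of s] space_G[of s] by (auto simp: measurable_def subset_iff)

lemma measurable_G_mono: "f \<in> measurable (G s) N \<Longrightarrow> s \<le> t \<Longrightarrow> f \<in> measurable (G t) N"
  using G_mono[of s t] space_G[of s] space_G[of t] by (auto simp: measurable_def subset_iff)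

text \<open>
  Integrate out the increment first: for fixed \<open>\<omega>\<close> it contributes the factor
  \<open>exp (- c\<^sup>2 (t - s) / 2)\<close>, which cancels the compensator. The bounds make the integrand integrable on
  the product space.
\<close>
lemma exponential_step:
  fixes \<Phi> :: "'a \<Rightarrow> complex" and c :: "'a \<Rightarrow> real"
  assumes st: "0 \<le> s" "s \<le> t"
    and \<Phi>[measurable]: "\<Phi> \<in> borel_measurable (G s)" and \<Phi>K: "\<And>\<omega>. \<omega> \<in> space M \<Longrightarrow> norm (\<Phi> \<omega>) \<le> L"
    and c[measurable]: "c \<in> borel_measurable (G s)"
    and cK: "\<And>\<omega>. \<omega> \<in> space M \<Longrightarrow> (c \<omega>)\<^sup>2 * (t - s) \<le> K"
  shows "(CLINT \<omega>|M. \<Phi> \<omega> * exp (\<i> * complex_of_real (c \<omega> * (B t \<omega> - B s \<omega>)) + complex_of_real ((c \<omega>)\<^sup>2 * (t - s) / 2)))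
    = (CLINT \<omega>|M. \<Phi> \<omega>)"
proof (cases "s = t")
  case False
  with st have lt: "s < t" by simp
  let ?D = "\<lambda>\<omega>. B t \<omega> - B s \<omega>"
  define f where "f = (\<lambda>(\<omega>, d). \<Phi> \<omega> * exp (\<i> * complex_of_real (c \<omega> * d) + complex_of_real ((c \<omega>)\<^sup>2 * (t - s) / 2)))"
  have id: "(\<lambda>\<omega>. \<omega>) \<in> measurable M (G s)" by (rule measurable_G_events[of _ s]) simp
  have D: "?D \<in> borel_measurable M"
    using B_adapted st by (intro borel_measurable_diff measurable_G_events[of _ s] measurable_G_events[of _ t]) (auto intro: measurable_G_events)
  have f[measurable]: "f \<in> borel_measurable (G s \<Otimes>\<^sub>M borel)" unfolding f_def by measurable
  have pair: "(\<lambda>\<omega>. (\<omega>, ?D \<omega>)) \<in> measurable M (G s \<Otimes>\<^sub>M borel)" using id D by (rule measurable_Pair)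
  interpret G: prob_space "distr M (G s) (\<lambda>\<omega>. \<omega>)" using id by (rule prob_space_distr)
  interpret D: prob_space "distr M borel ?D" using D by (rule prob_space_distr)
  interpret P: pair_prob_space "distr M (G s) (\<lambda>\<omega>. \<omega>)" "distr M borel ?D" ..
  let ?P = "distr M (G s) (\<lambda>\<omega>. \<omega>) \<Otimes>\<^sub>M distr M borel ?D"
  have P: "distr M (G s \<Otimes>\<^sub>M borel) (\<lambda>\<omega>. (\<omega>, ?D \<omega>)) = ?P" by (rule increment_indep[OF st(1) lt])
  have "norm (f (\<omega>, d)) \<le> L * exp (K / 2)" if "\<omega> \<in> space M" for \<omega> d
    using \<Phi>K[OF that] cK[OF that] order_trans[OF norm_ge_zero \<Phi>K[OF that]]
    unfolding f_def by (auto simp: norm_mult intro!: mult_mono)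
  then have "integrable ?P f"
    by (intro P.P.integrable_const_bound[of _ "L * exp (K/2)"] AE_I2)
       (auto simp: space_pair_measure space_G cong: measurable_cong_sets sets_pair_measure_cong)
  then have int: "(CLINT \<omega>|distr M (G s) (\<lambda>\<omega>. \<omega>). CLINT d|distr M borel ?D. f (\<omega>, d)) = integral\<^sup>L ?P f"
    by (rule P.integral_fst')
  have inner: "(CLINT d|distr M borel ?D. f (\<omega>, d)) = \<Phi> \<omega>" for \<omega>
  proof -
    have "(CLINT d|distr M borel ?D. f (\<omega>, d)) =
        (CLINT d|distr M borel ?D. (\<Phi> \<omega> * exp (complex_of_real ((c \<omega>)\<^sup>2 * (t - s) / 2))) * iexp (c \<omega> * d))"
      by (simp add: f_def exp_add mult_ac)
    also have "\<dots> = (\<Phi> \<omega> * exp (complex_of_real ((c \<omega>)\<^sup>2 * (t - s) / 2))) * (CLINT \<omega>'|M. iexp (c \<omega> * ?D \<omega>'))"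
      using D by (subst integral_mult_right_zero) (auto simp: integral_distr)
    also have "(CLINT \<omega>'|M. iexp (c \<omega> * ?D \<omega>')) = complex_of_real (exp (- ((c \<omega>)\<^sup>2 * (t - s)) / 2))"
      using char_normal[OF increment_normal[OF st(1) lt], of "c \<omega>"] lt by simp
    finally show ?thesis
      by (simp add: mult.assoc flip: exp_of_real exp_add)
  qed
  have "(CLINT \<omega>|M. f (\<omega>, ?D \<omega>)) = integral\<^sup>L ?P f"
    unfolding P[symmetric] using pair by (subst integral_distr) auto
  also have "\<dots> = (CLINT \<omega>|distr M (G s) (\<lambda>\<omega>. \<omega>). \<Phi> \<omega>)"
    unfolding int[symmetric] inner ..
  also have "\<dots> = (CLINT \<omega>|M. \<Phi> \<omega>)" using id by (subst integral_distr) auto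
  finally show ?thesis by (simp add: f_def)
qed simp

lemma exponential_martingale:
  assumes \<tau>: "0 \<le> \<tau> 0" "\<And>i. i < n \<Longrightarrow> \<tau> i \<le> \<tau> (Suc i)"
    and c: "\<And>i. i < n \<Longrightarrow> c i \<in> borel_measurable (G (\<tau> i))"
    and K: "\<And>\<omega>. \<omega> \<in> space M \<Longrightarrow> (\<Sum>i<n. (c i \<omega>)\<^sup>2 * (\<tau> (Suc i) - \<tau> i)) \<le> K"
  shows "(CLINT \<omega>|M. exp (\<i> * complex_of_real (\<Sum>i<n. c i \<omega> * (B (\<tau> (Suc i)) \<omega> - B (\<tau> i) \<omega>))
      + complex_of_real ((\<Sum>i<n. (c i \<omega>)\<^sup>2 * (\<tau> (Suc i) - \<tau> i)) / 2))) = 1"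
  using \<tau>(2) c K
proof (induction n)
  case 0
  show ?case by (simp add: prob_space)
next
  case (Suc n)
  have lo: "0 \<le> \<tau> i" if "i \<le> n" for i
    using that \<tau>(1) Suc.prems(1) lift_Suc_mono_le_upto[of n \<tau> 0 i] by (auto simp: less_Suc_eq)
  have up: "\<tau> i \<le> \<tau> n" if "i \<le> n" for i
    by (rule lift_Suc_mono_le_upto[of n]) (use that Suc.prems(1) in auto)
  have nn: "0 \<le> (c i \<omega>)\<^sup>2 * (\<tau> (Suc i) - \<tau> i)" if "i < Suc n" for i \<omega>
    using Suc.prems(1)[OF that] by auto
  have K0: "(\<Sum>i<n. (c i \<omega>)\<^sup>2 * (\<tau> (Suc i) - \<tau> i)) \<le> K" "(c n \<omega>)\<^sup>2 * (\<tau> (Suc n) - \<tau> n) \<le> K" if "\<omega> \<in> space M" for \<omega>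
  proof -
    have "0 \<le> (\<Sum>i<n. (c i \<omega>)\<^sup>2 * (\<tau> (Suc i) - \<tau> i))" using nn[of _ \<omega>] by (intro sum_nonneg) (simp only: lessThan_iff less_SucI)
    then show "(\<Sum>i<n. (c i \<omega>)\<^sup>2 * (\<tau> (Suc i) - \<tau> i)) \<le> K" "(c n \<omega>)\<^sup>2 * (\<tau> (Suc n) - \<tau> n) \<le> K"
      using Suc.prems(3)[OF that] nn[of n \<omega>, OF lessI] unfolding sum.lessThan_Suc by linarith+
  qed
  define \<Phi> where "\<Phi> \<omega> = exp (\<i> * complex_of_real (\<Sum>i<n. c i \<omega> * (B (\<tau> (Suc i)) \<omega> - B (\<tau> i) \<omega>))
      + complex_of_real ((\<Sum>i<n. (c i \<omega>)\<^sup>2 * (\<tau> (Suc i) - \<tau> i)) / 2))" for \<omega>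
  have [measurable]: "c i \<in> borel_measurable (G (\<tau> n))" "B (\<tau> i) \<in> borel_measurable (G (\<tau> n))"
     "B (\<tau> (Suc i)) \<in> borel_measurable (G (\<tau> n))" if "i < n" for i
    using that lo[of i] lo[of "Suc i"] up[of i] up[of "Suc i"] Suc.prems(2)[of i]
    by (auto intro: measurable_G_mono B_adapted)
  have "\<Phi> \<in> borel_measurable (G (\<tau> n))" unfolding \<Phi>_def by measurable
  moreover have "norm (\<Phi> \<omega>) \<le> exp (K / 2)" if "\<omega> \<in> space M" for \<omega>
    using K0(1)[OF that] by (simp add: \<Phi>_def)
  ultimately have "(CLINT \<omega>|M. \<Phi> \<omega> * exp (\<i> * complex_of_real (c n \<omega> * (B (\<tau> (Suc n)) \<omega> - B (\<tau> n) \<omega>))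
      + complex_of_real ((c n \<omega>)\<^sup>2 * (\<tau> (Suc n) - \<tau> n) / 2))) = (CLINT \<omega>|M. \<Phi> \<omega>)"
    using lo[of n] Suc.prems(1)[of n] Suc.prems(2)[of n] K0(2) by (intro exponential_step) auto
  also have "\<dots> = 1"
    unfolding \<Phi>_def using Suc.prems K0(1) by (intro Suc.IH) auto
  finally have "(CLINT \<omega>|M. \<Phi> \<omega> * exp (\<i> * complex_of_real (c n \<omega> * (B (\<tau> (Suc n)) \<omega> - B (\<tau> n) \<omega>))
      + complex_of_real ((c n \<omega>)\<^sup>2 * (\<tau> (Suc n) - \<tau> n) / 2))) = 1" .
  moreover have "exp (\<i> * complex_of_real X + complex_of_real (Y / 2)) * exp (\<i> * complex_of_real x + complex_of_real (y / 2)) =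
    exp (\<i> * complex_of_real (X + x) + complex_of_real ((Y + y) / 2))" for X Y x y
    by (simp add: exp_add[symmetric] algebra_simps add_divide_distrib)
  ultimately show ?case
    unfolding \<Phi>_def sum.lessThan_Suc by (simp only:)
qed

lemma measurable_simple_integral:
  assumes \<tau>: "0 \<le> \<tau> 0" "\<And>i. i < n \<Longrightarrow> \<tau> i \<le> \<tau> (Suc i)"
    and c: "\<And>i. i < n \<Longrightarrow> c i \<in> borel_measurable M"
  shows "(\<lambda>\<omega>. \<Sum>i<n. c i \<omega> * (B (\<tau> (Suc i)) \<omega> - B (\<tau> i) \<omega>)) \<in> borel_measurable M"
proof -
  have "B (\<tau> i) \<in> borel_measurable M" if "i \<le> n" for i
    using that lift_Suc_mono_le_upto[of n \<tau> 0 i] \<tau> by (intro measurable_G_events[OF B_adapted]) auto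
  then show ?thesis using c by (intro borel_measurable_sum borel_measurable_times borel_measurable_diff) auto
qed

text \<open>
  The exponential martingale needs a quadratic variation bounded by a constant. So each \<open>\<eta> k i\<close> is
  switched off as soon as the quadratic variation would exceed \<open>2\<close>; this decision depends on
  \<open>\<eta> k 0, \<dots>, \<eta> k i\<close> only and is known at time \<open>\<tau> k i\<close>. Because the total quadratic variation tends
  to \<open>1\<close>, almost surely nothing is switched off once \<open>k\<close> is large, and dominated convergence applies.
\<close>
lemma char_limit_of_self_normalized_sums:
  fixes \<tau> :: "nat \<Rightarrow> nat \<Rightarrow> real" and \<eta> :: "nat \<Rightarrow> nat \<Rightarrow> 'a \<Rightarrow> real"
  assumes R[measurable]: "R \<in> borel_measurable M"
    and \<tau>: "\<And>k. 0 \<le> \<tau> k 0" "\<And>k i. i < n k \<Longrightarrow> \<tau> k i \<le> \<tau> k (Suc i)"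
    and \<eta>: "\<And>k i. i < n k \<Longrightarrow> \<eta> k i \<in> borel_measurable (G (\<tau> k i))"
    and qv: "AE \<omega> in M. (\<lambda>k. \<Sum>i<n k. (\<eta> k i \<omega>)\<^sup>2 * (\<tau> k (Suc i) - \<tau> k i)) \<longlonglongrightarrow> 1"
    and lim: "AE \<omega> in M. (\<lambda>k. \<Sum>i<n k. \<eta> k i \<omega> * (B (\<tau> k (Suc i)) \<omega> - B (\<tau> k i) \<omega>)) \<longlonglongrightarrow> R \<omega>"
  shows "(CLINT \<omega>|M. iexp (u * R \<omega>)) = complex_of_real (exp (- u\<^sup>2 / 2))"
proof -
  define v where "v k i \<omega> = (\<eta> k i \<omega>)\<^sup>2 * (\<tau> k (Suc i) - \<tau> k i)" for k i \<omega>
  define c where "c k i \<omega> = (if (\<Sum>j<Suc i. v k j \<omega>) \<le> 2 then u * \<eta> k i \<omega> else 0)" for k i \<omega>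
  define S where "S k \<omega> = (\<Sum>i<n k. c k i \<omega> * (B (\<tau> k (Suc i)) \<omega> - B (\<tau> k i) \<omega>))" for k \<omega>
  define Q where "Q k \<omega> = (\<Sum>i<n k. (c k i \<omega>)\<^sup>2 * (\<tau> k (Suc i) - \<tau> k i))" for k \<omega>
  define f where "f k \<omega> = exp (\<i> * complex_of_real (S k \<omega>) + complex_of_real (Q k \<omega> / 2))" for k \<omega>
  have v0: "0 \<le> v k i \<omega>" if "i < n k" for k i \<omega> using \<tau>(2)[OF that] by (simp add: v_def)
  have c_meas: "c k i \<in> borel_measurable (G (\<tau> k i))" if "i < n k" for k i
  proof -
    have [measurable]: "\<eta> k j \<in> borel_measurable (G (\<tau> k i))" if "j \<le> i" for j
      using that \<open>i < n k\<close> by (intro measurable_G_mono[OF \<eta>] lift_Suc_mono_le_upto[of "n k" "\<tau> k", OF \<tau>(2)]) auto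
    have [measurable]: "(\<lambda>\<omega>. \<Sum>j<Suc i. v k j \<omega>) \<in> borel_measurable (G (\<tau> k i))"
      unfolding v_def by (intro borel_measurable_sum) auto
    have [measurable]: "\<eta> k i \<in> borel_measurable (G (\<tau> k i))" using that by (rule \<eta>)
    show ?thesis unfolding c_def[abs_def] by measurable
  qed
  have Q_le: "Q k \<omega> \<le> 2 * u\<^sup>2" for k \<omega>
  proof -
    have "Q k \<omega> = u\<^sup>2 * (\<Sum>i<n k. if (\<Sum>j<Suc i. v k j \<omega>) \<le> 2 then v k i \<omega> else 0)"
      unfolding Q_def sum_distrib_left by (intro sum.cong) (auto simp: c_def v_def power_mult_distrib)
    also have "\<dots> \<le> u\<^sup>2 * 2"
      by (intro mult_left_mono sum_stopped_le) (auto simp: v0)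
    finally show ?thesis by simp
  qed
  have S_meas[measurable]: "S k \<in> borel_measurable M" for k
    unfolding S_def[abs_def] using c_meas by (intro measurable_simple_integral \<tau>) (auto intro: measurable_G_events)
  have Q_meas[measurable]: "Q k \<in> borel_measurable M" for k
    unfolding Q_def[abs_def] using measurable_G_events[OF c_meas] by (intro borel_measurable_sum) auto
  have f1: "(CLINT \<omega>|M. f k \<omega>) = 1" for k
    unfolding f_def S_def Q_def
    by (rule exponential_martingale[of "\<tau> k" "n k" "c k" "2 * u\<^sup>2"])
       (use \<tau> c_meas Q_le in \<open>auto simp: Q_def\<close>)
  have f_lim: "AE \<omega> in M. (\<lambda>k. f k \<omega>) \<longlonglongrightarrow> exp (\<i> * complex_of_real (u * R \<omega>) + complex_of_real (u\<^sup>2 * 1 / 2))"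
    using qv lim
  proof eventually_elim
    fix \<omega> assume qv: "(\<lambda>k. \<Sum>i<n k. (\<eta> k i \<omega>)\<^sup>2 * (\<tau> k (Suc i) - \<tau> k i)) \<longlonglongrightarrow> 1"
      and lim: "(\<lambda>k. \<Sum>i<n k. \<eta> k i \<omega> * (B (\<tau> k (Suc i)) \<omega> - B (\<tau> k i) \<omega>)) \<longlonglongrightarrow> R \<omega>"
    have "\<forall>\<^sub>F k in sequentially. (\<Sum>i<n k. (\<eta> k i \<omega>)\<^sup>2 * (\<tau> k (Suc i) - \<tau> k i)) < 2"
      using order_tendstoD(2)[OF qv, of 2] by simp
    then have ev: "\<forall>\<^sub>F k in sequentially. \<forall>i<n k. c k i \<omega> = u * \<eta> k i \<omega>"
    proof eventually_elim
      case (elim k)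
      have "(\<Sum>j<Suc i. v k j \<omega>) \<le> (\<Sum>j<n k. v k j \<omega>)" if "i < n k" for i
        using that v0[of _ k \<omega>] by (intro sum_mono2) auto
      then show ?case using elim by (fastforce simp: c_def v_def)
    qed
    have "(\<lambda>k. u * (\<Sum>i<n k. \<eta> k i \<omega> * (B (\<tau> k (Suc i)) \<omega> - B (\<tau> k i) \<omega>))) \<longlonglongrightarrow> u * R \<omega>"
      by (intro tendsto_intros lim)
    then have S: "(\<lambda>k. S k \<omega>) \<longlonglongrightarrow> u * R \<omega>"
      by (rule Lim_transform_eventually)
         (use ev in eventually_elim, auto simp: S_def sum_distrib_left mult.assoc intro!: sum.cong)
    have "(\<lambda>k. u\<^sup>2 * (\<Sum>i<n k. (\<eta> k i \<omega>)\<^sup>2 * (\<tau> k (Suc i) - \<tau> k i))) \<longlonglongrightarrow> u\<^sup>2 * 1"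
      by (intro tendsto_intros qv)
    then have Q: "(\<lambda>k. Q k \<omega>) \<longlonglongrightarrow> u\<^sup>2 * 1"
      by (rule Lim_transform_eventually)
         (use ev in eventually_elim, auto simp: Q_def sum_distrib_left mult.assoc power_mult_distrib intro!: sum.cong)
    show "(\<lambda>k. f k \<omega>) \<longlonglongrightarrow> exp (\<i> * complex_of_real (u * R \<omega>) + complex_of_real (u\<^sup>2 * 1 / 2))"
      unfolding f_def by (intro tendsto_intros S Q) auto
  qed
  have "(\<lambda>k. CLINT \<omega>|M. f k \<omega>) \<longlonglongrightarrow> (CLINT \<omega>|M. exp (\<i> * complex_of_real (u * R \<omega>) + complex_of_real (u\<^sup>2 * 1 / 2)))"
  proof (rule integral_dominated_convergence[where w="\<lambda>_. exp (u\<^sup>2)"])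
    show "AE \<omega> in M. norm (f k \<omega>) \<le> exp (u\<^sup>2)" for k
      using Q_le[of k] by (simp add: f_def mult.commute)
  qed (use f_lim in \<open>auto simp: f_def[abs_def]\<close>)
  then have "(CLINT \<omega>|M. exp (\<i> * complex_of_real (u * R \<omega>) + complex_of_real (u\<^sup>2 * 1 / 2))) = 1"
    unfolding f1 by (simp add: LIMSEQ_const_iff)
  then have "exp (complex_of_real (u\<^sup>2 / 2)) * (CLINT \<omega>|M. iexp (u * R \<omega>)) = 1"
    by (simp add: exp_add mult.commute)
  then have "(CLINT \<omega>|M. iexp (u * R \<omega>)) = exp (- complex_of_real (u\<^sup>2 / 2))"
    by (simp add: exp_minus inverse_unique)
  moreover have "exp (- complex_of_real (u\<^sup>2 / 2)) = complex_of_real (exp (- u\<^sup>2 / 2))"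
    unfolding exp_of_real[symmetric] by simp
  ultimately show ?thesis by (simp only:)
qed

text \<open>
  If the total variance \<open>A = \<integral>\<^sub>0\<^sup>T H\<^sup>2\<close> is already known at time \<open>0\<close>, then \<open>H / sqrt A\<close> is an adapted
  integrand with quadratic variation \<open>1\<close>, and its integral is exactly standard normal. The given
  approximating processes serve directly: divided by \<open>sqrt A\<close>, a subsequence of them satisfies the
  hypotheses of \<open>char_limit_of_self_normalized_sums\<close>.
\<close>
lemma ito_integral_self_normalized:
  assumes ito: "has_ito_integral M F B H T J"
    and F: "\<And>s. 0 \<le> s \<Longrightarrow> space (F s) = space M" "\<And>s. 0 \<le> s \<Longrightarrow> sets (F s) \<subseteq> sets (G s)"
    and A[measurable]: "A \<in> borel_measurable (G 0)"
    and A_pos: "\<And>\<omega>. \<omega> \<in> space M \<Longrightarrow> 0 < A \<omega>"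
    and A_eq: "\<And>\<omega>. \<omega> \<in> space M \<Longrightarrow> (\<integral>\<^sup>+s\<in>{0..T}. ennreal ((H s \<omega>)\<^sup>2) \<partial>lborel) = ennreal (A \<omega>)"
    and H: "\<And>\<omega>. \<omega> \<in> space M \<Longrightarrow> continuous_on {0..T} (\<lambda>s. H s \<omega>)"
  shows "distr M borel (\<lambda>\<omega>. J \<omega> / sqrt (A \<omega>)) = std_normal_distribution"
proof -
  from ito obtain n \<tau> \<xi> where J[measurable]: "J \<in> borel_measurable M"
    and sp: "\<And>k::nat. simple_process M F T (n k) (\<tau> k) (\<xi> k)"
    and lim1: "(\<lambda>k. \<integral>\<^sup>+\<omega>. (\<integral>\<^sup>+s\<in>{0..T}. ennreal ((H s \<omega> - simple_value (n k) (\<tau> k) (\<xi> k) s \<omega>)\<^sup>2)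
              \<partial>lborel) \<partial>M) \<longlonglongrightarrow> 0"
    and lim2: "(\<lambda>k. \<integral>\<^sup>+\<omega>. ennreal ((J \<omega> - simple_integral B (n k) (\<tau> k) (\<xi> k) \<omega>)\<^sup>2) \<partial>M) \<longlonglongrightarrow> 0"
    unfolding has_ito_integral_def by blast
  define S where "S k = simple_integral B (n k) (\<tau> k) (\<xi> k)" for k
  define V where "V k \<omega> = (\<Sum>i<n k. (\<xi> k i \<omega>)\<^sup>2 * (\<tau> k (Suc i) - \<tau> k i))" for k \<omega>
  have \<tau>: "0 \<le> \<tau> k 0" "\<And>i. i < n k \<Longrightarrow> \<tau> k i \<le> \<tau> k (Suc i)" for k
    using sp[of k] by (auto simp: simple_process_def)
  have \<tau>0: "0 \<le> \<tau> k i" if "i \<le> n k" for k i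
    using that \<tau>(1)[of k] \<tau>(2)[of _ k] lift_Suc_mono_le_upto[of "n k" "\<tau> k" 0 i] by auto
  have \<xi>: "\<xi> k i \<in> borel_measurable (G (\<tau> k i))" if "i < n k" for k i
  proof -
    have "\<xi> k i \<in> borel_measurable (F (\<tau> k i))" using sp[of k] that by (auto simp: simple_process_def)
    then show ?thesis
      using F[OF \<tau>0[of i k]] that space_G[of "\<tau> k i"] by (auto simp: measurable_def subset_iff)
  qed
  have [measurable]: "A \<in> borel_measurable M" using A by (rule measurable_G_events)
  have S_meas[measurable]: "S k \<in> borel_measurable M" for k
    unfolding S_def simple_integral_def[abs_def]
    using \<xi> by (intro measurable_simple_integral \<tau>) (auto intro: measurable_G_events)
  have V_meas[measurable]: "V k \<in> borel_measurable M" for k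
    unfolding V_def[abs_def] using measurable_G_events[OF \<xi>] by (intro borel_measurable_sum) auto
  have V0: "0 \<le> V k \<omega>" for k \<omega> unfolding V_def using \<tau>(2)[of _ k] by (intro sum_nonneg) auto
  \<comment> \<open>One nonnegative error that controls both the integral and its quadratic variation.\<close>
  define w where "w k \<omega> = ennreal ((J \<omega> - S k \<omega>)\<^sup>2) + ennreal ((sqrt (A \<omega>) - sqrt (V k \<omega>))\<^sup>2)" for k \<omega>
  have [measurable]: "w k \<in> borel_measurable M" for k unfolding w_def[abs_def] by measurable
  have tri: "ennreal ((sqrt (A \<omega>) - sqrt (V k \<omega>))\<^sup>2) \<le>
      (\<integral>\<^sup>+s\<in>{0..T}. ennreal ((H s \<omega> - simple_value (n k) (\<tau> k) (\<xi> k) s \<omega>)\<^sup>2) \<partial>lborel)" if \<omega>: "\<omega> \<in> space M" for k \<omega>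
  proof -
    let ?h = "\<lambda>s. indicator {0..T} s *\<^sub>R H s \<omega>" and ?v = "\<lambda>s. indicator {0..T} s * simple_value (n k) (\<tau> k) (\<xi> k) s \<omega>"
    have "?h \<in> borel_measurable borel"
      by (rule borel_measurable_continuous_on_indicator) (use H[OF \<omega>] in auto)
    moreover have "?v \<in> borel_measurable borel" unfolding simple_value_def by measurable
    moreover have "(\<integral>\<^sup>+s. ennreal ((?h s)\<^sup>2) \<partial>lborel) = ennreal (A \<omega>)"
      unfolding A_eq[OF \<omega>, symmetric] by (intro nn_integral_cong) (auto simp: indicator_def)
    moreover have "(\<integral>\<^sup>+s. ennreal ((?v s)\<^sup>2) \<partial>lborel) = ennreal (V k \<omega>)"
      unfolding V_def nn_integral_simple_value_square[OF sp, symmetric]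
      by (intro nn_integral_cong) (auto simp: indicator_def)
    ultimately have "ennreal ((sqrt (A \<omega>) - sqrt (V k \<omega>))\<^sup>2) \<le> (\<integral>\<^sup>+s. ennreal ((?h s - ?v s)\<^sup>2) \<partial>lborel)"
      using A_pos[OF \<omega>] V0[of k \<omega>] by (intro L2_reverse_triangle) auto
    also have "\<dots> = (\<integral>\<^sup>+s\<in>{0..T}. ennreal ((H s \<omega> - simple_value (n k) (\<tau> k) (\<xi> k) s \<omega>)\<^sup>2) \<partial>lborel)"
      by (intro nn_integral_cong) (auto simp: indicator_def)
    finally show ?thesis .
  qed
  have "(\<lambda>k. \<integral>\<^sup>+\<omega>. w k \<omega> \<partial>M) \<longlonglongrightarrow> 0"
  proof (rule tendsto_sandwich[OF _ _ tendsto_const])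
    show "(\<lambda>k. (\<integral>\<^sup>+\<omega>. ennreal ((J \<omega> - S k \<omega>)\<^sup>2) \<partial>M) + (\<integral>\<^sup>+\<omega>. (\<integral>\<^sup>+s\<in>{0..T}. ennreal ((H s \<omega> - simple_value (n k) (\<tau> k) (\<xi> k) s \<omega>)\<^sup>2)
              \<partial>lborel) \<partial>M)) \<longlonglongrightarrow> 0"
      using tendsto_add[OF lim2 lim1] by (simp add: S_def)
    show "\<forall>\<^sub>F k in sequentially. (\<integral>\<^sup>+\<omega>. w k \<omega> \<partial>M) \<le> (\<integral>\<^sup>+\<omega>. ennreal ((J \<omega> - S k \<omega>)\<^sup>2) \<partial>M) +
       (\<integral>\<^sup>+\<omega>. (\<integral>\<^sup>+s\<in>{0..T}. ennreal ((H s \<omega> - simple_value (n k) (\<tau> k) (\<xi> k) s \<omega>)\<^sup>2) \<partial>lborel) \<partial>M)"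
    proof (intro always_eventually allI)
      fix k
      have "(\<integral>\<^sup>+\<omega>. w k \<omega> \<partial>M) = (\<integral>\<^sup>+\<omega>. ennreal ((J \<omega> - S k \<omega>)\<^sup>2) \<partial>M) + (\<integral>\<^sup>+\<omega>. ennreal ((sqrt (A \<omega>) - sqrt (V k \<omega>))\<^sup>2) \<partial>M)"
        unfolding w_def by (rule nn_integral_add) auto
      also have "(\<integral>\<^sup>+\<omega>. ennreal ((sqrt (A \<omega>) - sqrt (V k \<omega>))\<^sup>2) \<partial>M) \<le>
         (\<integral>\<^sup>+\<omega>. (\<integral>\<^sup>+s\<in>{0..T}. ennreal ((H s \<omega> - simple_value (n k) (\<tau> k) (\<xi> k) s \<omega>)\<^sup>2) \<partial>lborel) \<partial>M)"
        by (intro nn_integral_mono tri)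
      finally show "(\<integral>\<^sup>+\<omega>. w k \<omega> \<partial>M) \<le> (\<integral>\<^sup>+\<omega>. ennreal ((J \<omega> - S k \<omega>)\<^sup>2) \<partial>M) +
       (\<integral>\<^sup>+\<omega>. (\<integral>\<^sup>+s\<in>{0..T}. ennreal ((H s \<omega> - simple_value (n k) (\<tau> k) (\<xi> k) s \<omega>)\<^sup>2) \<partial>lborel) \<partial>M)"
        by (simp add: add_left_mono)
    qed
  qed simp
  then obtain r :: "nat \<Rightarrow> nat" where r: "AE \<omega> in M. (\<lambda>k. w (r k) \<omega>) \<longlonglongrightarrow> 0"
    using nn_integral_tendsto_0_AE_subseq[of w M] by auto
  have both: "AE \<omega> in M. (\<lambda>k. S (r k) \<omega> / sqrt (A \<omega>)) \<longlonglongrightarrow> J \<omega> / sqrt (A \<omega>) \<and> (\<lambda>k. V (r k) \<omega> / A \<omega>) \<longlonglongrightarrow> 1"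
    using r AE_space
  proof eventually_elim
    fix \<omega> assume r: "(\<lambda>k. w (r k) \<omega>) \<longlonglongrightarrow> 0" and \<omega>: "\<omega> \<in> space M"
    have sq0: "g \<longlonglongrightarrow> 0" if "\<And>k. ennreal ((g k)\<^sup>2) \<le> w (r k) \<omega>" for g :: "nat \<Rightarrow> real"
    proof -
      have "(\<lambda>k. ennreal ((g k)\<^sup>2)) \<longlonglongrightarrow> ennreal 0"
        using tendsto_sandwich[OF _ _ tendsto_const r, of "\<lambda>k. ennreal ((g k)\<^sup>2)"] that by (simp add: always_eventually)
      then have "(\<lambda>k. (g k)\<^sup>2) \<longlonglongrightarrow> 0" by (subst (asm) tendsto_ennreal_iff) auto
      then have "(\<lambda>k. sqrt ((g k)\<^sup>2)) \<longlonglongrightarrow> sqrt 0" by (rule tendsto_real_sqrt)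
      then show ?thesis by (simp add: tendsto_rabs_zero_iff)
    qed
    have "(\<lambda>k. J \<omega> - S (r k) \<omega>) \<longlonglongrightarrow> 0" by (rule sq0) (simp add: w_def)
    from tendsto_diff[OF tendsto_const this, of "J \<omega>"] have S: "(\<lambda>k. S (r k) \<omega>) \<longlonglongrightarrow> J \<omega>" by simp
    have "(\<lambda>k. sqrt (A \<omega>) - sqrt (V (r k) \<omega>)) \<longlonglongrightarrow> 0" by (rule sq0) (simp add: w_def)
    from tendsto_diff[OF tendsto_const this, of "sqrt (A \<omega>)"]
    have "(\<lambda>k. (sqrt (V (r k) \<omega>))\<^sup>2) \<longlonglongrightarrow> (sqrt (A \<omega>))\<^sup>2" by (intro tendsto_power) simp
    then have V: "(\<lambda>k. V (r k) \<omega>) \<longlonglongrightarrow> A \<omega>" using V0 A_pos[OF \<omega>] by simp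
    have "(\<lambda>k. V (r k) \<omega> / A \<omega>) \<longlonglongrightarrow> A \<omega> / A \<omega>"
      using A_pos[OF \<omega>] by (intro tendsto_intros V) auto
    moreover have "(\<lambda>k. S (r k) \<omega> / sqrt (A \<omega>)) \<longlonglongrightarrow> J \<omega> / sqrt (A \<omega>)"
      using A_pos[OF \<omega>] by (intro tendsto_intros S) auto
    ultimately show "(\<lambda>k. S (r k) \<omega> / sqrt (A \<omega>)) \<longlonglongrightarrow> J \<omega> / sqrt (A \<omega>) \<and> (\<lambda>k. V (r k) \<omega> / A \<omega>) \<longlonglongrightarrow> 1"
      using A_pos[OF \<omega>] by simp
  qed
  show ?thesis
  proof (rule std_normal_if_char)
    show "(\<lambda>\<omega>. J \<omega> / sqrt (A \<omega>)) \<in> borel_measurable M" by measurable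
    show "(CLINT \<omega>|M. iexp (u * (J \<omega> / sqrt (A \<omega>)))) = complex_of_real (exp (- u\<^sup>2 / 2))" for u
    proof (rule char_limit_of_self_normalized_sums[where \<tau>="\<lambda>k. \<tau> (r k)" and n="\<lambda>k. n (r k)" and
          \<eta>="\<lambda>k i \<omega>. \<xi> (r k) i \<omega> / sqrt (A \<omega>)"])
      show "(\<lambda>\<omega>. J \<omega> / sqrt (A \<omega>)) \<in> borel_measurable M" by measurable
      show "(\<lambda>\<omega>. \<xi> (r k) i \<omega> / sqrt (A \<omega>)) \<in> borel_measurable (G (\<tau> (r k) i))" if "i < n (r k)" for k i
      proof -
        have [measurable]: "A \<in> borel_measurable (G (\<tau> (r k) i))"
          using that \<tau>0 by (intro measurable_G_mono[OF A]) auto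
        have [measurable]: "\<xi> (r k) i \<in> borel_measurable (G (\<tau> (r k) i))" using that by (rule \<xi>)
        show ?thesis by measurable
      qed
      show "AE \<omega> in M. (\<lambda>k. \<Sum>i<n (r k). (\<xi> (r k) i \<omega> / sqrt (A \<omega>))\<^sup>2 * (\<tau> (r k) (Suc i) - \<tau> (r k) i)) \<longlonglongrightarrow> 1"
        using both AE_space
      proof eventually_elim
        case (elim \<omega>)
        then show ?case using A_pos[of \<omega>] by (simp add: V_def sum_divide_distrib power_divide)
      qed
      show "AE \<omega> in M. (\<lambda>k. \<Sum>i<n (r k). \<xi> (r k) i \<omega> / sqrt (A \<omega>) * (B (\<tau> (r k) (Suc i)) \<omega> - B (\<tau> (r k) i) \<omega>))
          \<longlonglongrightarrow> J \<omega> / sqrt (A \<omega>)"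
        using both by eventually_elim (simp add: S_def simple_integral_def sum_divide_distrib)
    qed (use \<tau> in auto)
  qed
qed

end

section \<open>The Laplace method for exponential integrals with drift\<close>

lemma integral_scale_01:
  fixes f :: "real \<Rightarrow> real"
  assumes "0 < t" "continuous_on {0..t} f"
  shows "integral {0..t} f = t * integral {0..1} (\<lambda>s. f (t * s))"
proof -
  have "(f has_integral integral {0..t} f) (cbox 0 t)"
    using assms by (simp add: integrable_continuous_interval integrable_integral)
  from has_integral_affinity[OF this, of t 0] assms(1)
  have "((\<lambda>s. f (t * s)) has_integral (1 / t) * integral {0..t} f) ((\<lambda>x. x / t) ` {0..t})"
    by simp
  also have "(\<lambda>x. x / t) ` {0..t} = {0..1}"
    using assms(1) by (auto simp: image_iff intro!: bexI[of _ "t * _"] mult_left_le)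
  finally show ?thesis using assms(1) by (simp add: integral_unique)
qed

lemma integral_reflect_01:
  fixes f :: "real \<Rightarrow> real"
  assumes "continuous_on {0..1} f"
  shows "integral {0..1} (\<lambda>s. f (1 - s)) = integral {0..1} f"
proof -
  have "(f has_integral integral {0..1} f) (cbox 0 1)"
    using assms by (simp add: integrable_continuous_interval integrable_integral)
  from has_integral_affinity[OF this, of "-1" 1]
  have "((\<lambda>s. f (1 - s)) has_integral integral {0..1} f) ((\<lambda>x. 1 - x) ` {0..1})"
    by simp
  also have "(\<lambda>x::real. 1 - x) ` {0..1} = {0..1}"
    by (auto simp: image_iff intro!: bexI[of _ "1 - _"])
  finally show ?thesis by (simp add: integral_unique)
qed

lemma riemann_sum_tendsto:
  fixes f :: "real \<Rightarrow> real"
  assumes f: "continuous_on {0..1} f"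
  shows "(\<lambda>n. (\<Sum>j<n. f (real (Suc j) / real n)) / real n) \<longlonglongrightarrow> integral {0..1} f"
proof (rule LIMSEQ_I)
  fix e :: real assume e: "0 < e"
  have "uniformly_continuous_on {0..1} f"
    using f by (rule compact_uniformly_continuous) simp
  then obtain d where d: "d > 0" and unif: "\<And>x y. x \<in> {0..1} \<Longrightarrow> y \<in> {0..1} \<Longrightarrow> dist y x < d \<Longrightarrow> dist (f y) (f x) < e / 2"
    using e unfolding uniformly_continuous_on_def by (metis half_gt_zero)
  obtain n0 :: nat where n0: "1 / d < real n0" using reals_Archimedean2 by blast
  have "norm ((\<Sum>j<n. f (real (Suc j) / real n)) / real n - integral {0..1} f) < e" if n: "n \<ge> n0" for n
  proof -
    have npos: "0 < n" using n n0 d by (metis not_gr0 le_zero_eq of_nat_0 less_divide_eq_1_pos not_less_iff_gr_or_eq zero_less_divide_1_iff order_less_trans)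
    have nd: "1 / real n < d"
      using n n0 d npos by (simp add: field_simps) (smt (verit) mult_left_mono of_nat_mono)
    have "\<bar>integral {0..real m / real n} f - (\<Sum>j<m. f (real (Suc j) / real n)) / real n\<bar> \<le> real m * (e / 2 / real n)"
      if "m \<le> n" for m
      using that
    proof (induction m)
      case (Suc m)
      let ?a = "real m / real n" and ?b = "real (Suc m) / real n"
      have ab: "0 \<le> ?a" "?a \<le> ?b" "?b \<le> 1" "?b - ?a = 1 / real n"
        using Suc.prems npos by (auto simp: field_simps)
      have int: "f integrable_on {0..?b}" "f integrable_on {?a..?b}"
      proof -
        have "{0..?b} \<subseteq> {0..1}" "{?a..?b} \<subseteq> {0..1}" using ab(1-3) unfolding atLeastatMost_subset_iff by linarith+
        then show "f integrable_on {0..?b}" "f integrable_on {?a..?b}"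
          by (simp_all only: integrable_continuous_interval continuous_on_subset[OF f])
      qed
      have comb: "integral {0..?a} f + integral {?a..?b} f = integral {0..?b} f"
        using ab int by (intro Henstock_Kurzweil_Integration.integral_combine) auto
      have "\<bar>integral {?a..?b} (\<lambda>s. f s - f ?b)\<bar> \<le> e / 2 * (?b - ?a)"
      proof -
        have "norm (integral (cbox ?a ?b) (\<lambda>s. f s - f ?b)) \<le> e / 2 * Henstock_Kurzweil_Integration.content (cbox ?a ?b)"
        proof (rule integrable_bound)
          show "(\<lambda>s. f s - f ?b) integrable_on cbox ?a ?b" using int by (auto intro!: integrable_diff)
          show "norm (f s - f ?b) \<le> e / 2" if "s \<in> cbox ?a ?b" for s
          proof -
            have "s \<in> {0..1}" "dist s ?b < d" "?b \<in> {0..1}"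
              using that ab nd unfolding dist_real_def atLeastAtMost_iff cbox_interval by linarith+
            then show ?thesis using unif[of ?b s] by (simp add: dist_real_def)
          qed
        qed (use e in simp)
        then show ?thesis using ab by simp
      qed
      moreover have "integral {?a..?b} (\<lambda>s. f s - f ?b) = integral {?a..?b} f - f ?b / real n"
        using int ab by (subst integral_diff) auto
      ultimately have "\<bar>integral {?a..?b} f - f ?b / real n\<bar> \<le> e / 2 / real n"
        using ab(4) by simp
      with Suc comb show ?case
        by (simp add: add_divide_distrib algebra_simps)
    qed simp
    from this[of n] npos have "\<bar>integral {0..1} f - (\<Sum>j<n. f (real (Suc j) / real n)) / real n\<bar> \<le> e / 2"
      by simp
    with e show ?thesis by (simp add: abs_minus_commute)
  qed
  then show "\<exists>no. \<forall>n\<ge>no. norm ((\<Sum>j<n. f (real (Suc j) / real n)) / real n - integral {0..1} f) < e" by blast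
qed

text \<open>
  The exponent may depend on the parameter \<open>l\<close>, so a maximal value \<open>m\<close> has to be approached on an
  interval that is not too short. Length \<open>d / l\<close> suffices because \<open>ln (d / l) / l\<close> tends to \<open>0\<close>, and
  this is the length on which a drift of slope proportional to \<open>l\<close> stays small.
\<close>
lemma laplace_method:
  fixes h :: "real \<Rightarrow> real \<Rightarrow> real"
  assumes cont: "\<And>l. continuous_on {0..1} (h l)"
    and upper: "\<And>e. e > 0 \<Longrightarrow> \<forall>\<^sub>F l in at_top. \<forall>s\<in>{0..1}. h l s \<le> m + e"
    and lower: "\<And>e. e > 0 \<Longrightarrow> \<exists>d>0. \<forall>\<^sub>F l in at_top. \<exists>x\<ge>0. x + d / l \<le> 1 \<and> (\<forall>s\<in>{x..x + d / l}. m - e \<le> h l s)"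
  shows "((\<lambda>l. ln (integral {0..1} (\<lambda>s. exp (2 * l * h l s))) / (2 * l)) \<longlongrightarrow> m) at_top"
proof (rule tendstoI)
  fix e :: real assume e: "0 < e"
  then have e2: "0 < e / 2" by simp
  obtain d where d: "d > 0" and low: "\<forall>\<^sub>F l in at_top. \<exists>x\<ge>0. x + d / l \<le> 1 \<and> (\<forall>s\<in>{x..x + d / l}. m - e / 2 \<le> h l s)"
    using lower[OF e2] by blast
  have "((\<lambda>l::real. ln (d / l) / (2 * l)) \<longlongrightarrow> 0) at_top"
    using d by real_asymp
  then have small: "\<forall>\<^sub>F l in at_top. - (e / 2) < ln (d / l) / (2 * l)"
    using e by (intro order_tendstoD) auto
  show "\<forall>\<^sub>F l in at_top. dist (ln (integral {0..1} (\<lambda>s. exp (2 * l * h l s))) / (2 * l)) m < e"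
    using upper[OF e2] low small eventually_gt_at_top[of 0]
  proof eventually_elim
    case (elim l)
    then obtain x where x: "x \<ge> 0" "x + d / l \<le> 1" "\<And>s. s \<in> {x..x + d / l} \<Longrightarrow> m - e / 2 \<le> h l s" by blast
    let ?I = "integral {0..1} (\<lambda>s. exp (2 * l * h l s))"
    have int: "(\<lambda>s. exp (2 * l * h l s)) integrable_on {0..1}"
      by (intro integrable_continuous_interval continuous_intros cont)
    have dl: "0 < d / l" using d elim by simp
    have "?I \<le> integral {0..1} (\<lambda>s::real. exp (2 * l * (m + e / 2)))"
      using elim by (intro integral_le int) auto
    then have up: "?I \<le> exp (2 * l * (m + e / 2))" by simp
    have int': "(\<lambda>s. exp (2 * l * h l s)) integrable_on {x..x + d / l}"
      using x by (intro integrable_on_subinterval[OF int]) auto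
    have "d / l * exp (2 * l * (m - e / 2)) = integral {x..x + d / l} (\<lambda>s::real. exp (2 * l * (m - e / 2)))"
      using dl by simp
    also have "\<dots> \<le> integral {x..x + d / l} (\<lambda>s. exp (2 * l * h l s))"
      using elim x by (intro integral_le int') auto
    also have "\<dots> \<le> ?I"
      using x int int' by (intro integral_subset_le) auto
    finally have lo: "d / l * exp (2 * l * (m - e / 2)) \<le> ?I" .
    have I0: "0 < ?I" by (rule less_le_trans[OF mult_pos_pos[OF dl exp_gt_zero] lo])
    have "ln ?I \<le> 2 * l * (m + e / 2)" using up I0 by (metis ln_exp ln_le_cancel_iff exp_gt_zero)
    then have u: "ln ?I / (2 * l) \<le> m + e / 2" using elim by (simp add: divide_le_eq mult.commute)
    have "ln (d / l) + 2 * l * (m - e / 2) = ln (d / l * exp (2 * l * (m - e / 2)))"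
      using ln_mult_pos[OF dl exp_gt_zero] by simp
    also have "\<dots> \<le> ln ?I" by (rule ln_mono[OF lo mult_pos_pos[OF dl exp_gt_zero]])
    finally have "(ln (d / l) + 2 * l * (m - e / 2)) / (2 * l) \<le> ln ?I / (2 * l)" using elim by (intro divide_right_mono) auto
    then have "ln (d / l) / (2 * l) + (m - e / 2) \<le> ln ?I / (2 * l)" using elim by (simp add: add_divide_distrib)
    with u elim e show ?case by (simp add: dist_real_def abs_less_iff)
  qed
qed

text \<open>
  Change of parameter \<open>l = sqrt t\<close>; the factor \<open>t\<close> from Brownian scaling is negligible.
\<close>
lemma half_log_integral_tendsto:
  fixes I :: "real \<Rightarrow> real"
  assumes I: "\<And>t. 0 < t \<Longrightarrow> 0 < I t"
    and lim: "((\<lambda>l. ln (I (l\<^sup>2)) / (2 * l)) \<longlongrightarrow> m) at_top"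
  shows "((\<lambda>t. ln (t * I t) / 2 / sqrt t) \<longlongrightarrow> m) at_top"
proof -
  have "((\<lambda>t. ln (I ((sqrt t)\<^sup>2)) / (2 * sqrt t)) \<longlongrightarrow> m) at_top"
    by (rule filterlim_compose[OF lim sqrt_at_top])
  moreover have "((\<lambda>t::real. ln t / 2 / sqrt t) \<longlongrightarrow> 0) at_top" by real_asymp
  ultimately have "((\<lambda>t. ln t / 2 / sqrt t + ln (I ((sqrt t)\<^sup>2)) / (2 * sqrt t)) \<longlongrightarrow> 0 + m) at_top"
    by (intro tendsto_add)
  then have lim': "((\<lambda>t. ln t / 2 / sqrt t + ln (I ((sqrt t)\<^sup>2)) / (2 * sqrt t)) \<longlongrightarrow> m) at_top" by simp
  have "\<forall>\<^sub>F t in at_top. ln t / 2 / sqrt t + ln (I ((sqrt t)\<^sup>2)) / (2 * sqrt t) = ln (t * I t) / 2 / sqrt t"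
    using eventually_gt_at_top[of 0]
  proof eventually_elim
    case (elim t)
    then have "ln (t * I t) = ln t + ln (I t)" using I[of t] by (intro ln_mult_pos) auto
    then show ?case using elim by (simp add: add_divide_distrib)
  qed
  with lim' show ?thesis by (rule Lim_transform_eventually)
qed

lemma integral_exp_pos:
  fixes f :: "real \<Rightarrow> real"
  assumes "continuous_on {a..b} f" "a < b"
  shows "0 < integral {a..b} (\<lambda>s. exp (f s))"
proof -
  obtain x where x: "\<And>s. s \<in> {a..b} \<Longrightarrow> f x \<le> f s"
    using continuous_attains_inf[of "{a..b}" f] assms by force
  have "0 < (b - a) * exp (f x)" using assms by simp
  also have "\<dots> = integral {a..b} (\<lambda>s. exp (f x))" using assms by simp
  also have "\<dots> \<le> integral {a..b} (\<lambda>s. exp (f s))"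
    using x by (intro integral_le integrable_continuous_interval continuous_intros assms) auto
  finally show ?thesis .
qed

text \<open>
  The maximum point \<open>s0\<close> may be an end point of \<open>[0, 1]\<close>, so the interval on which \<open>g\<close> is nearly
  maximal is placed on the side of \<open>s0\<close> that has room.
\<close>
lemma log_integral_exp_no_drift:
  fixes g :: "real \<Rightarrow> real"
  assumes g: "continuous_on {0..1} g" and m: "s0 \<in> {0..1}" "\<And>s. s \<in> {0..1} \<Longrightarrow> g s \<le> g s0"
  shows "((\<lambda>t. ln (t * integral {0..1} (\<lambda>s. exp (2 * (sqrt t * g s)))) / 2 / sqrt t) \<longlongrightarrow> g s0) at_top"
proof (rule half_log_integral_tendsto)
  show "0 < integral {0..1} (\<lambda>s. exp (2 * (sqrt t * g s)))" for t
    by (intro integral_exp_pos continuous_intros g) simp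
  have "((\<lambda>l. ln (integral {0..1} (\<lambda>s. exp (2 * l * g s))) / (2 * l)) \<longlongrightarrow> g s0) at_top"
  proof (rule laplace_method)
    show "\<forall>\<^sub>F l::real in at_top. \<forall>s\<in>{0..1}. g s \<le> g s0 + e" if "e > 0" for e
      using m(2) that by (intro always_eventually allI ballI) (fastforce intro: add_increasing2)
    show "\<exists>d>0. \<forall>\<^sub>F l in at_top. \<exists>x\<ge>0. x + d / l \<le> 1 \<and> (\<forall>s\<in>{x..x + d / l}. g s0 - e \<le> g s)" if e: "e > 0" for e
    proof -
      obtain d where d: "d > 0" "\<And>s. s \<in> {0..1} \<Longrightarrow> dist s s0 < d \<Longrightarrow> dist (g s) (g s0) < e"
        using g m(1) e unfolding continuous_on_iff by metis
      define d' where "d' = min (d / 2) (1 / 2)"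
      have "\<forall>\<^sub>F l in at_top. \<exists>x\<ge>0. x + d' / l \<le> 1 \<and> (\<forall>s\<in>{x..x + d' / l}. g s0 - e \<le> g s)"
        using eventually_ge_at_top[of 1]
      proof eventually_elim
        case (elim l)
        have d2: "d' < d" "d' \<le> 1 / 2" "0 < d'" using d by (auto simp: d'_def)
        have dl: "0 < d' / l" "d' / l \<le> d'" using d2(3) elim by (auto simp: divide_le_eq)
        define x where "x = (if s0 \<le> 1 / 2 then s0 else s0 - d' / l)"
        have "x \<ge> 0" "x + d' / l \<le> 1" using m(1) dl d2 by (auto simp: x_def)
        moreover have "g s0 - e \<le> g s" if "s \<in> {x..x + d' / l}" for s
        proof -
          have "\<bar>s - s0\<bar> \<le> d' / l" using that dl(1) by (cases "s0 \<le> 1 / 2") (simp_all add: x_def abs_le_iff)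
          then have "dist s s0 < d" using dl(2) d2(1) by (simp add: dist_real_def)
          then show ?thesis using d(2)[of s] that \<open>x \<ge> 0\<close> \<open>x + d' / l \<le> 1\<close> by (auto simp: dist_real_def)
        qed
        ultimately show ?case by blast
      qed
      moreover have "d' > 0" using d by (simp add: d'_def)
      ultimately show ?thesis by blast
    qed
  qed (rule g)
  then show "((\<lambda>l. ln (integral {0..1} (\<lambda>s. exp (2 * (sqrt (l\<^sup>2) * g s)))) / (2 * l)) \<longlongrightarrow> g s0) at_top"
    by (rule Lim_transform_eventually)
       (use eventually_gt_at_top[of 0] in eventually_elim, simp add: mult.assoc)
qed

text \<open>
  With \<open>l = sqrt t\<close> the exponent is \<open>2 l (b l s + g s)\<close>. Away from \<open>s = 0\<close> the drift \<open>b l s\<close> beats the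
  bounded function \<open>g\<close>; on \<open>[0, d / l]\<close> it is at least \<open>b d\<close>, which is small for small \<open>d\<close>.
\<close>
lemma log_integral_exp_negative_drift:
  fixes g :: "real \<Rightarrow> real"
  assumes g: "continuous_on {0..1} g" and b: "b < 0"
  shows "((\<lambda>t. ln (t * integral {0..1} (\<lambda>s. exp (2 * (b * t * s + sqrt t * g s)))) / 2 / sqrt t) \<longlongrightarrow> g 0) at_top"
proof (rule half_log_integral_tendsto)
  show "0 < integral {0..1} (\<lambda>s. exp (2 * (b * t * s + sqrt t * g s)))" for t
    by (intro integral_exp_pos continuous_intros g) simp
  have near: "\<exists>d>0. \<forall>s\<in>{0..1}. s \<le> d \<longrightarrow> \<bar>g s - g 0\<bar> < e" if "e > 0" for e
  proof -
    have "\<exists>d>0. \<forall>s\<in>{0..1}. dist s 0 < d \<longrightarrow> dist (g s) (g 0) < e"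
      using bspec[OF g[unfolded continuous_on_iff], of 0] that by simp
    then obtain d where d: "d > 0" "\<And>s. s \<in> {0..1} \<Longrightarrow> dist s 0 < d \<Longrightarrow> dist (g s) (g 0) < e" by blast
    have "\<bar>g s - g 0\<bar> < e" if "s \<in> {0..1}" "s \<le> d / 2" for s
      using d(2)[of s] that d(1) by (simp add: dist_real_def)
    then show ?thesis using d(1) by (intro exI[of _ "d / 2"]) simp
  qed
  have "((\<lambda>l. ln (integral {0..1} (\<lambda>s. exp (2 * l * (b * l * s + g s)))) / (2 * l)) \<longlongrightarrow> g 0) at_top"
  proof (rule laplace_method)
    show "continuous_on {0..1} (\<lambda>s. b * l * s + g s)" for l by (intro continuous_intros g)
    show "\<forall>\<^sub>F l in at_top. \<forall>s\<in>{0..1}. b * l * s + g s \<le> g 0 + e" if e: "e > 0" for e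
    proof -
      obtain d where d: "d > 0" "\<And>s. s \<in> {0..1} \<Longrightarrow> s \<le> d \<Longrightarrow> \<bar>g s - g 0\<bar> < e" using near[OF e] by blast
      obtain K where K: "\<And>s. s \<in> {0..1} \<Longrightarrow> g s \<le> K"
        using continuous_attains_sup[of "{0..1}" g] g by force
      have "\<forall>\<^sub>F l in at_top. (K - g 0) / (- b * d) \<le> l" by (rule eventually_ge_at_top)
      then show ?thesis using eventually_gt_at_top[of 0]
      proof eventually_elim
        case (elim l)
        show ?case
        proof
          fix s :: real assume s: "s \<in> {0..1}"
          show "b * l * s + g s \<le> g 0 + e"
          proof (cases "s \<le> d")
            case True
            have "b * l * s \<le> 0" using b elim s by (simp add: mult_nonpos_nonneg mult_nonneg_nonneg mult.assoc)
            then show ?thesis using d(2)[OF s True] by linarith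
          next
            case False
            have "0 < - b * d" using b d(1) by (simp add: mult_neg_pos)
            then have "K - g 0 \<le> l * (- b * d)" using elim(1) by (simp only: pos_divide_le_eq)
            moreover have "l * (- b) * d \<le> l * (- b) * s" using False elim b by (intro mult_left_mono) (auto simp: mult_nonneg_nonpos)
            ultimately show ?thesis using K[OF s] e by (simp add: algebra_simps)
          qed
        qed
      qed
    qed
    show "\<exists>d>0. \<forall>\<^sub>F l in at_top. \<exists>x\<ge>0. x + d / l \<le> 1 \<and> (\<forall>s\<in>{x..x + d / l}. g 0 - e \<le> b * l * s + g s)" if e: "e > 0" for e
    proof -
      obtain d0 where d0: "d0 > 0" "\<And>s. s \<in> {0..1} \<Longrightarrow> s \<le> d0 \<Longrightarrow> \<bar>g s - g 0\<bar> < e / 2" using near[of "e / 2"] e by auto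
      define d where "d = Min {d0, 1, e / (- 2 * b)}"
      have d: "d > 0" "d \<le> d0" "d \<le> 1" "d \<le> e / (- 2 * b)" using d0 b e by (auto simp: d_def divide_pos_neg)
      have bd: "- b * d \<le> e / 2" using d(4) b by (simp add: field_simps)
      have "\<forall>\<^sub>F l in at_top. \<exists>x\<ge>0. x + d / l \<le> 1 \<and> (\<forall>s\<in>{x..x + d / l}. g 0 - e \<le> b * l * s + g s)"
        using eventually_ge_at_top[of 1]
      proof eventually_elim
        case (elim l)
        have dl: "0 < d / l" "d / l \<le> d" using d elim by (auto simp: divide_le_eq mult_le_cancel_left1)
        have "g 0 - e \<le> b * l * s + g s" if s: "s \<in> {0..0 + d / l}" for s
        proof -
          have "l * s \<le> d" using s elim by (simp add: field_simps)
          then have "- b * (l * s) \<le> - b * d" using b by (intro mult_left_mono) auto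
          moreover have "\<bar>g s - g 0\<bar> < e / 2" using s dl d by (intro d0(2)) auto
          ultimately have "b * d \<le> b * (l * s)" "- (e / 2) < g s - g 0" "- (b * d) \<le> e / 2" using bd by (simp_all, linarith)
          then show ?thesis unfolding mult.assoc by linarith
        qed
        then show ?case using dl d by (intro exI[of _ 0]) auto
      qed
      with d(1) show ?thesis by blast
    qed
  qed
  then show "((\<lambda>l. ln (integral {0..1} (\<lambda>s. exp (2 * (b * l\<^sup>2 * s + sqrt (l\<^sup>2) * g s)))) / (2 * l)) \<longlongrightarrow> g 0) at_top"
    by (rule Lim_transform_eventually)
       (use eventually_gt_at_top[of 0] in eventually_elim, simp add: algebra_simps power2_eq_square)
qed

text \<open>
  Time reversal \<open>s \<mapsto> 1 - s\<close> reduces this to negative drift, with the factor \<open>exp (2 b t)\<close> split off.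
\<close>
lemma log_integral_exp_positive_drift:
  fixes g :: "real \<Rightarrow> real"
  assumes g: "continuous_on {0..1} g" and b: "0 < b"
  shows "((\<lambda>t. (ln (t * integral {0..1} (\<lambda>s. exp (2 * (b * t * s + sqrt t * g s)))) / 2 - b * t) / sqrt t) \<longlongrightarrow> g 1) at_top"
proof -
  have g': "continuous_on {0..1} (\<lambda>s. g (1 - s))"
    by (intro continuous_on_compose2[OF g] continuous_intros) auto
  from log_integral_exp_negative_drift[OF g', of "- b"] b
  have "((\<lambda>t. ln (t * integral {0..1} (\<lambda>s. exp (2 * (- b * t * s + sqrt t * g (1 - s))))) / 2 / sqrt t) \<longlongrightarrow> g 1) at_top"
    by simp
  then show ?thesis
  proof (rule Lim_transform_eventually)
    show "\<forall>\<^sub>F t in at_top. ln (t * integral {0..1} (\<lambda>s. exp (2 * (- b * t * s + sqrt t * g (1 - s))))) / 2 / sqrt t =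
      (ln (t * integral {0..1} (\<lambda>s. exp (2 * (b * t * s + sqrt t * g s)))) / 2 - b * t) / sqrt t"
      using eventually_gt_at_top[of 0]
    proof eventually_elim
      case (elim t)
      let ?f = "\<lambda>s. exp (2 * (b * t * s + sqrt t * g s))"
      have cont: "continuous_on {0..1} ?f" by (intro continuous_intros g)
      have "exp (2 * (- b * t * s + sqrt t * g (1 - s))) = exp (- 2 * b * t) * ?f (1 - s)" for s
        by (simp add: exp_add[symmetric] algebra_simps)
      then have "integral {0..1} (\<lambda>s. exp (2 * (- b * t * s + sqrt t * g (1 - s)))) = exp (- 2 * b * t) * integral {0..1} ?f"
        using integral_reflect_01[OF cont] by simp
      moreover have "0 < integral {0..1} ?f" by (intro integral_exp_pos continuous_intros g) simp
      ultimately have "ln (t * integral {0..1} (\<lambda>s. exp (2 * (- b * t * s + sqrt t * g (1 - s))))) =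
          ln (t * integral {0..1} ?f) - 2 * b * t"
        using elim by (simp add: ln_mult_pos)
      then show ?case by (simp add: diff_divide_distrib)
    qed
  qed
qed

section \<open>Brownian scaling of exponential functionals\<close>

lemma (in prob_space) distr_eq_normal_density:
  "distributed M lborel D (normal_density \<mu> \<sigma>) \<Longrightarrow> distr M borel D = density lborel (normal_density \<mu> \<sigma>)"
  by (drule distributed_distr_eq_density) (simp cong: distr_cong)

text \<open>
  On both sides the increments are independent and \<open>normal(0, t / n)\<close>, so both laws are the same
  product measure.
\<close>
lemma brownian_increments_scaling:
  assumes W: "brownian_motion M W" and t: "0 < t" and n: "0 < n"
  shows "distr M (PiM {..<n} (\<lambda>_. borel)) (\<lambda>\<omega>. \<lambda>i\<in>{..<n}. W (t * real (Suc i) / real n) \<omega> - W (t * real i / real n) \<omega>) =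
    distr M (PiM {..<n} (\<lambda>_. borel)) (\<lambda>\<omega>. \<lambda>i\<in>{..<n}. sqrt t * (W (real (Suc i) / real n) \<omega> - W (real i / real n) \<omega>))"
proof -
  interpret prob_space M using W by (simp add: brownian_motion_def)
  have meas: "W r \<in> borel_measurable M" if "0 \<le> r" for r
    using W that by (rule brownian_motion_measurable)
  have ind: "indep_vars (\<lambda>_. borel) (\<lambda>i \<omega>. W (c * real (Suc i) / real n) \<omega> - W (c * real i / real n) \<omega>) {..<n}" if "0 < c" for c
  proof -
    have "0 \<le> c * real 0 / real n \<and> (\<forall>i<n. c * real i / real n < c * real (Suc i) / real n)"
      using that n by (simp add: divide_strict_right_mono)
    moreover have all: "\<And>(n::nat) \<tau>. 0 \<le> \<tau> 0 \<and> (\<forall>i<n. \<tau> i < \<tau> (Suc i)) \<Longrightarrow>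
        indep_vars (\<lambda>_. borel) (\<lambda>i \<omega>. W (\<tau> (Suc i)) \<omega> - W (\<tau> i) \<omega>) {..<n}"
      using W by (simp add: brownian_motion_def)
    ultimately show ?thesis
      by (intro all[of "\<lambda>i. c * real i / real n"])
  qed
  have norm: "distributed M lborel (\<lambda>\<omega>. W (c * real (Suc i) / real n) \<omega> - W (c * real i / real n) \<omega>) (normal_density 0 (sqrt (c / real n)))" if "0 < c" for c i
  proof -
    have "0 \<le> c * real i / real n" "c * real i / real n < c * real (Suc i) / real n"
      using that n by (simp_all add: divide_strict_right_mono)
    then have "distributed M lborel (\<lambda>\<omega>. W (c * real (Suc i) / real n) \<omega> - W (c * real i / real n) \<omega>)
        (normal_density 0 (sqrt (c * real (Suc i) / real n - c * real i / real n)))"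
      using W unfolding brownian_motion_def by blast
    also have "c * real (Suc i) / real n - c * real i / real n = c / real n" by (simp add: algebra_simps add_divide_distrib)
    finally show ?thesis .
  qed
  have norm2: "distributed M lborel (\<lambda>\<omega>. sqrt t * (W (real (Suc i) / real n) \<omega> - W (real i / real n) \<omega>)) (normal_density 0 (sqrt (t / real n)))" for i
  proof -
    have "distributed M lborel (\<lambda>\<omega>. 0 + sqrt t * (W (1 * real (Suc i) / real n) \<omega> - W (1 * real i / real n) \<omega>))
       (normal_density (0 + sqrt t * 0) (\<bar>sqrt t\<bar> * sqrt (1 / real n)))"
      using t n by (intro normal_density_affine norm) auto
    moreover have "\<bar>sqrt t\<bar> * sqrt (1 / real n) = sqrt (t / real n)"
      using t by (simp add: real_sqrt_divide)
    ultimately show ?thesis by simp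
  qed
  have "indep_vars (\<lambda>_. borel) (\<lambda>i \<omega>. sqrt t * (W (1 * real (Suc i) / real n) \<omega> - W (1 * real i / real n) \<omega>)) {..<n}"
    by (rule indep_vars_compose2[OF ind[of 1], of "\<lambda>_. (*) (sqrt t)"]) auto
  then have ind2: "indep_vars (\<lambda>_. borel) (\<lambda>i \<omega>. sqrt t * (W (real (Suc i) / real n) \<omega> - W (real i / real n) \<omega>)) {..<n}"
    by simp
  have ne: "{..<n} \<noteq> {}" using n by auto
  have "distr M (PiM {..<n} (\<lambda>_. borel)) (\<lambda>\<omega>. \<lambda>i\<in>{..<n}. W (t * real (Suc i) / real n) \<omega> - W (t * real i / real n) \<omega>) =
    (\<Pi>\<^sub>M i\<in>{..<n}. distr M borel (\<lambda>\<omega>. W (t * real (Suc i) / real n) \<omega> - W (t * real i / real n) \<omega>))"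
    using ind[OF t] t n by (subst (asm) indep_vars_iff_distr_eq_PiM'[OF ne]) (auto intro!: meas borel_measurable_diff)
  also have "\<dots> = (\<Pi>\<^sub>M i\<in>{..<n}. distr M borel (\<lambda>\<omega>. sqrt t * (W (real (Suc i) / real n) \<omega> - W (real i / real n) \<omega>)))"
    unfolding distr_eq_normal_density[OF norm[OF t]] distr_eq_normal_density[OF norm2] ..
  also have "\<dots> = distr M (PiM {..<n} (\<lambda>_. borel)) (\<lambda>\<omega>. \<lambda>i\<in>{..<n}. sqrt t * (W (real (Suc i) / real n) \<omega> - W (real i / real n) \<omega>))"
    using ind2 t n by (subst (asm) indep_vars_iff_distr_eq_PiM'[OF ne]) (auto intro!: meas borel_measurable_diff borel_measurable_times)
  finally show ?thesis .
qed

text \<open>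
  With \<open>c = a t\<close> and \<open>w s = W (t s)\<close>, the product \<open>t * exp_functional k c w\<close> is
  \<open>\<integral>\<^sub>0\<^sup>t exp (2 k (a s + W s)) ds\<close>, the conditional variance of the stochastic integral.
\<close>
definition exp_functional :: "real \<Rightarrow> real \<Rightarrow> (real \<Rightarrow> real) \<Rightarrow> real" where
  "exp_functional k c w = integral {0..1} (\<lambda>s. exp (2 * k * (c * s + w s)))"

definition exp_functional_sum :: "real \<Rightarrow> real \<Rightarrow> nat \<Rightarrow> (nat \<Rightarrow> real) \<Rightarrow> real" where
  "exp_functional_sum k c n x = (\<Sum>j<n. exp (2 * k * (c * (real (Suc j) / real n) + x j))) / real n"

lemma exp_functional_pos: "continuous_on {0..1} w \<Longrightarrow> 0 < exp_functional k c w"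
  unfolding exp_functional_def by (intro integral_exp_pos continuous_intros) auto

lemma exp_functional_sum_tendsto:
  assumes "continuous_on {0..1} w"
  shows "(\<lambda>n. exp_functional_sum k c n (\<lambda>j. w (real (Suc j) / real n))) \<longlonglongrightarrow> exp_functional k c w"
  unfolding exp_functional_def exp_functional_sum_def
  by (rule riemann_sum_tendsto[of "\<lambda>s. exp (2 * k * (c * s + w s))"]) (intro continuous_intros assms)

text \<open>
  Riemann sums show that the functional is measurable for every sigma-algebra that contains the path,
  in particular for the one generated by \<open>W\<close> alone.
\<close>
lemma exp_functional_measurable:
  assumes cont: "\<And>\<omega>. \<omega> \<in> space N \<Longrightarrow> continuous_on {0..1} (\<lambda>s. w s \<omega>)"
    and meas: "\<And>s. 0 \<le> s \<Longrightarrow> w s \<in> borel_measurable N"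
  shows "(\<lambda>\<omega>. exp_functional k c (\<lambda>s. w s \<omega>)) \<in> borel_measurable N"
proof (rule borel_measurable_LIMSEQ_real)
  show "(\<lambda>n. exp_functional_sum k c n (\<lambda>j. w (real (Suc j) / real n) \<omega>)) \<longlonglongrightarrow> exp_functional k c (\<lambda>s. w s \<omega>)"
    if "\<omega> \<in> space N" for \<omega>
    using cont[OF that] by (rule exp_functional_sum_tendsto)
  show "(\<lambda>\<omega>. exp_functional_sum k c n (\<lambda>j. w (real (Suc j) / real n) \<omega>)) \<in> borel_measurable N" for n
  proof -
    have [measurable]: "w (real (Suc j) / real n) \<in> borel_measurable N" for j by (rule meas) simp
    show ?thesis unfolding exp_functional_sum_def by measurable
  qed
qed

lemma brownian_motion_continuous_comp:
  assumes W: "brownian_motion M W" and "\<omega> \<in> space M" "0 \<le> t"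
  shows "continuous_on {0..1} (\<lambda>s. W (t * s) \<omega>)"
proof -
  have "continuous_on {0..} (\<lambda>t. W t \<omega>)" using assms by (simp add: brownian_motion_def)
  then show ?thesis
    by (rule continuous_on_compose2) (use assms in \<open>auto intro!: continuous_intros\<close>)
qed

text \<open>
  Equality in law of \<open>(W (t s))\<close> and \<open>(sqrt t W s)\<close>, for \<open>0 \<le> s \<le> 1\<close>, under the functionals that matter
  here. It holds for Riemann sums on the grid \<open>j / n\<close>, which depend on finitely many increments, and
  passes to the limit. Continuity of \<open>g\<close> is asked only where both functionals are positive, since \<open>g\<close>
  will involve their logarithms.
\<close>
lemma brownian_motion_scaling:
  fixes g :: "real \<times> real \<times> real \<Rightarrow> real"
  assumes W: "brownian_motion M W" and t: "0 < t"
    and g[measurable]: "g \<in> borel_measurable borel" and K: "\<And>x. \<bar>g x\<bar> \<le> K"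
    and cont: "\<And>x y z. 0 < x \<Longrightarrow> 0 < y \<Longrightarrow> isCont g (x, y, z)"
  shows "(\<integral>\<omega>. g (exp_functional k c (\<lambda>s. W (t * s) \<omega>), exp_functional k' c' (\<lambda>s. W (t * s) \<omega>), W t \<omega>) \<partial>M) =
    (\<integral>\<omega>. g (exp_functional k c (\<lambda>s. sqrt t * W s \<omega>), exp_functional k' c' (\<lambda>s. sqrt t * W s \<omega>), sqrt t * W 1 \<omega>) \<partial>M)"
proof -
  interpret prob_space M using W by (simp add: brownian_motion_def)
  have meas: "W r \<in> borel_measurable M" if "0 \<le> r" for r
    using W that by (rule brownian_motion_measurable)
  have W0: "AE \<omega> in M. W 0 \<omega> = 0" using W by (simp add: brownian_motion_def)
  define \<Psi> where "\<Psi> n w = g (exp_functional_sum k c n (\<lambda>j. w (real (Suc j) / real n)),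
      exp_functional_sum k' c' n (\<lambda>j. w (real (Suc j) / real n)), w 1)" for n and w :: "real \<Rightarrow> real"
  have lim: "(\<lambda>n. \<integral>\<omega>. \<Psi> n (\<lambda>s. w s \<omega>) \<partial>M) \<longlonglongrightarrow>
      (\<integral>\<omega>. g (exp_functional k c (\<lambda>s. w s \<omega>), exp_functional k' c' (\<lambda>s. w s \<omega>), w 1 \<omega>) \<partial>M)"
    if wc: "\<And>\<omega>. \<omega> \<in> space M \<Longrightarrow> continuous_on {0..1} (\<lambda>s. w s \<omega>)"
      and wm: "\<And>s. 0 \<le> s \<Longrightarrow> w s \<in> borel_measurable M" for w
  proof (rule integral_dominated_convergence[where w="\<lambda>_. K"])
    have [measurable]: "w (real (Suc j) / real n) \<in> borel_measurable M" "w 1 \<in> borel_measurable M" for j n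
      by (rule wm, simp)+
    have [measurable]: "(\<lambda>\<omega>. exp_functional k c (\<lambda>s. w s \<omega>)) \<in> borel_measurable M" for k c
      by (rule exp_functional_measurable) (use wc wm in auto)
    show "(\<lambda>\<omega>. g (exp_functional k c (\<lambda>s. w s \<omega>), exp_functional k' c' (\<lambda>s. w s \<omega>), w 1 \<omega>)) \<in> borel_measurable M"
      by measurable
    show "(\<lambda>\<omega>. \<Psi> n (\<lambda>s. w s \<omega>)) \<in> borel_measurable M" for n
      unfolding \<Psi>_def exp_functional_sum_def by measurable
    show "AE \<omega> in M. (\<lambda>n. \<Psi> n (\<lambda>s. w s \<omega>)) \<longlonglongrightarrow> g (exp_functional k c (\<lambda>s. w s \<omega>), exp_functional k' c' (\<lambda>s. w s \<omega>), w 1 \<omega>)"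
      unfolding \<Psi>_def using wc
      by (intro AE_I2 isCont_tendsto_compose[OF cont] tendsto_Pair exp_functional_sum_tendsto tendsto_const exp_functional_pos)
    show "AE \<omega> in M. norm (\<Psi> n (\<lambda>s. w s \<omega>)) \<le> K" for n using K by (simp add: \<Psi>_def)
  qed simp
  have eq: "(\<integral>\<omega>. \<Psi> n (\<lambda>s. W (t * s) \<omega>) \<partial>M) = (\<integral>\<omega>. \<Psi> n (\<lambda>s. sqrt t * W s \<omega>) \<partial>M)" if n: "0 < n" for n
  proof -
    define \<Phi> where "\<Phi> x = g (exp_functional_sum k c n (\<lambda>j. \<Sum>i<Suc j. x i), exp_functional_sum k' c' n (\<lambda>j. \<Sum>i<Suc j. x i), \<Sum>i<n. x i)"
      for x :: "nat \<Rightarrow> real"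
    have sm: "(\<lambda>x. \<Sum>i<j. x i) \<in> borel_measurable (PiM {..<n} (\<lambda>_. borel::real measure))" if "j \<le> n" for j
      using that by (intro borel_measurable_sum) auto
    have [measurable]: "(\<lambda>x. exp_functional_sum k c n (\<lambda>j. \<Sum>i<Suc j. x i)) \<in> borel_measurable (PiM {..<n} (\<lambda>_. borel::real measure))" for k c
      unfolding exp_functional_sum_def
      by (intro borel_measurable_divide borel_measurable_sum borel_measurable_exp borel_measurable_times borel_measurable_add sm) auto
    have \<Phi>: "\<Phi> \<in> borel_measurable (PiM {..<n} (\<lambda>_. borel))"
      unfolding \<Phi>_def[abs_def] using sm[of n] by measurable
    have tel: "(\<Sum>i<m. (\<lambda>i\<in>{..<n}. w (real (Suc i) / real n) - w (real i / real n)) i) = w (real m / real n) - w 0"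
      if "m \<le> n" for m and w :: "real \<Rightarrow> real"
    proof -
      have "(\<Sum>i<m. (\<lambda>i\<in>{..<n}. w (real (Suc i) / real n) - w (real i / real n)) i) =
          (\<Sum>i<m. w (real (Suc i) / real n) - w (real i / real n))"
        using that by (intro sum.cong) auto
      then show ?thesis using sum_lessThan_telescope[of "\<lambda>i. w (real i / real n)" m] by simp
    qed
    have \<Phi>\<Psi>: "\<Phi> (\<lambda>i\<in>{..<n}. w (real (Suc i) / real n) - w (real i / real n)) = \<Psi> n w" if "w 0 = 0" for w
    proof -
      have "exp_functional_sum k c n (\<lambda>j. \<Sum>i<Suc j. (\<lambda>i\<in>{..<n}. w (real (Suc i) / real n) - w (real i / real n)) i) =
         exp_functional_sum k c n (\<lambda>j. w (real (Suc j) / real n))" for k c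
        unfolding exp_functional_sum_def using that by (intro arg_cong2[of _ _ _ _ "(/)"] sum.cong refl) (subst tel, auto)
      then show ?thesis using tel[of n w] that n by (simp add: \<Phi>_def \<Psi>_def)
    qed
    let ?D1 = "\<lambda>\<omega>. \<lambda>i\<in>{..<n}. W (t * (real (Suc i) / real n)) \<omega> - W (t * (real i / real n)) \<omega>"
    let ?D2 = "\<lambda>\<omega>. \<lambda>i\<in>{..<n}. sqrt t * W (real (Suc i) / real n) \<omega> - sqrt t * W (real i / real n) \<omega>"
    have D: "?D1 \<in> measurable M (PiM {..<n} (\<lambda>_. borel))" "?D2 \<in> measurable M (PiM {..<n} (\<lambda>_. borel))"
      using t by (intro measurable_restrict borel_measurable_diff borel_measurable_times meas borel_measurable_const; simp)+
    have "(\<integral>\<omega>. \<Psi> n (\<lambda>s. W (t * s) \<omega>) \<partial>M) = (\<integral>\<omega>. \<Phi> (?D1 \<omega>) \<partial>M)"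
    proof (rule integral_cong_AE)
      show "AE \<omega> in M. \<Psi> n (\<lambda>s. W (t * s) \<omega>) = \<Phi> (?D1 \<omega>)"
        using W0 by eventually_elim (subst \<Phi>\<Psi>, auto)
      have [measurable]: "W (t * (real (Suc j) / real n)) \<in> borel_measurable M" "W (t * 1) \<in> borel_measurable M" for j
        by (rule meas, use t in simp)+
      show "(\<lambda>\<omega>. \<Psi> n (\<lambda>s. W (t * s) \<omega>)) \<in> borel_measurable M"
        unfolding \<Psi>_def exp_functional_sum_def by measurable
      show "(\<lambda>\<omega>. \<Phi> (?D1 \<omega>)) \<in> borel_measurable M" using D(1) \<Phi> by (rule measurable_compose)
    qed
    also have "\<dots> = (\<integral>x. \<Phi> x \<partial>distr M (PiM {..<n} (\<lambda>_. borel)) ?D1)"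
      using D(1) \<Phi> by (rule integral_distr[symmetric])
    also have "distr M (PiM {..<n} (\<lambda>_. borel)) ?D1 = distr M (PiM {..<n} (\<lambda>_. borel)) ?D2"
      using brownian_increments_scaling[OF W t n] by (simp add: right_diff_distrib)
    also have "(\<integral>x. \<Phi> x \<partial>distr M (PiM {..<n} (\<lambda>_. borel)) ?D2) = (\<integral>\<omega>. \<Phi> (?D2 \<omega>) \<partial>M)"
      using D(2) \<Phi> by (rule integral_distr)
    also have "\<dots> = (\<integral>\<omega>. \<Psi> n (\<lambda>s. sqrt t * W s \<omega>) \<partial>M)"
    proof (rule integral_cong_AE)
      show "AE \<omega> in M. \<Phi> (?D2 \<omega>) = \<Psi> n (\<lambda>s. sqrt t * W s \<omega>)"
        using W0 by eventually_elim (subst \<Phi>\<Psi>, auto)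
      have [measurable]: "W (real (Suc j) / real n) \<in> borel_measurable M" "W 1 \<in> borel_measurable M" for j
        by (rule meas, use t in simp)+
      show "(\<lambda>\<omega>. \<Psi> n (\<lambda>s. sqrt t * W s \<omega>)) \<in> borel_measurable M"
        unfolding \<Psi>_def exp_functional_sum_def by measurable
      show "(\<lambda>\<omega>. \<Phi> (?D2 \<omega>)) \<in> borel_measurable M" using D(2) \<Phi> by (rule measurable_compose)
    qed
    finally show ?thesis .
  qed
  have l1: "(\<lambda>n. \<integral>\<omega>. \<Psi> n (\<lambda>s. W (t * s) \<omega>) \<partial>M) \<longlonglongrightarrow>
      (\<integral>\<omega>. g (exp_functional k c (\<lambda>s. W (t * s) \<omega>), exp_functional k' c' (\<lambda>s. W (t * s) \<omega>), W (t * 1) \<omega>) \<partial>M)"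
    using t by (intro lim[of "\<lambda>s. W (t * s)"] brownian_motion_continuous_comp[OF W] meas) auto
  have l2: "(\<lambda>n. \<integral>\<omega>. \<Psi> n (\<lambda>s. sqrt t * W s \<omega>) \<partial>M) \<longlonglongrightarrow>
      (\<integral>\<omega>. g (exp_functional k c (\<lambda>s. sqrt t * W s \<omega>), exp_functional k' c' (\<lambda>s. sqrt t * W s \<omega>), sqrt t * W 1 \<omega>) \<partial>M)"
    using brownian_motion_continuous_comp[OF W, of _ 1]
    by (intro lim[of "\<lambda>s \<omega>. sqrt t * W s \<omega>"] borel_measurable_times continuous_intros meas) auto
  have ev: "\<forall>\<^sub>F n in sequentially. (\<integral>\<omega>. \<Psi> n (\<lambda>s. W (t * s) \<omega>) \<partial>M) = (\<integral>\<omega>. \<Psi> n (\<lambda>s. sqrt t * W s \<omega>) \<partial>M)"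
    using eventually_gt_at_top[of 0] by eventually_elim (rule eq)
  show ?thesis
    using LIMSEQ_unique[OF Lim_transform_eventually[OF l1 ev] l2] by simp
qed

section \<open>Perturbation of convergence in law\<close>

text \<open>
  A bounded continuous \<open>f\<close> is uniformly continuous only on compact sets, so tightness is needed: a
  continuous cutoff \<open>\<psi> n\<close> with large expectation under the limit law has large expectation under
  \<open>V0 t\<close> eventually, and outside the cutoff \<open>f\<close> is estimated by its bound.
\<close>
lemma converges_in_law_slutsky:
  fixes V V0 :: "'t \<Rightarrow> 'a \<Rightarrow> 'b::euclidean_space"
  assumes M: "prob_space M" and N: "prob_space N"
    and conv: "converges_in_law M V0 N L F"
    and V: "\<forall>\<^sub>F t in F. V t \<in> borel_measurable M"
    and close: "\<And>d. d > 0 \<Longrightarrow> ((\<lambda>t. measure M {\<omega>\<in>space M. d \<le> dist (V t \<omega>) (V0 t \<omega>)}) \<longlongrightarrow> 0) F"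
  shows "converges_in_law M V N L F"
proof -
  interpret M: prob_space M by fact
  interpret N: prob_space N by fact
  have L[measurable]: "L \<in> borel_measurable N" and V0: "\<forall>\<^sub>F t in F. V0 t \<in> borel_measurable M"
    and conv': "\<And>f::'b \<Rightarrow> real. continuous_on UNIV f \<Longrightarrow> bounded (range f) \<Longrightarrow>
        ((\<lambda>t. \<integral>\<omega>. f (V0 t \<omega>) \<partial>M) \<longlongrightarrow> (\<integral>\<omega>. f (L \<omega>) \<partial>N)) F"
    using conv unfolding converges_in_law_def by auto
  have "((\<lambda>t. \<integral>\<omega>. f (V t \<omega>) \<partial>M) \<longlongrightarrow> (\<integral>\<omega>. f (L \<omega>) \<partial>N)) F"
    if f: "continuous_on UNIV f" and bnd: "bounded (range f)" for f :: "'b \<Rightarrow> real"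
  proof -
    obtain K where K: "K > 0" "\<And>x. \<bar>f x\<bar> \<le> K" using bnd unfolding bounded_pos by auto
    have fm[measurable]: "f \<in> borel_measurable borel" using f by (rule borel_measurable_continuous_onI)
    have "((\<lambda>t. (\<integral>\<omega>. f (V t \<omega>) \<partial>M) - (\<integral>\<omega>. f (V0 t \<omega>) \<partial>M)) \<longlongrightarrow> 0) F"
    proof (rule tendstoI)
      fix e0 :: real assume e0: "0 < e0"
      define e where "e = e0 / 2 / (1 + 4 * K)"
      have e: "0 < e" and ee: "e + 4 * K * e < e0"
      proof -
        have "0 < 1 + 4 * K" using K by simp
        then show "0 < e" using e0 by (simp add: e_def)
        have "e + 4 * K * e = (1 + 4 * K) * e" by (simp add: algebra_simps)
        also have "\<dots> = e0 / 2" using \<open>0 < 1 + 4 * K\<close> unfolding e_def by (intro nonzero_mult_div_cancel_left[THEN trans[OF times_divide_eq_right]]) simp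
        finally show "e + 4 * K * e < e0" using e0 by simp
      qed
      define \<psi> where "\<psi> n x = max 0 (min 1 (real n + 1 - norm x))" for n and x :: 'b
      have \<psi>c: "continuous_on UNIV (\<psi> n)" for n unfolding \<psi>_def by (intro continuous_intros)
      have \<psi>m[measurable]: "\<psi> n \<in> borel_measurable borel" for n using \<psi>c by (rule borel_measurable_continuous_onI)
      have \<psi>b: "0 \<le> \<psi> n x" "\<psi> n x \<le> 1" for n x by (auto simp: \<psi>_def)
      have "(\<lambda>n. \<integral>\<omega>. \<psi> n (L \<omega>) \<partial>N) \<longlonglongrightarrow> (\<integral>\<omega>. 1 \<partial>N)"
      proof (rule integral_dominated_convergence[where w="\<lambda>_. 1"])
        show "AE \<omega> in N. (\<lambda>n. \<psi> n (L \<omega>)) \<longlonglongrightarrow> 1"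
        proof (intro AE_I2 tendsto_eventually)
          fix \<omega>
          obtain n0 :: nat where "norm (L \<omega>) \<le> real n0" using real_arch_simple by blast
          then have "\<psi> n (L \<omega>) = 1" if "n0 \<le> n" for n using that by (simp add: \<psi>_def min_def)
          then show "\<forall>\<^sub>F n in sequentially. \<psi> n (L \<omega>) = 1"
            unfolding eventually_sequentially by blast
        qed
        show "AE \<omega> in N. norm (\<psi> n (L \<omega>)) \<le> 1" for n using \<psi>b by auto
      qed auto
      then have "\<forall>\<^sub>F n in sequentially. 1 - e < (\<integral>\<omega>. \<psi> n (L \<omega>) \<partial>N)"
        using e by (intro order_tendstoD) (auto simp: N.prob_space)
      then obtain n where n: "1 - e < (\<integral>\<omega>. \<psi> n (L \<omega>) \<partial>N)"
        using eventually_happens'[OF sequentially_bot] by blast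
      have "bounded (range (\<psi> n))" using \<psi>b by (intro boundedI[of _ 1]) auto
      from order_tendstoD(1)[OF conv'[OF \<psi>c this] n]
      have ev1: "\<forall>\<^sub>F t in F. 1 - e < (\<integral>\<omega>. \<psi> n (V0 t \<omega>) \<partial>M)" .
      have "uniformly_continuous_on (cball 0 (real n + 2)) f"
        using f by (intro compact_uniformly_continuous continuous_on_subset[OF f]) auto
      then obtain d0 where d0: "d0 > 0" "\<And>x y. x \<in> cball 0 (real n + 2) \<Longrightarrow> y \<in> cball 0 (real n + 2) \<Longrightarrow> dist y x < d0 \<Longrightarrow> dist (f y) (f x) < e"
        using e unfolding uniformly_continuous_on_def by metis
      define d where "d = min d0 1"
      have d: "0 < d" "d \<le> 1" "d \<le> d0" using d0 by (auto simp: d_def)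
      have ev2: "\<forall>\<^sub>F t in F. measure M {\<omega>\<in>space M. d \<le> dist (V t \<omega>) (V0 t \<omega>)} < e"
        using order_tendstoD(2)[OF close[OF d(1)] e] .
      show "\<forall>\<^sub>F t in F. dist ((\<integral>\<omega>. f (V t \<omega>) \<partial>M) - (\<integral>\<omega>. f (V0 t \<omega>) \<partial>M)) 0 < e0"
        using ev1 ev2 V V0
      proof eventually_elim
        case (elim t)
        note [measurable] = elim(3,4)
        let ?E = "{\<omega>\<in>space M. d \<le> dist (V t \<omega>) (V0 t \<omega>)}"
        have E[measurable]: "?E \<in> sets M" by measurable
        have pw: "\<bar>f (V t \<omega>) - f (V0 t \<omega>)\<bar> \<le> e + 2 * K * (1 - \<psi> n (V0 t \<omega>)) + 2 * K * indicator ?E \<omega>" if "\<omega> \<in> space M" for \<omega>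
        proof -
          have le2K: "\<bar>f (V t \<omega>) - f (V0 t \<omega>)\<bar> \<le> 2 * K" using K(2)[of "V t \<omega>"] K(2)[of "V0 t \<omega>"] by linarith
          have nn: "0 \<le> 2 * K * (1 - \<psi> n (V0 t \<omega>))" using K(1) \<psi>b(2)[of n "V0 t \<omega>"] by simp
          consider "\<omega> \<in> ?E" | "\<omega> \<notin> ?E" "norm (V0 t \<omega>) > real n + 1" | "\<omega> \<notin> ?E" "norm (V0 t \<omega>) \<le> real n + 1" by fastforce
          then show ?thesis
          proof cases
            case 1 then show ?thesis using le2K nn e by simp
          next
            case 2
            then have "\<psi> n (V0 t \<omega>) = 0" by (simp add: \<psi>_def)
            then show ?thesis using 2(1) le2K e by simp
          next
            case 3
            then have ds: "dist (V t \<omega>) (V0 t \<omega>) < d" using that by simp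
            have "norm (V t \<omega>) \<le> norm (V0 t \<omega>) + dist (V t \<omega>) (V0 t \<omega>)"
              using norm_triangle_ineq[of "V0 t \<omega>" "V t \<omega> - V0 t \<omega>"] by (simp add: dist_norm)
            then have "V t \<omega> \<in> cball 0 (real n + 2)" using 3(2) ds d(2) by simp
            moreover have "V0 t \<omega> \<in> cball 0 (real n + 2)" using 3(2) by simp
            ultimately have "dist (f (V t \<omega>)) (f (V0 t \<omega>)) < e" using d0(2) ds d(3) by simp
            moreover have "0 \<le> 2 * K * indicator ?E \<omega>" using K(1) by simp
            ultimately show ?thesis using nn by (simp only: dist_real_def)
          qed
        qed
        have i1: "integrable M (\<lambda>\<omega>. f (V t \<omega>))" "integrable M (\<lambda>\<omega>. f (V0 t \<omega>))"
          using K by (auto intro!: M.integrable_const_bound[of _ K])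
        have i2: "integrable M (\<lambda>\<omega>. \<psi> n (V0 t \<omega>))"
          using \<psi>b by (auto intro!: M.integrable_const_bound[of _ 1])
        have i3: "integrable M (indicator ?E :: 'a \<Rightarrow> real)" by (rule integrable_real_indicator) (auto simp: M.emeasure_eq_measure)
        have "\<bar>(\<integral>\<omega>. f (V t \<omega>) \<partial>M) - (\<integral>\<omega>. f (V0 t \<omega>) \<partial>M)\<bar> = \<bar>\<integral>\<omega>. f (V t \<omega>) - f (V0 t \<omega>) \<partial>M\<bar>"
          using i1 by simp
        also have "\<dots> \<le> (\<integral>\<omega>. \<bar>f (V t \<omega>) - f (V0 t \<omega>)\<bar> \<partial>M)" by (rule integral_abs_bound)
        also have "\<dots> \<le> (\<integral>\<omega>. e + 2 * K * (1 - \<psi> n (V0 t \<omega>)) + 2 * K * indicator ?E \<omega> \<partial>M)"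
          using i1 i2 i3 pw by (intro integral_mono integrable_abs Bochner_Integration.integrable_diff Bochner_Integration.integrable_add integrable_mult_right) auto
        also have "\<dots> = e + 2 * K * (1 - (\<integral>\<omega>. \<psi> n (V0 t \<omega>) \<partial>M)) + 2 * K * measure M ?E"
          using i2 i3 by (simp add: M.prob_space)
        also have "\<dots> \<le> e + 2 * K * e + 2 * K * e"
          using elim(1,2) K(1) by (intro add_mono mult_left_mono) auto
        also have "\<dots> < e0" using ee by (simp add: algebra_simps)
        finally show ?case by (simp add: dist_real_def)
      qed
    qed
    from tendsto_add[OF this conv'[OF f bnd]] show ?thesis by simp
  qed
  then show ?thesis using L V unfolding converges_in_law_def by auto
qed

text \<open>
  The law of \<open>\<xi> t\<close> is fixed while the threshold \<open>d sqrt t\<close> grows. The event \<open>\<xi> t = 0\<close> is included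
  because \<open>ln 0 = 0\<close>, so that logarithms of products do not split there.
\<close>
lemma std_normal_log_negligible:
  assumes "prob_space M" and \<xi>[measurable]: "\<And>t. 0 < t \<Longrightarrow> \<xi> t \<in> borel_measurable M"
    and normal: "\<And>t. 0 < t \<Longrightarrow> distr M borel (\<xi> t) = std_normal_distribution" and d: "0 < d"
  shows "((\<lambda>t. measure M {\<omega>\<in>space M. \<xi> t \<omega> = 0 \<or> d * sqrt t \<le> \<bar>ln \<bar>\<xi> t \<omega>\<bar>\<bar>}) \<longlongrightarrow> 0) at_top"
proof -
  interpret S: prob_space std_normal_distribution by (rule prob_space_normal_density) simp
  define E where "E t = {x::real. x = 0 \<or> d * sqrt t \<le> \<bar>ln \<bar>x\<bar>\<bar>}" for t
  have [measurable]: "E t \<in> sets borel" for t unfolding E_def by measurable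
  have ne0: "AE x in std_normal_distribution. x \<noteq> 0"
    by (subst AE_density) (auto simp: AE_lborel_singleton intro: eventually_mono[OF AE_lborel_singleton])
  have "((\<lambda>t. \<integral>x. (indicator (E t) x :: real) \<partial>std_normal_distribution) \<longlongrightarrow> (\<integral>x. (0::real) \<partial>std_normal_distribution)) at_top"
  proof (rule integral_dominated_convergence_at_top[where w="\<lambda>_. 1::real" and s="\<lambda>t x. indicator (E t) x" and f="\<lambda>_. 0" and M=std_normal_distribution])
    show "\<forall>\<^sub>F t in at_top. AE x in std_normal_distribution. norm (indicator (E t) x :: real) \<le> 1"
      by (auto simp: indicator_def)
    show "AE x in std_normal_distribution. ((\<lambda>t. indicator (E t) x) \<longlongrightarrow> (0::real)) at_top"
      using ne0
    proof eventually_elim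
      case (elim x)
      have "filterlim (\<lambda>t. d * sqrt t) at_top at_top" using d by real_asymp
      then have "\<forall>\<^sub>F t in at_top. \<bar>ln \<bar>x\<bar>\<bar> < d * sqrt t" by (simp add: filterlim_at_top_dense)
      then show ?case using elim by (intro tendsto_eventually) (auto elim!: eventually_mono simp: E_def indicator_def)
    qed
  qed auto
  then have "((\<lambda>t. measure std_normal_distribution (E t)) \<longlongrightarrow> 0) at_top" by simp
  moreover have "\<forall>\<^sub>F t in at_top. measure std_normal_distribution (E t) = measure M {\<omega>\<in>space M. \<xi> t \<omega> = 0 \<or> d * sqrt t \<le> \<bar>ln \<bar>\<xi> t \<omega>\<bar>\<bar>}"
    using eventually_gt_at_top[of 0]
  proof eventually_elim
    case (elim t)
    show ?case unfolding normal[OF elim, symmetric]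
      using \<xi>[OF elim] by (subst measure_distr) (auto intro!: arg_cong[where f="measure M"] simp: E_def)
  qed
  ultimately show ?thesis by (rule Lim_transform_eventually)
qed

lemma nn_integral_exp_square:
  assumes t: "0 < t" and w: "continuous_on {0..t} w"
  shows "(\<integral>\<^sup>+s\<in>{0..t}. ennreal ((exp (k * (a * s + w s)))\<^sup>2) \<partial>lborel) =
    ennreal (t * exp_functional k (a * t) (\<lambda>s. w (t * s)))"
proof -
  let ?f = "\<lambda>s. exp (2 * k * (a * s + w s))"
  have c: "continuous_on {0..t} ?f" by (intro continuous_intros w)
  have si: "set_integrable lborel {0..t} ?f" using c by (rule borel_integrable_atLeastAtMost')
  have "(\<integral>\<^sup>+s\<in>{0..t}. ennreal ((exp (k * (a * s + w s)))\<^sup>2) \<partial>lborel) =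
      (\<integral>\<^sup>+s. ennreal (indicator {0..t} s *\<^sub>R ?f s) \<partial>lborel)"
    by (intro nn_integral_cong) (auto simp: indicator_def mult.assoc simp flip: exp_double)
  also have "\<dots> = ennreal (LINT s:{0..t}|lborel. ?f s)"
    unfolding set_lebesgue_integral_def
    using si unfolding set_integrable_def by (intro nn_integral_eq_integral) auto
  also have "(LINT s:{0..t}|lborel. ?f s) = integral {0..t} ?f"
    using si by (rule set_borel_integral_eq_integral)
  also have "\<dots> = t * exp_functional k (a * t) (\<lambda>s. w (t * s))"
    unfolding exp_functional_def integral_scale_01[OF t c] by (simp add: mult.assoc)
  finally show ?thesis .
qed

section \<open>Reduction of the stochastic integrals to their conditional variances\<close>

lemma insider_gaussian_increments:
  assumes ind: "indep_processes M P I" and I: "finite I" "k \<in> I" and B: "\<And>i. i \<in> I \<Longrightarrow> brownian_motion M (P i)"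
  shows "gaussian_increments M (insider_filtration M P I k) (P k)"
proof -
  interpret prob_space M using B[OF I(2)] by (simp add: brownian_motion_def)
  have meas: "P i r \<in> borel_measurable M" if "i \<in> I" "0 \<le> r" for i r
    using B[OF that(1)] that(2) by (rule brownian_motion_measurable)
  show ?thesis
  proof
    fix s t :: real
    show "space (insider_filtration M P I k s) = space M" by simp
    show "sets (insider_filtration M P I k s) \<subseteq> sets M"
      by (rule insider_filtration_subset_events) (rule meas)
    show "s \<le> t \<Longrightarrow> sets (insider_filtration M P I k s) \<subseteq> sets (insider_filtration M P I k t)"
      by (rule insider_filtration_mono)
    show "0 \<le> s \<Longrightarrow> P k s \<in> borel_measurable (insider_filtration M P I k s)"
      using I(2) by (intro insider_filtration_measurable) (simp add: insider_index_def)
    show "0 \<le> s \<Longrightarrow> s < t \<Longrightarrow> distr M (insider_filtration M P I k s \<Otimes>\<^sub>M borel) (\<lambda>\<omega>. (\<omega>, P k t \<omega> - P k s \<omega>)) =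
      distr M (insider_filtration M P I k s) (\<lambda>\<omega>. \<omega>) \<Otimes>\<^sub>M distr M borel (\<lambda>\<omega>. P k t \<omega> - P k s \<omega>)"
      by (rule insider_filtration_indep_increment[OF ind I B[OF I(2)] _ _ meas])
    show "0 \<le> s \<Longrightarrow> s < t \<Longrightarrow> distributed M lborel (\<lambda>\<omega>. P k t \<omega> - P k s \<omega>) (normal_density 0 (sqrt (t - s)))"
      using B[OF I(2)] unfolding brownian_motion_def by blast
  qed
qed

text \<open>
  The filtration for which the integrands are adapted is contained in the enlarged one, so every
  approximating simple process is also adapted to the latter.
\<close>
lemma natural_filtration_subset_insider:
  assumes "k < 3"
  shows "sets (natural_filtration M (\<lambda>s \<omega>. (W s \<omega>, W1 s \<omega>, W2 s \<omega>)) t) \<subseteq>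
    sets (insider_filtration M (\<lambda>i. [W, W1, W2] ! i) {..<3::nat} k t)"
proof -
  let ?G = "insider_filtration M (\<lambda>i. [W, W1, W2] ! i) {..<3::nat} k t"
  have "(\<lambda>\<omega>. (W s \<omega>, W1 s \<omega>, W2 s \<omega>)) -` A \<inter> space M \<in> sets ?G"
    if "0 \<le> s" "s \<le> t" "A \<in> sets borel" for s A
  proof -
    have "([W, W1, W2] ! i) s \<in> borel_measurable ?G" if "i < 3" for i
      using that \<open>0 \<le> s\<close> \<open>s \<le> t\<close> by (intro insider_filtration_measurable) (simp add: insider_index_def)
    from this[of 0] this[of 1] this[of 2]
    have "W s \<in> borel_measurable ?G" "W1 s \<in> borel_measurable ?G" "W2 s \<in> borel_measurable ?G" by simp_all
    then have "(\<lambda>\<omega>. (W s \<omega>, W1 s \<omega>, W2 s \<omega>)) \<in> borel_measurable ?G" by simp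
    from measurable_sets[OF this that(3)] show ?thesis by simp
  qed
  then have sub: "{(\<lambda>\<omega>. (W s \<omega>, W1 s \<omega>, W2 s \<omega>)) -` A \<inter> space M | s A. 0 \<le> s \<and> s \<le> t \<and> A \<in> sets borel} \<subseteq> sets ?G"
    by blast
  have "sigma_sets (space ?G) {(\<lambda>\<omega>. (W s \<omega>, W1 s \<omega>, W2 s \<omega>)) -` A \<inter> space M | s A. 0 \<le> s \<and> s \<le> t \<and> A \<in> sets borel} \<subseteq> sets ?G"
    using sub by (rule sets.sigma_sets_subset)
  moreover have "{(\<lambda>\<omega>. (W s \<omega>, W1 s \<omega>, W2 s \<omega>)) -` A \<inter> space M | s A. 0 \<le> s \<and> s \<le> t \<and> A \<in> sets borel} \<subseteq> Pow (space M)"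
    by blast
  ultimately show ?thesis unfolding natural_filtration_def by (simp add: sets_measure_of)
qed

text \<open>
  For \<open>k \<noteq> 0\<close> the insider who watches the \<open>k\<close>-th process knows the whole path of \<open>W\<close>, and with it the
  variance, at time \<open>0\<close>.
\<close>
lemma ito_integral_exp_self_normalized:
  assumes W: "brownian_motion M W" and W1: "brownian_motion M W1" and W2: "brownian_motion M W2"
    and indep: "indep_processes M (\<lambda>i. [W, W1, W2] ! i) {..<3}"
    and F: "F = natural_filtration M (\<lambda>s \<omega>. (W s \<omega>, W1 s \<omega>, W2 s \<omega>))"
    and Z: "\<And>t \<omega>. t \<ge> 0 \<Longrightarrow> Z t \<omega> = a * t + W t \<omega>"
    and k: "k = 1 \<or> k = 2"
    and J: "has_ito_integral M F ([W, W1, W2] ! k) (\<lambda>s \<omega>. exp (\<kappa> * Z s \<omega>)) t J"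
    and t: "0 < t"
  shows "distr M borel (\<lambda>\<omega>. J \<omega> / sqrt (t * exp_functional \<kappa> (a * t) (\<lambda>s. W (t * s) \<omega>))) = std_normal_distribution"
proof -
  let ?P = "\<lambda>i. [W, W1, W2] ! i"
  let ?G = "insider_filtration M ?P {..<3::nat} k"
  have BM: "brownian_motion M (?P i)" if "i \<in> {..<3}" for i
    using that W W1 W2 by (auto simp: less_Suc_eq numeral_3_eq_3)
  interpret gaussian_increments M ?G "?P k"
    by (rule insider_gaussian_increments[OF indep _ _ BM]) (use k in auto)
  have cont: "continuous_on {0..t} (\<lambda>s. W s \<omega>)" if "\<omega> \<in> space M" for \<omega>
    using W that by (auto simp: brownian_motion_def intro: continuous_on_subset)
  have "(\<lambda>\<omega>. exp_functional \<kappa> (a * t) (\<lambda>s. W (t * s) \<omega>)) \<in> borel_measurable (?G 0)"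
  proof (rule exp_functional_measurable)
    show "continuous_on {0..1} (\<lambda>s. W (t * s) \<omega>)" if "\<omega> \<in> space (?G 0)" for \<omega>
      using that t by (intro brownian_motion_continuous_comp[OF W]) auto
    show "W (t * s) \<in> borel_measurable (?G 0)" if "0 \<le> s" for s
      using insider_filtration_measurable[of 0 "t * s" "{..<3}" k 0 ?P M] that t k by (auto simp: insider_index_def)
  qed
  then have A: "(\<lambda>\<omega>. t * exp_functional \<kappa> (a * t) (\<lambda>s. W (t * s) \<omega>)) \<in> borel_measurable (?G 0)" by simp
  show ?thesis
  proof (rule ito_integral_self_normalized[OF J _ _ A])
    show "space (F s) = space M" for s by (simp add: F natural_filtration_def space_measure_of_conv)
    show "sets (F s) \<subseteq> sets (?G s)" for s unfolding F using k by (intro natural_filtration_subset_insider) auto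
    fix \<omega> assume \<omega>: "\<omega> \<in> space M"
    show "0 < t * exp_functional \<kappa> (a * t) (\<lambda>s. W (t * s) \<omega>)"
      using t \<omega> by (intro mult_pos_pos exp_functional_pos brownian_motion_continuous_comp[OF W]) auto
    show "(\<integral>\<^sup>+s\<in>{0..t}. ennreal ((exp (\<kappa> * Z s \<omega>))\<^sup>2) \<partial>lborel) = ennreal (t * exp_functional \<kappa> (a * t) (\<lambda>s. W (t * s) \<omega>))"
      unfolding nn_integral_exp_square[OF t cont[OF \<omega>], symmetric]
      by (intro nn_integral_cong) (auto simp: Z indicator_def)
    have "continuous_on {0..t} (\<lambda>s. exp (\<kappa> * (a * s + W s \<omega>)))" by (intro continuous_intros cont \<omega>)
    then show "continuous_on {0..t} (\<lambda>s. exp (\<kappa> * Z s \<omega>))"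
      by (rule continuous_on_eq) (simp add: Z)
  qed
qed

text \<open>
  Both logarithms carry the same shift \<open>s\<close>, so their difference is \<open>ln \<bar>x / sqrt A\<bar>\<close> alone.
\<close>
lemma abs_log_ratio_le:
  fixes x A d s :: real
  assumes "0 < A" "0 < r" "x / sqrt A \<noteq> 0" "\<bar>ln \<bar>x / sqrt A\<bar>\<bar> < d * r"
  shows "\<bar>(ln \<bar>x\<bar> - s) / r - (ln A / 2 - s) / r\<bar> < d"
proof -
  have x: "x \<noteq> 0" using assms by auto
  have "ln \<bar>x / sqrt A\<bar> = ln \<bar>x\<bar> - ln A / 2"
    using x assms(1) by (simp add: abs_divide ln_div ln_sqrt)
  moreover have "(ln \<bar>x\<bar> - s) / r - (ln A / 2 - s) / r = (ln \<bar>x\<bar> - ln A / 2) / r"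
    by (simp add: diff_divide_distrib)
  ultimately show ?thesis using assms by (simp add: abs_divide pos_divide_less_eq)
qed

text \<open>
  The common part of all drift regimes. The shifts \<open>sx\<close>, \<open>sy\<close> and the limits \<open>lx\<close>, \<open>ly\<close> enter only
  through the pathwise asymptotics of the exponential functionals of the scaled path
  \<open>sqrt t W\<close>. In the proof \<open>V0\<close> replaces the logarithms of the integrals by half the logarithms of
  their variances, and \<open>V1\<close> is \<open>V0\<close> with the path \<open>W (t s)\<close> replaced by \<open>sqrt t W s\<close>.
\<close>
lemma log_ito_integrals_converge_in_law:
  fixes sx sy :: "real \<Rightarrow> real"
  assumes W: "brownian_motion M W" and W1: "brownian_motion M W1" and W2: "brownian_motion M W2"
    and indep: "indep_processes M (\<lambda>i. [W, W1, W2] ! i) {..<3}"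
    and F: "F = natural_filtration M (\<lambda>s \<omega>. (W s \<omega>, W1 s \<omega>, W2 s \<omega>))"
    and Z: "\<And>t \<omega>. t \<ge> 0 \<Longrightarrow> Z t \<omega> = a * t + W t \<omega>"
    and X: "\<And>t. t \<ge> 0 \<Longrightarrow> has_ito_integral M F W1 (\<lambda>s \<omega>. exp (k * Z s \<omega>)) t (X t)"
    and Y: "\<And>t. t \<ge> 0 \<Longrightarrow> has_ito_integral M F W2 (\<lambda>s \<omega>. exp (k' * Z s \<omega>)) t (Y t)"
    and lx[measurable]: "lx \<in> borel_measurable M" and ly[measurable]: "ly \<in> borel_measurable M"
    and limx: "AE \<omega> in M. ((\<lambda>t. (ln (t * exp_functional k (a * t) (\<lambda>s. sqrt t * W s \<omega>)) / 2 - sx t) / sqrt t) \<longlongrightarrow> lx \<omega>) at_top"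
    and limy: "AE \<omega> in M. ((\<lambda>t. (ln (t * exp_functional k' (a * t) (\<lambda>s. sqrt t * W s \<omega>)) / 2 - sy t) / sqrt t) \<longlongrightarrow> ly \<omega>) at_top"
  shows "converges_in_law M
      (\<lambda>t \<omega>. (1 / sqrt t) *\<^sub>R (ln \<bar>X t \<omega>\<bar> - sx t, ln \<bar>Y t \<omega>\<bar> - sy t, Z t \<omega> - a * t))
      M (\<lambda>\<omega>. (lx \<omega>, ly \<omega>, W 1 \<omega>)) at_top"
proof -
  interpret prob_space M using W by (simp add: brownian_motion_def)
  have meas: "W r \<in> borel_measurable M" if "0 \<le> r" for r
    using W that by (rule brownian_motion_measurable)
  have [measurable]: "W 1 \<in> borel_measurable M" by (rule meas) simp
  have Xm: "X t \<in> borel_measurable M" "Y t \<in> borel_measurable M" if "0 \<le> t" for t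
    using X[OF that] Y[OF that] by (auto simp: has_ito_integral_def)
  define A where "A \<kappa> t \<omega> = t * exp_functional \<kappa> (a * t) (\<lambda>s. W (t * s) \<omega>)" for \<kappa> t \<omega>
  have Am: "A \<kappa> t \<in> borel_measurable M" if "0 < t" for \<kappa> t
  proof -
    have "(\<lambda>\<omega>. exp_functional \<kappa> (a * t) (\<lambda>s. W (t * s) \<omega>)) \<in> borel_measurable M"
      using that by (intro exp_functional_measurable brownian_motion_continuous_comp[OF W] meas) auto
    then show ?thesis unfolding A_def[abs_def] by simp
  qed
  have A_pos: "0 < A \<kappa> t \<omega>" if "0 < t" "\<omega> \<in> space M" for \<kappa> t \<omega>
    unfolding A_def using that by (intro mult_pos_pos exp_functional_pos brownian_motion_continuous_comp[OF W]) auto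
  define G where "G t = (\<lambda>(x, y, z). ((ln (t * x) / 2 - sx t) / sqrt t, (ln (t * y) / 2 - sy t) / sqrt t, z / sqrt t))" for t :: real
  define V0 where "V0 t \<omega> = G t (exp_functional k (a * t) (\<lambda>s. W (t * s) \<omega>), exp_functional k' (a * t) (\<lambda>s. W (t * s) \<omega>), W t \<omega>)" for t \<omega>
  define V where "V t \<omega> = (1 / sqrt t) *\<^sub>R (ln \<bar>X t \<omega>\<bar> - sx t, ln \<bar>Y t \<omega>\<bar> - sy t, Z t \<omega> - a * t)" for t \<omega>
  have V0_eq: "V0 t \<omega> = ((ln (A k t \<omega>) / 2 - sx t) / sqrt t, (ln (A k' t \<omega>) / 2 - sy t) / sqrt t, W t \<omega> / sqrt t)" for t \<omega>
    by (simp add: V0_def G_def A_def)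
  have V_eq: "V t \<omega> = ((ln \<bar>X t \<omega>\<bar> - sx t) / sqrt t, (ln \<bar>Y t \<omega>\<bar> - sy t) / sqrt t, W t \<omega> / sqrt t)" if "0 \<le> t" for t \<omega>
    using Z[OF that, of \<omega>] by (simp add: V_def divide_inverse mult.commute)
  have V0m: "V0 t \<in> borel_measurable M" if "0 < t" for t
  proof -
    have [measurable]: "A k t \<in> borel_measurable M" "A k' t \<in> borel_measurable M" "W t \<in> borel_measurable M"
      using that by (auto intro: Am meas)
    show ?thesis unfolding V0_eq[abs_def] by measurable
  qed
  have Vm: "V t \<in> borel_measurable M" if "0 < t" for t
  proof -
    have [measurable]: "X t \<in> borel_measurable M" "Y t \<in> borel_measurable M" "W t \<in> borel_measurable M"
      using that by (auto intro: Xm meas)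
    have "(\<lambda>\<omega>. ((ln \<bar>X t \<omega>\<bar> - sx t) / sqrt t, (ln \<bar>Y t \<omega>\<bar> - sy t) / sqrt t, W t \<omega> / sqrt t)) \<in> borel_measurable M"
      by measurable
    then show ?thesis using V_eq[of t] that by (simp add: fun_eq_iff[symmetric] cong: measurable_cong)
  qed
  have conv0: "converges_in_law M V0 M (\<lambda>\<omega>. (lx \<omega>, ly \<omega>, W 1 \<omega>)) at_top"
    unfolding converges_in_law_def
  proof (intro conjI allI impI)
    show "\<forall>\<^sub>F t in at_top. V0 t \<in> borel_measurable M"
      using eventually_gt_at_top[of 0] by eventually_elim (rule V0m)
    show "(\<lambda>\<omega>. (lx \<omega>, ly \<omega>, W 1 \<omega>)) \<in> borel_measurable M" by measurable
    fix f :: "real \<times> real \<times> real \<Rightarrow> real" assume f: "continuous_on UNIV f \<and> bounded (range f)"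
    then obtain K where K: "\<And>x. \<bar>f x\<bar> \<le> K" unfolding bounded_iff by auto
    have fm[measurable]: "f \<in> borel_measurable borel" using f by (intro borel_measurable_continuous_onI) auto
    have fc: "isCont f x" for x
      using conjunct1[OF f] unfolding continuous_on_eq_continuous_at[OF open_UNIV] by blast
    define V1 where "V1 t \<omega> = G t (exp_functional k (a * t) (\<lambda>s. sqrt t * W s \<omega>), exp_functional k' (a * t) (\<lambda>s. sqrt t * W s \<omega>), sqrt t * W 1 \<omega>)" for t \<omega>
    have eq: "(\<integral>\<omega>. f (V0 t \<omega>) \<partial>M) = (\<integral>\<omega>. f (V1 t \<omega>) \<partial>M)" if t: "0 < t" for t
      unfolding V0_def V1_def
    proof (rule brownian_motion_scaling[OF W t, of "\<lambda>x. f (G t x)"])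
      have "(\<lambda>x. f (G t x)) \<in> borel_measurable (borel \<Otimes>\<^sub>M (borel \<Otimes>\<^sub>M borel))"
        unfolding G_def split_beta by measurable
      then show "(\<lambda>x. f (G t x)) \<in> borel_measurable borel" by (simp only: borel_prod)
      show "\<bar>f (G t x)\<bar> \<le> K" for x by (rule K)
      show "isCont (\<lambda>x. f (G t x)) (x, y, z)" if "0 < x" "0 < y" for x y z
      proof -
        have "isCont (G t) (x, y, z)"
          unfolding G_def split_beta using that t by (intro continuous_intros) auto
        then show ?thesis using fc by (rule isCont_o2)
      qed
    qed
    have V1m: "V1 t \<in> borel_measurable M" for t
    proof -
      have c: "continuous_on {0..1} (\<lambda>s. sqrt t * W s \<omega>)" if "\<omega> \<in> space M" for \<omega>
        using brownian_motion_continuous_comp[OF W that, of 1] by (intro continuous_intros) simp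
      have [measurable]: "(\<lambda>\<omega>. exp_functional \<kappa> (a * t) (\<lambda>s. sqrt t * W s \<omega>)) \<in> borel_measurable M" for \<kappa>
        by (intro exp_functional_measurable c borel_measurable_times meas) auto
      show ?thesis unfolding V1_def[abs_def] G_def split_beta fst_conv snd_conv by measurable
    qed
    have "((\<lambda>t. \<integral>\<omega>. f (V1 t \<omega>) \<partial>M) \<longlongrightarrow> (\<integral>\<omega>. f (lx \<omega>, ly \<omega>, W 1 \<omega>) \<partial>M)) at_top"
    proof (rule integral_dominated_convergence_at_top[where w="\<lambda>_. K" and s="\<lambda>t \<omega>. f (V1 t \<omega>)"])
      show "AE \<omega> in M. ((\<lambda>t. f (V1 t \<omega>)) \<longlongrightarrow> f (lx \<omega>, ly \<omega>, W 1 \<omega>)) at_top"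
        using limx limy
      proof eventually_elim
        case (elim \<omega>)
        have "((\<lambda>t. sqrt t * W 1 \<omega> / sqrt t) \<longlongrightarrow> W 1 \<omega>) at_top"
          by (rule tendsto_eventually) (use eventually_gt_at_top[of 0] in eventually_elim, simp)
        with elim have "((\<lambda>t. V1 t \<omega>) \<longlongrightarrow> (lx \<omega>, ly \<omega>, W 1 \<omega>)) at_top"
          unfolding V1_def G_def prod.case by (intro tendsto_Pair)
        then show ?case by (rule isCont_tendsto_compose[OF fc])
      qed
      show "\<forall>\<^sub>F t in at_top. AE \<omega> in M. norm (f (V1 t \<omega>)) \<le> K" using K by auto
      show "(\<lambda>\<omega>. f (lx \<omega>, ly \<omega>, W 1 \<omega>)) \<in> borel_measurable M" by measurable
      show "(\<lambda>\<omega>. f (V1 t \<omega>)) \<in> borel_measurable M" for t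
        by (rule measurable_compose[OF V1m fm])
    qed simp
    then show "((\<lambda>t. \<integral>\<omega>. f (V0 t \<omega>) \<partial>M) \<longlongrightarrow> (\<integral>\<omega>. f (lx \<omega>, ly \<omega>, W 1 \<omega>) \<partial>M)) at_top"
      by (rule Lim_transform_eventually) (use eventually_gt_at_top[of 0] in eventually_elim, simp add: eq)
  qed
  have "converges_in_law M V M (\<lambda>\<omega>. (lx \<omega>, ly \<omega>, W 1 \<omega>)) at_top"
  proof (rule converges_in_law_slutsky[OF prob_space_axioms prob_space_axioms conv0])
    show "\<forall>\<^sub>F t in at_top. V t \<in> borel_measurable M"
      using eventually_gt_at_top[of 0] by eventually_elim (rule Vm)
    fix d :: real assume d: "0 < d"
    define Ex where "Ex t = {\<omega>\<in>space M. X t \<omega> / sqrt (A k t \<omega>) = 0 \<or> d / 2 * sqrt t \<le> \<bar>ln \<bar>X t \<omega> / sqrt (A k t \<omega>)\<bar>\<bar>}" for t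
    define Ey where "Ey t = {\<omega>\<in>space M. Y t \<omega> / sqrt (A k' t \<omega>) = 0 \<or> d / 2 * sqrt t \<le> \<bar>ln \<bar>Y t \<omega> / sqrt (A k' t \<omega>)\<bar>\<bar>}" for t
    have ex: "((\<lambda>t. prob (Ex t)) \<longlongrightarrow> 0) at_top"
      unfolding Ex_def
    proof (rule std_normal_log_negligible[OF prob_space_axioms])
      fix t :: real assume t: "0 < t"
      show "(\<lambda>\<omega>. X t \<omega> / sqrt (A k t \<omega>)) \<in> borel_measurable M"
        using Am[OF t] Xm(1)[OF less_imp_le[OF t]]
        by (intro borel_measurable_divide borel_measurable_sqrt) auto
      show "distr M borel (\<lambda>\<omega>. X t \<omega> / sqrt (A k t \<omega>)) = std_normal_distribution"
        unfolding A_def using ito_integral_exp_self_normalized[OF W W1 W2 indep F Z, of 1] X[of t] t by simp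
    qed (use d in simp)
    have ey: "((\<lambda>t. prob (Ey t)) \<longlongrightarrow> 0) at_top"
      unfolding Ey_def
    proof (rule std_normal_log_negligible[OF prob_space_axioms])
      fix t :: real assume t: "0 < t"
      show "(\<lambda>\<omega>. Y t \<omega> / sqrt (A k' t \<omega>)) \<in> borel_measurable M"
        using Am[OF t] Xm(2)[OF less_imp_le[OF t]]
        by (intro borel_measurable_divide borel_measurable_sqrt) auto
      show "distr M borel (\<lambda>\<omega>. Y t \<omega> / sqrt (A k' t \<omega>)) = std_normal_distribution"
        unfolding A_def using ito_integral_exp_self_normalized[OF W W1 W2 indep F Z, of 2] Y[of t] t by simp
    qed (use d in simp)
    \<comment> \<open>If \<open>\<omega>\<close> lies outside both exceptional events, each coordinate moves by less than \<open>d / 2\<close>.\<close>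
    have "((\<lambda>t. prob (Ex t) + prob (Ey t)) \<longlongrightarrow> 0) at_top" using tendsto_add[OF ex ey] by simp
    then show "((\<lambda>t. prob {\<omega>\<in>space M. d \<le> dist (V t \<omega>) (V0 t \<omega>)}) \<longlongrightarrow> 0) at_top"
    proof (rule tendsto_sandwich[OF _ _ tendsto_const, rotated 2])
      show "\<forall>\<^sub>F t in at_top. 0 \<le> prob {\<omega>\<in>space M. d \<le> dist (V t \<omega>) (V0 t \<omega>)}" by simp
      show "\<forall>\<^sub>F t in at_top. prob {\<omega>\<in>space M. d \<le> dist (V t \<omega>) (V0 t \<omega>)} \<le> prob (Ex t) + prob (Ey t)"
        using eventually_gt_at_top[of 0]
      proof eventually_elim
        case (elim t)
        have [measurable]: "A k t \<in> borel_measurable M" "A k' t \<in> borel_measurable M" "X t \<in> borel_measurable M" "Y t \<in> borel_measurable M"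
          using elim by (auto intro: Am Xm)
        have E: "Ex t \<in> sets M" "Ey t \<in> sets M" unfolding Ex_def Ey_def by measurable
        have "{\<omega>\<in>space M. d \<le> dist (V t \<omega>) (V0 t \<omega>)} \<subseteq> Ex t \<union> Ey t"
        proof (rule subsetI, rule ccontr)
          fix \<omega> assume "\<omega> \<in> {\<omega>\<in>space M. d \<le> dist (V t \<omega>) (V0 t \<omega>)}" "\<omega> \<notin> Ex t \<union> Ey t"
          then have \<omega>: "\<omega> \<in> space M" "d \<le> dist (V t \<omega>) (V0 t \<omega>)" and n: "\<omega> \<notin> Ex t" "\<omega> \<notin> Ey t" by auto
          define dx where "dx = \<bar>(ln \<bar>X t \<omega>\<bar> - sx t) / sqrt t - (ln (A k t \<omega>) / 2 - sx t) / sqrt t\<bar>"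
          define dy where "dy = \<bar>(ln \<bar>Y t \<omega>\<bar> - sy t) / sqrt t - (ln (A k' t \<omega>) / 2 - sy t) / sqrt t\<bar>"
          have "dx < d / 2" unfolding dx_def
            using n(1) \<omega>(1) elim by (intro abs_log_ratio_le A_pos) (auto simp: Ex_def)
          moreover have "dy < d / 2" unfolding dy_def
            using n(2) \<omega>(1) elim by (intro abs_log_ratio_le A_pos) (auto simp: Ey_def)
          moreover have "dist (V t \<omega>) (V0 t \<omega>) = sqrt (dx\<^sup>2 + dy\<^sup>2)"
            using elim by (simp add: V_eq V0_eq dist_Pair_Pair dist_real_def dx_def dy_def)
          moreover have "sqrt (dx\<^sup>2 + dy\<^sup>2) \<le> dx + dy" by (rule sqrt_sum_squares_le_sum) (simp_all add: dx_def dy_def)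
          ultimately show False using \<omega>(2) by linarith
        qed
        then have "prob {\<omega>\<in>space M. d \<le> dist (V t \<omega>) (V0 t \<omega>)} \<le> prob (Ex t \<union> Ey t)"
          using E by (intro finite_measure_mono) auto
        also have "\<dots> \<le> prob (Ex t) + prob (Ey t)" using E by (intro measure_Un_le)
        finally show ?case .
      qed
    qed
  qed
  then show ?thesis unfolding V_def[abs_def] .
qed

section \<open>Pathwise growth of exponential functionals and the three regimes\<close>

lemma exp_functional_scaled:
  "exp_functional k (a * t) (\<lambda>s. sqrt t * w s) = integral {0..1} (\<lambda>s. exp (2 * (k * a * t * s + sqrt t * (k * w s))))"
  unfolding exp_functional_def by (intro arg_cong[where f="integral {0..1}"] ext) (simp add: algebra_simps)

text \<open>
  The growth lemmas for \<open>g = k w\<close>, in the shape in which \<open>log_ito_integrals_converge_in_law\<close> takes them.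
  The shift \<open>0\<close> and the drift \<open>0 * t\<close> are left unsimplified for this reason.
\<close>
lemma log_exp_functional_positive_drift:
  assumes "continuous_on {0..1} w" "0 < k * a"
  shows "((\<lambda>t. (ln (t * exp_functional k (a * t) (\<lambda>s. sqrt t * w s)) / 2 - k * a * t) / sqrt t) \<longlongrightarrow> k * w 1) at_top"
  unfolding exp_functional_scaled
  by (rule log_integral_exp_positive_drift[of "\<lambda>s. k * w s"]) (intro continuous_intros assms)+

lemma log_exp_functional_negative_drift:
  assumes "continuous_on {0..1} w" "k * a < 0" "w 0 = 0"
  shows "((\<lambda>t. (ln (t * exp_functional k (a * t) (\<lambda>s. sqrt t * w s)) / 2 - 0) / sqrt t) \<longlongrightarrow> 0) at_top"
  using log_integral_exp_negative_drift[of "\<lambda>s. k * w s" "k * a"] assms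
  unfolding exp_functional_scaled by (simp add: continuous_intros)

lemma log_exp_functional_no_drift:
  assumes "continuous_on {0..1} w" "s0 \<in> {0..1}" "\<And>s. s \<in> {0..1} \<Longrightarrow> k * w s \<le> k * w s0"
  shows "((\<lambda>t. (ln (t * exp_functional k (0 * t) (\<lambda>s. sqrt t * w s)) / 2 - 0) / sqrt t) \<longlongrightarrow> k * w s0) at_top"
  using log_integral_exp_no_drift[of "\<lambda>s. k * w s" s0] assms
  unfolding exp_functional_scaled by (simp add: continuous_intros)

lemma log_exp_functional_sup:
  assumes "continuous_on {0..1} w" "0 < k"
  shows "((\<lambda>t. (ln (t * exp_functional k (0 * t) (\<lambda>s. sqrt t * w s)) / 2 - 0) / sqrt t) \<longlongrightarrow> k * (SUP s\<in>{0..1}. w s)) at_top"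
proof -
  obtain s0 where s0: "s0 \<in> {0..1}" "\<And>s. s \<in> {0..1} \<Longrightarrow> w s \<le> w s0"
    using continuous_attains_sup[of "{0..1::real}" w] assms(1) by auto
  then have "(SUP s\<in>{0..1}. w s) = w s0" by (intro cSup_eq_maximum) auto
  then show ?thesis using log_exp_functional_no_drift[of w s0 k] assms s0 by simp
qed

lemma log_exp_functional_inf:
  assumes "continuous_on {0..1} w" "k < 0"
  shows "((\<lambda>t. (ln (t * exp_functional k (0 * t) (\<lambda>s. sqrt t * w s)) / 2 - 0) / sqrt t) \<longlongrightarrow> k * (INF s\<in>{0..1}. w s)) at_top"
proof -
  obtain s0 where s0: "s0 \<in> {0..1}" "\<And>s. s \<in> {0..1} \<Longrightarrow> w s0 \<le> w s"
    using continuous_attains_inf[of "{0..1::real}" w] assms(1) by auto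
  then have "(INF s\<in>{0..1}. w s) = w s0" by (intro cInf_eq_minimum) auto
  then show ?thesis using log_exp_functional_no_drift[of w s0 k] assms s0 by (simp add: mult_left_mono_neg)
qed

text \<open>
  Supplies measurability of the extrema of \<open>W\<close>: they are pointwise limits of logarithms of
  exponential functionals.
\<close>
lemma measurable_limit_log_exp_functional:
  assumes W: "brownian_motion M W"
    and lim: "\<And>\<omega>. \<omega> \<in> space M \<Longrightarrow>
      ((\<lambda>t. (ln (t * exp_functional k (a * t) (\<lambda>s. sqrt t * W s \<omega>)) / 2 - 0) / sqrt t) \<longlongrightarrow> l \<omega>) at_top"
  shows "l \<in> borel_measurable M"
proof (rule borel_measurable_LIMSEQ_real)
  fix n :: nat
  have c: "continuous_on {0..1} (\<lambda>s. sqrt (real n) * W s \<omega>)" if "\<omega> \<in> space M" for \<omega>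
    using brownian_motion_continuous_comp[OF W that, of 1] by (intro continuous_intros) simp
  have [measurable]: "(\<lambda>\<omega>. exp_functional k (a * real n) (\<lambda>s. sqrt (real n) * W s \<omega>)) \<in> borel_measurable M"
    by (intro exp_functional_measurable c borel_measurable_times brownian_motion_measurable[OF W]) auto
  show "(\<lambda>\<omega>. (ln (real n * exp_functional k (a * real n) (\<lambda>s. sqrt (real n) * W s \<omega>)) / 2 - 0) / sqrt (real n)) \<in> borel_measurable M"
    by measurable
next
  show "(\<lambda>n. (ln (real n * exp_functional k (a * real n) (\<lambda>s. sqrt (real n) * W s \<omega>)) / 2 - 0) / sqrt (real n)) \<longlonglongrightarrow> l \<omega>"
    if "\<omega> \<in> space M" for \<omega>
    using lim[OF that] filterlim_real_sequentially by (rule filterlim_compose)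
qed

theorem theorem3p2:
  fixes M :: "'a measure" and p q a :: real
    and W W1 W2 X Y Z :: "real \<Rightarrow> 'a \<Rightarrow> real"
    and F :: "real \<Rightarrow> 'a measure"
    and N Mmin Mmax :: "'a \<Rightarrow> real"
  assumes M: "prob_space M"
    and p: "p > 0" and q: "q > 0"
    and W: "brownian_motion M W"
    and W1: "brownian_motion M W1"
    and W2: "brownian_motion M W2"
    and indep: "indep_processes M (\<lambda>i. [W, W1, W2] ! i) {..<3}"
    and F: "F = natural_filtration M (\<lambda>s \<omega>. (W s \<omega>, W1 s \<omega>, W2 s \<omega>))"
    and Z: "\<And>t \<omega>. t \<ge> 0 \<Longrightarrow> Z t \<omega> = a * t + W t \<omega>"
    and X: "\<And>t. t \<ge> 0 \<Longrightarrow> has_ito_integral M F W1 (\<lambda>s \<omega>. exp (p * Z s \<omega>)) t (X t)"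
    and Y: "\<And>t. t \<ge> 0 \<Longrightarrow> has_ito_integral M F W2 (\<lambda>s \<omega>. exp (- q * Z s \<omega>)) t (Y t)"
    and N: "\<And>\<omega>. N \<omega> = W 1 \<omega>"
    and Mmin: "\<And>\<omega>. Mmin \<omega> = (INF t\<in>{0..1}. W t \<omega>)"
    and Mmax: "\<And>\<omega>. Mmax \<omega> = (SUP t\<in>{0..1}. W t \<omega>)"
  shows
    "(a > 0 \<longrightarrow>
        converges_in_law M
          (\<lambda>t \<omega>. (1 / sqrt t) *\<^sub>R (ln \<bar>X t \<omega>\<bar> - p * a * t, ln \<bar>Y t \<omega>\<bar>, Z t \<omega> - a * t))
          M (\<lambda>\<omega>. (p * N \<omega>, 0, N \<omega>)) at_top) \<and>
     (a < 0 \<longrightarrow>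
        converges_in_law M
          (\<lambda>t \<omega>. (1 / sqrt t) *\<^sub>R (ln \<bar>X t \<omega>\<bar>, ln \<bar>Y t \<omega>\<bar> + q * a * t, Z t \<omega> - a * t))
          M (\<lambda>\<omega>. (0, - q * N \<omega>, N \<omega>)) at_top) \<and>
     (a = 0 \<longrightarrow>
        converges_in_law M
          (\<lambda>t \<omega>. (1 / sqrt t) *\<^sub>R (ln \<bar>X t \<omega>\<bar>, ln \<bar>Y t \<omega>\<bar>, Z t \<omega>))
          M (\<lambda>\<omega>. (p * Mmax \<omega>, - q * Mmin \<omega>, N \<omega>)) at_top)"
proof -
  interpret prob_space M by (rule M)
  have W0: "AE \<omega> in M. W 0 \<omega> = 0" using W by (simp add: brownian_motion_def)
  have [measurable]: "W 1 \<in> borel_measurable M" by (rule brownian_motion_measurable[OF W]) simp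
  have cont: "continuous_on {0..1} (\<lambda>s. W s \<omega>)" if "\<omega> \<in> space M" for \<omega>
    using brownian_motion_continuous_comp[OF W that, of 1] by simp
  note conv = log_ito_integrals_converge_in_law[OF W W1 W2 indep F Z X Y]
  have pos: "AE \<omega> in M. ((\<lambda>t. (ln (t * exp_functional k (a * t) (\<lambda>s. sqrt t * W s \<omega>)) / 2 - k * a * t) / sqrt t) \<longlongrightarrow> k * W 1 \<omega>) at_top"
    if "0 < k * a" for k
    using AE_space by eventually_elim (rule log_exp_functional_positive_drift[OF cont that])
  have neg: "AE \<omega> in M. ((\<lambda>t. (ln (t * exp_functional k (a * t) (\<lambda>s. sqrt t * W s \<omega>)) / 2 - 0) / sqrt t) \<longlongrightarrow> 0) at_top"
    if "k * a < 0" for k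
    using AE_space W0 by eventually_elim (rule log_exp_functional_negative_drift[OF cont that])
  show ?thesis
  proof (intro conjI impI)
    assume a: "0 < a"
    have "0 < p * a" "- q * a < 0" using a p q by auto
    then have "converges_in_law M
      (\<lambda>t \<omega>. (1 / sqrt t) *\<^sub>R (ln \<bar>X t \<omega>\<bar> - p * a * t, ln \<bar>Y t \<omega>\<bar> - 0, Z t \<omega> - a * t))
      M (\<lambda>\<omega>. (p * W 1 \<omega>, 0, W 1 \<omega>)) at_top"
      by (intro conv pos neg) measurable
    then show "converges_in_law M
      (\<lambda>t \<omega>. (1 / sqrt t) *\<^sub>R (ln \<bar>X t \<omega>\<bar> - p * a * t, ln \<bar>Y t \<omega>\<bar>, Z t \<omega> - a * t))
      M (\<lambda>\<omega>. (p * N \<omega>, 0, N \<omega>)) at_top"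
      by (simp only: N diff_zero)
  next
    assume a: "a < 0"
    have "p * a < 0" "0 < - q * a" using a p q by (auto simp: mult_pos_neg)
    then have "converges_in_law M
      (\<lambda>t \<omega>. (1 / sqrt t) *\<^sub>R (ln \<bar>X t \<omega>\<bar> - 0, ln \<bar>Y t \<omega>\<bar> - - q * a * t, Z t \<omega> - a * t))
      M (\<lambda>\<omega>. (0, - q * W 1 \<omega>, W 1 \<omega>)) at_top"
      by (intro conv pos neg) measurable
    then show "converges_in_law M
      (\<lambda>t \<omega>. (1 / sqrt t) *\<^sub>R (ln \<bar>X t \<omega>\<bar>, ln \<bar>Y t \<omega>\<bar> + q * a * t, Z t \<omega> - a * t))
      M (\<lambda>\<omega>. (0, - q * N \<omega>, N \<omega>)) at_top"
      by (simp add: N)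
  next
    assume a: "a = 0"
    have X0: "((\<lambda>t. (ln (t * exp_functional p (a * t) (\<lambda>s. sqrt t * W s \<omega>)) / 2 - 0) / sqrt t) \<longlongrightarrow> p * Mmax \<omega>) at_top"
      if "\<omega> \<in> space M" for \<omega>
      using log_exp_functional_sup[OF cont[OF that] p] unfolding a Mmax .
    have Y0: "((\<lambda>t. (ln (t * exp_functional (- q) (a * t) (\<lambda>s. sqrt t * W s \<omega>)) / 2 - 0) / sqrt t) \<longlongrightarrow> - q * Mmin \<omega>) at_top"
      if "\<omega> \<in> space M" for \<omega>
      using log_exp_functional_inf[OF cont[OF that], of "- q"] q unfolding a Mmin by simp
    have mx: "(\<lambda>\<omega>. p * Mmax \<omega>) \<in> borel_measurable M" and my: "(\<lambda>\<omega>. - q * Mmin \<omega>) \<in> borel_measurable M"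
      using X0 Y0 by (blast intro: measurable_limit_log_exp_functional[OF W])+
    have "converges_in_law M
      (\<lambda>t \<omega>. (1 / sqrt t) *\<^sub>R (ln \<bar>X t \<omega>\<bar> - 0, ln \<bar>Y t \<omega>\<bar> - 0, Z t \<omega> - a * t))
      M (\<lambda>\<omega>. (p * Mmax \<omega>, - q * Mmin \<omega>, W 1 \<omega>)) at_top"
      by (intro conv AE_I2 X0 Y0 mx my)
    then show "converges_in_law M
      (\<lambda>t \<omega>. (1 / sqrt t) *\<^sub>R (ln \<bar>X t \<omega>\<bar>, ln \<bar>Y t \<omega>\<bar>, Z t \<omega>))
      M (\<lambda>\<omega>. (p * Mmax \<omega>, - q * Mmin \<omega>, N \<omega>)) at_top"
      by (simp add: N a)
  qed
qed

end
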